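(* Let $k$ be a positive integer and let $a\in M_k$ be Hermitian, with distinct eigenvalues $\xi_1,\dots,\xi_m$ whose eigenspaces have dimensions $D_1\ge D_2\ge\cdots\ge D_m$ respectively. Let $\sigma(a)\ge0$ be given by $\sigma(a)^2=\tau(a^2)-\tau(a)^2$, let $t\in(0,1]$, and let $L^-,L^+\in\mathbb{R}$ satisfy $L^-\le a\le L^+$. Put $$\beta:=\max\Big\{\big|tL^+ +2\sigma(a)\sqrt{t(1-t)}+(1-t)\tau(a)\big|,\ \big|tL^- -2\sigma(a)\sqrt{t(1-t)}+(1-t)\tau(a)\big|\Big\}.$$ (1) If $D_1\le k(1-t)$, then the measure $\mu_a^{\boxplus 1/t}$ has no atoms, and $\|a\|_{(t)}\le\beta$. (2) If all the eigenvalues of $a$ are different (i.e. $m=k$) and $t\le 1-\frac1k$, then $\|a\|_{(t)}\le\beta$. If, in addition, $\tau(a)=0$, then with $L=\|a\|$ (operator norm), $$\|a\|_{(t)}\le tL+2\sigma(a)\sqrt{t(1-t)}.$$ (3) If $D_1>k(1-t)$, then the measure $\mu_a^{\boxplus1/t}$ has atoms, and $$\|a\|_{(t)}\le\max\{\xi_{i_0},\ \beta\},\qquad\text{where } \xi_{i_0}=\max\{\xi_i:\ D_i>k(1-t)\}.$$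
   Context: Let $\mathcal{A}$ be a $II_1$ factor with faithful normal tracial state $\tau$ ($\tau(1)=1$). $M_k\subset\mathcal{A}$ denotes a $k$-dimensional abelian subalgebra spanned by $k$ mutually orthogonal self-adjoint projections, each of trace $1/k$ (and summing to $1$); Hermitian elements of $M_k$ are identified with real vectors $(a_1,\dots,a_k)\in\mathbb{R}^k$, equivalently real diagonal $k\times k$ matrices, so $\tau(a)=\frac1k\sum_i a_i$, the eigenvalues of $a$ are the distinct values among the $a_i$, and the dimension of the eigenspace of $\xi$ is $\#\{i:a_i=\xi\}$. For $a=a^*$, $\mu_a$ is the spectral distribution of $a$ with respect to $\tau$; for $a\in M_k$, $\mu_a=\frac1k\sum_{i=1}^k\delta_{a_i}$. For $t\in(0,1]$ let $p_t\in\mathcal{A}$ be a projection with $\tau(p_t)=t$ that is free (in Voiculescu's sense, with respect to $\tau$) from $M_k$. The $(t)$-norm of $a$ is $\|a\|_{(t)}:=\|p_tap_t\|_\infty$ (operator norm). For a probability measure $\mu$ on $\mathbb{R}$ and $T\ge1$, $\mu^{\boxplus T}$ denotes the free additive convolution power: the unique probability measure on $\mathbb{R}$ whose Voiculescu transform is $\varphi_{\mu^{\boxplus T}}=T\varphi_\mu$, where $\varphi_\mu(z)=F_\mu^{-1}(z)-z$, $F_\mu=1/G_\mu$, $G_\mu(z)=\int_{\mathbb{R}}\frac{d\mu(s)}{z-s}$ (the equality holding on a truncated cone $\{x+iy: y>M,\ |x|<\eta y\}$ where both sides are defined). Equivalently (Nica–Speicher), $\mu_a^{\boxplus 1/t}$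 is the distribution of $t^{-1}p_tap_t$ in the compressed space $(p_t\mathcal{A}p_t,\,t^{-1}\tau)$. *)

theory Defs
  imports "HOL-Probability.Probability"
begin

section \<open>Complex Hilbert spaces and their bounded operators\<close>

text \<open>
  The inner product is linear in the second argument.  Positive definiteness is inherited from
  the norm, completeness from \<^class>\<open>banach\<close>.
\<close>

class chilbert_space = banach +
  fixes scaleC :: "complex \<Rightarrow> 'a \<Rightarrow> 'a"
    and cinner :: "'a \<Rightarrow> 'a \<Rightarrow> complex"
  assumes scaleC_add_right: "scaleC c (x + y) = scaleC c x + scaleC c y"
    and scaleC_add_left: "scaleC (c + d) x = scaleC c x + scaleC d x"
    and scaleC_scaleC: "scaleC c (scaleC d x) = scaleC (c * d) x"
    and scaleC_of_real: "scaleC (complex_of_real r) x = r *\<^sub>R x"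
    and cinner_commute: "cinner x y = cnj (cinner y x)"
    and cinner_add_right: "cinner x (y + z) = cinner x y + cinner x z"
    and cinner_scaleC_right: "cinner x (scaleC c y) = c * cinner x y"
    and cinner_self: "cinner x x = complex_of_real ((norm x)\<^sup>2)"

lemma norm_scaleC: "norm (scaleC c (x::'h::chilbert_space)) = cmod c * norm x"
proof -
  have "cinner (scaleC c x) x = cnj (c * cinner x x)"
    by (metis cinner_commute cinner_scaleC_right)
  then have "cinner (scaleC c x) (scaleC c x) = (c * cnj c) * cinner x x"
    using cinner_scaleC_right[of "scaleC c x" c x] by (simp flip: cinner_commute)
  also have "\<dots> = complex_of_real ((cmod c * norm x)\<^sup>2)"
    using complex_norm_square[of c] by (simp add: cinner_self power_mult_distrib)
  finally have "(norm (scaleC c x))\<^sup>2 = (cmod c * norm x)\<^sup>2"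
    by (metis cinner_self of_real_eq_iff)
  then show ?thesis
    by (simp add: power2_eq_iff_nonneg)
qed

lemma bounded_linear_scaleC: "bounded_linear (scaleC c :: 'h::chilbert_space \<Rightarrow> 'h)"
proof (rule bounded_linear_intro[where K = "cmod c"])
  fix x y :: 'h and r :: real
  show "scaleC c (x + y) = scaleC c x + scaleC c y"
    by (rule scaleC_add_right)
  show "scaleC c (r *\<^sub>R x) = r *\<^sub>R scaleC c x"
    by (metis mult.commute scaleC_of_real scaleC_scaleC)
  show "norm (scaleC c x) \<le> norm x * cmod c"
    by (simp add: norm_scaleC mult.commute)
qed

text \<open>
  A bounded operator is a real-bounded-linear map \<^typ>\<open>'h \<Rightarrow>\<^sub>L 'h\<close> (whose norm is the operator
  norm) that commutes with all complex scalars.  The complex multiple \<open>c T\<close> of an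
  operator is written as the composition \<open>scalar_op c o\<^sub>L T\<close>.
\<close>

type_synonym 'h op = "'h \<Rightarrow>\<^sub>L 'h"

definition scalar_op :: "complex \<Rightarrow> 'h::chilbert_space op"
  where "scalar_op c = Blinfun (scaleC c)"

lemma scalar_op_apply: "blinfun_apply (scalar_op c) x = scaleC c x"
  by (simp add: scalar_op_def bounded_linear_Blinfun_apply bounded_linear_scaleC)

definition bounded_ops :: "'h::chilbert_space op set"
  where "bounded_ops = {T. \<forall>c x. blinfun_apply T (scaleC c x) = scaleC c (blinfun_apply T x)}"

text \<open>\<open>is_adjoint T S\<close> says \<open>S = T*\<close>; such an \<open>S\<close> is unique.\<close>

definition is_adjoint :: "'h::chilbert_space op \<Rightarrow> 'h op \<Rightarrow> bool"
  where "is_adjoint T S \<longleftrightarrow>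
    (\<forall>x y. cinner (blinfun_apply T x) y = cinner x (blinfun_apply S y))"

abbreviation self_adjoint :: "'h::chilbert_space op \<Rightarrow> bool"
  where "self_adjoint T \<equiv> is_adjoint T T"

definition is_projection :: "'h::chilbert_space op \<Rightarrow> bool"
  where "is_projection P \<longleftrightarrow> self_adjoint P \<and> P o\<^sub>L P = P"

definition op_le :: "'h::chilbert_space op \<Rightarrow> 'h op \<Rightarrow> bool"
  where "op_le T U \<longleftrightarrow> (\<forall>x. cinner x (blinfun_apply (U - T) x) \<in> \<real>\<^sub>\<ge>\<^sub>0)"


section \<open>Factors of type II1 and their trace\<close>

definition commutant :: "'h::chilbert_space op set \<Rightarrow> 'h op set"
  where "commutant S = {T \<in> bounded_ops. \<forall>U\<in>S. T o\<^sub>L U = U o\<^sub>L T}"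

definition von_neumann_algebra :: "'h::chilbert_space op set \<Rightarrow> bool"
  where "von_neumann_algebra A \<longleftrightarrow>
    A \<subseteq> bounded_ops \<and> (\<forall>T\<in>A. \<exists>S\<in>A. is_adjoint T S) \<and> commutant (commutant A) = A"

definition vn_factor :: "'h::chilbert_space op set \<Rightarrow> bool"
  where "vn_factor A \<longleftrightarrow> von_neumann_algebra A \<and> A \<inter> commutant A = range scalar_op"

text \<open>
  In a factor the abelian projections are the minimal ones, so type II means that there is no
  minimal projection together with the presence of a finite projection; the index 1 means that
  the identity is finite, i.e. every isometry of the algebra is unitary.
\<close>

definition II1_factor :: "'h::chilbert_space op set \<Rightarrow> bool"
  where "II1_factor A \<longleftrightarrow> vn_factor A
    \<and> (\<forall>P\<in>A. is_projection P \<and> P \<noteq> 0 \<longrightarrow>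
          (\<exists>Q\<in>A. is_projection Q \<and> Q \<noteq> 0 \<and> Q \<noteq> P \<and> op_le Q P))
    \<and> (\<forall>V\<in>A. \<forall>W\<in>A. is_adjoint V W \<and> W o\<^sub>L V = id_blinfun \<longrightarrow> V o\<^sub>L W = id_blinfun)"

definition tracial_state :: "'h::chilbert_space op set \<Rightarrow> ('h op \<Rightarrow> complex) \<Rightarrow> bool"
  where "tracial_state A \<tau> \<longleftrightarrow>
      (\<forall>T\<in>A. \<forall>U\<in>A. \<tau> (T + U) = \<tau> T + \<tau> U)
    \<and> (\<forall>c. \<forall>T\<in>A. \<tau> (scalar_op c o\<^sub>L T) = c * \<tau> T)
    \<and> (\<forall>T\<in>A. \<forall>S\<in>A. is_adjoint T S \<longrightarrow> \<tau> (S o\<^sub>L T) \<in> \<real>\<^sub>\<ge>\<^sub>0)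
    \<and> \<tau> id_blinfun = 1
    \<and> (\<forall>T\<in>A. \<forall>U\<in>A. \<tau> (T o\<^sub>L U) = \<tau> (U o\<^sub>L T))"

definition faithful_on :: "'h::chilbert_space op set \<Rightarrow> ('h op \<Rightarrow> complex) \<Rightarrow> bool"
  where "faithful_on A \<tau> \<longleftrightarrow>
    (\<forall>T\<in>A. \<forall>S\<in>A. is_adjoint T S \<and> \<tau> (S o\<^sub>L T) = 0 \<longrightarrow> T = 0)"

text \<open>Normality: suprema of bounded increasing nets of self-adjoint elements are preserved.\<close>

definition normal_on :: "'h::chilbert_space op set \<Rightarrow> ('h op \<Rightarrow> complex) \<Rightarrow> bool"
  where "normal_on A \<tau> \<longleftrightarrow>
    (\<forall>S s. S \<noteq> {} \<and> S \<subseteq> {T \<in> A. self_adjoint T}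
      \<and> (\<forall>T\<in>S. \<forall>U\<in>S. \<exists>V\<in>S. op_le T V \<and> op_le U V)
      \<and> s \<in> A \<and> self_adjoint s \<and> (\<forall>T\<in>S. op_le T s)
      \<and> (\<forall>u\<in>A. self_adjoint u \<and> (\<forall>T\<in>S. op_le T u) \<longrightarrow> op_le s u)
      \<longrightarrow> Re (\<tau> s) = (SUP T\<in>S. Re (\<tau> T)))"


section \<open>Freeness, the algebra spanned by equal-trace projections, compressions\<close>

definition star_subalgebra :: "'h::chilbert_space op set \<Rightarrow> bool"
  where "star_subalgebra B \<longleftrightarrow> B \<subseteq> bounded_ops \<and> range scalar_op \<subseteq> B
    \<and> (\<forall>T\<in>B. \<forall>U\<in>B. T + U \<in> B \<and> T o\<^sub>L U \<in> B)
    \<and> (\<forall>T\<in>B. \<exists>S\<in>B. is_adjoint T S)"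

text \<open>
  Two sets are free if the unital *-algebras they generate are free: every alternating product
  of centred elements is centred.  The Boolean \<open>c i\<close> records which algebra the \<open>i\<close>-th factor
  comes from.
\<close>

definition free_sets ::
    "('h::chilbert_space op \<Rightarrow> complex) \<Rightarrow> 'h op set \<Rightarrow> 'h op set \<Rightarrow> bool"
  where "free_sets \<tau> S1 S2 \<longleftrightarrow>
    (\<forall>n>0. \<forall>(c :: nat \<Rightarrow> bool) x.
      (\<forall>i<n. x i \<in> star_subalgebra hull (if c i then S1 else S2) \<and> \<tau> (x i) = 0)
      \<and> (\<forall>i. Suc i < n \<longrightarrow> c i \<noteq> c (Suc i))
      \<longrightarrow> \<tau> (foldr (\<lambda>i T. x i o\<^sub>L T) [0..<n] id_blinfun) = 0)"

definition equal_trace_partition ::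
    "'h::chilbert_space op set \<Rightarrow> ('h op \<Rightarrow> complex) \<Rightarrow> nat \<Rightarrow> (nat \<Rightarrow> 'h op) \<Rightarrow> bool"
  where "equal_trace_partition A \<tau> k e \<longleftrightarrow>
      (\<forall>i<k. e i \<in> A \<and> is_projection (e i) \<and> \<tau> (e i) = 1 / of_nat k)
    \<and> (\<forall>i<k. \<forall>j<k. i \<noteq> j \<longrightarrow> e i o\<^sub>L e j = 0)
    \<and> (\<Sum>i<k. e i) = id_blinfun"

text \<open>The abelian algebra \<open>M\<^sub>k\<close> spanned by the projections \<open>e 0, \<dots>, e (k - 1)\<close>.\<close>

definition diag_algebra :: "nat \<Rightarrow> (nat \<Rightarrow> 'h::chilbert_space op) \<Rightarrow> 'h op set"
  where "diag_algebra k e = {(\<Sum>i<k. scalar_op (c i) o\<^sub>L e i) | c. True}"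

definition compression_norm :: "'h::chilbert_space op \<Rightarrow> 'h op \<Rightarrow> real"
  where "compression_norm p a = norm (p o\<^sub>L a o\<^sub>L p)"


section \<open>Free additive convolution powers\<close>

definition cauchy_transform :: "real measure \<Rightarrow> complex \<Rightarrow> complex"
  where "cauchy_transform \<mu> z = (LINT s|\<mu>. 1 / (z - complex_of_real s))"

definition F_transform :: "real measure \<Rightarrow> complex \<Rightarrow> complex"
  where "F_transform \<mu> z = 1 / cauchy_transform \<mu> z"

definition truncated_cone :: "real \<Rightarrow> real \<Rightarrow> complex set"
  where "truncated_cone \<eta> M = {z. Im z > M \<and> \<bar>Re z\<bar> < \<eta> * Im z}"

text \<open>
  For every probability measure \<open>\<mu>\<close> the function \<^term>\<open>F_transform \<mu>\<close> is injective on some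
  truncated cone, and its image contains a truncated cone.  The Voiculescu transform
  \<open>F\<^sup>-\<^sup>1(z) - z\<close> uses the inverse with values in the former cone \<open>\<Gamma>\<close>.  This choice of
  branch matters: \<^term>\<open>F_transform \<mu>\<close> need not be injective on the upper half plane.
  By analytic continuation, two choices of \<open>\<Gamma>\<close> give the same function on every truncated cone
  where both are defined.
\<close>

definition voiculescu_domain :: "real measure \<Rightarrow> complex set \<Rightarrow> complex set \<Rightarrow> bool"
  where "voiculescu_domain \<mu> \<Gamma> \<Delta> \<longleftrightarrow>
    (\<exists>\<eta>>0. \<exists>M>0. \<Gamma> = truncated_cone \<eta> M) \<and>
    inj_on (F_transform \<mu>) \<Gamma> \<and> \<Delta> \<subseteq> F_transform \<mu> ` \<Gamma>"

definition voiculescu_transform :: "real measure \<Rightarrow> complex set \<Rightarrow> complex \<Rightarrow> complex"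
  where "voiculescu_transform \<mu> \<Gamma> z = the_inv_into \<Gamma> (F_transform \<mu>) z - z"

definition is_free_power :: "real measure \<Rightarrow> real \<Rightarrow> real measure \<Rightarrow> bool"
  where "is_free_power \<mu> T \<nu> \<longleftrightarrow> prob_space \<nu> \<and> sets \<nu> = sets borel \<and>
    (\<exists>\<eta>>0. \<exists>M>0. \<exists>\<Gamma> \<Gamma>'.
      voiculescu_domain \<mu> \<Gamma> (truncated_cone \<eta> M) \<and>
      voiculescu_domain \<nu> \<Gamma>' (truncated_cone \<eta> M) \<and>
      (\<forall>z\<in>truncated_cone \<eta> M.
        voiculescu_transform \<nu> \<Gamma>' z = complex_of_real T * voiculescu_transform \<mu> \<Gamma> z))"

definition free_power :: "real measure \<Rightarrow> real \<Rightarrow> real measure"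
  where "free_power \<mu> T = (THE \<nu>. is_free_power \<mu> T \<nu>)"

text \<open>\<open>(1/k) \<Sum>\<^sub>i \<delta>\<^bsub>\<alpha> i\<^esub>\<close>, the spectral distribution of \<open>\<Sum>\<^sub>i \<alpha> i e i\<close>.\<close>

definition diag_distribution :: "nat \<Rightarrow> (nat \<Rightarrow> real) \<Rightarrow> real measure"
  where "diag_distribution k \<alpha> = distr (uniform_count_measure {..<k}) borel \<alpha>"

end

theory Submission
  imports Defs "HOL-Complex_Analysis.Complex_Analysis" "HOL-Real_Asymp.Real_Asymp"
begin

text \<open>
  Let \<open>G\<close> be the Cauchy transform of the distribution of \<open>a\<close>, \<open>F = 1 / G\<close> and
  \<open>H w = T w - (T - 1) F w\<close> with \<open>T = 1 / t\<close>. The map \<open>H\<close> is injective on the part of the upper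
  half plane that it sends into the upper half plane, and by Brouwer's theorem it is onto; with
  \<open>\<omega>\<close> its inverse, \<open>G (\<omega> z)\<close> is the Cauchy transform of the free power. The point masses are
  read off by comparing the nontangential limits of \<open>(z - x) G z\<close> for the two measures.

  The norm bound does not use the free power. On the real axis right of the spectrum of \<open>a\<close>, the
  resolvent of the compression at \<open>lam w = t H w\<close> factors through \<open>1 - u v\<close> with \<open>u\<close>, \<open>v\<close>
  centred and free. Freeness makes the 2-norms of the powers of \<open>u v\<close> geometric, with ratio below
  one exactly as long as \<open>lam' w > 0\<close>. So the trace of the resolvent is \<open>G w\<close>, expressed through
  \<open>lam\<close>, and stays bounded wherever \<open>lam\<close> is increasing, which covers everything above the bound.
  Since the trace is faithful, the resolvent of \<open>p a p\<close> cannot blow up there.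
\<close>

section \<open>The reciprocal Cauchy transform of a uniform measure\<close>

text \<open>The pivot is \<open>dev w\<close>, the centred function
  \<open>F w / (w - \<alpha> i) - 1\<close>, with mean square \<open>\<kappa> w\<close>. Both halves
  of the proof run on the condition \<open>\<kappa> w * (T - 1) < 1\<close>: on the upper half plane
  it says that \<open>H w\<close> has positive imaginary part, on the real axis that
  \<open>lam\<close> is increasing. The free power is defined through Voiculescu transforms on
  cones, which do not mention \<open>p a p\<close>; this is why the norm estimate works with the
  operators directly. The constant \<open>2 * \<sigma> * sqrt (t * (1 - t))\<close> comes from a
  minimisation. Right of a bound \<open>L\<close> for the eigenvalues, \<open>lam w\<close> is at
  most \<open>t w + (1 - t) mean + (1 - t) var / (w - L)\<close>; this is least at
  \<open>w - L = sqrt (var (1 - t) / t)\<close>, and its value there is the claimed bound. Beyond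
  that same point the estimate of \<open>\<kappa>\<close> makes \<open>lam\<close> increasing. The
  operator norm of \<open>u v\<close> may exceed 1 even where the 2-norms of its powers decay, so a
  Neumann series need not converge in norm. Traces of resolvents are computed instead, and the norm
  is recovered from the growth of moments.\<close>

locale uniform_atoms =
  fixes k :: nat and \<alpha> :: "nat \<Rightarrow> real"
  assumes k_pos: "k > 0"
begin

definition avg :: "(nat \<Rightarrow> 'a::real_normed_field) \<Rightarrow> 'a"
  where "avg g = (\<Sum>i<k. g i) / of_nat k"

definition mean :: real where "mean = avg \<alpha>"

definition var :: real where "var = avg (\<lambda>i. (\<alpha> i - mean)\<^sup>2)"

text \<open>Polymorphic, because the free power needs complex arguments in the upper half plane
  while the norm bound needs real arguments right of the spectrum.\<close>

definition G :: "'a::real_normed_field \<Rightarrow> 'a"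
  where "G w = avg (\<lambda>i. 1 / (w - of_real (\<alpha> i)))"

definition F :: "'a::real_normed_field \<Rightarrow> 'a"
  where "F w = 1 / G w"

text \<open>The diagonal of \<open>F w (w - a)^-1 - 1\<close>; the factor \<open>F w\<close>
  normalises the resolvent to have trace 1, so \<open>dev\<close> has mean zero.\<close>

definition dev :: "'a::real_normed_field \<Rightarrow> nat \<Rightarrow> 'a"
  where "dev w i = F w / (w - of_real (\<alpha> i)) - 1"

definition \<kappa> :: "'a::real_normed_field \<Rightarrow> real"
  where "\<kappa> w = avg (\<lambda>i. (norm (dev w i))\<^sup>2)"

definition regular :: "'a::real_normed_field \<Rightarrow> bool"
  where "regular w \<longleftrightarrow> (\<forall>i<k. w \<noteq> of_real (\<alpha> i)) \<and> G w \<noteq> 0"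

section \<open>Averages over the atoms\<close>

lemma avg_add: "avg (\<lambda>i. g i + h i) = avg g + avg h"
  by (simp add: avg_def sum.distrib add_divide_distrib)

lemma avg_diff: "avg (\<lambda>i. g i - h i) = avg g - avg h"
  by (simp add: avg_def sum_subtractf diff_divide_distrib)

lemma avg_mult_left: "avg (\<lambda>i. c * g i) = c * avg g"
  by (simp add: avg_def sum_distrib_left)

lemma avg_mult_right: "avg (\<lambda>i. g i * c) = avg g * c"
  by (simp add: avg_def sum_distrib_right)

lemma avg_const [simp]: "avg (\<lambda>i. c) = c"
  using k_pos by (simp add: avg_def)

lemma avg_cong: "(\<And>i. i < k \<Longrightarrow> g i = h i) \<Longrightarrow> avg g = avg h"
  by (simp add: avg_def)

lemma avg_of_real: "avg (\<lambda>i. of_real (g i)) = of_real (avg g)"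
  by (simp add: avg_def)

lemma avg_mono: "(\<And>i. i < k \<Longrightarrow> g i \<le> h i) \<Longrightarrow> avg g \<le> (avg h :: real)"
  by (auto simp: avg_def intro!: divide_right_mono sum_mono)

lemma avg_nonneg: "(\<And>i. i < k \<Longrightarrow> 0 \<le> g i) \<Longrightarrow> 0 \<le> (avg g :: real)"
  using avg_mono[of "\<lambda>_. 0" g] by simp

lemma avg_pos: "(\<And>i. i < k \<Longrightarrow> 0 < g i) \<Longrightarrow> 0 < (avg g :: real)"
  using k_pos by (auto simp: avg_def intro!: divide_pos_pos sum_pos)

lemma norm_avg_le: "norm (avg g) \<le> avg (\<lambda>i. norm (g i))"
  by (auto simp: avg_def norm_divide intro!: divide_right_mono norm_sum)

lemma avg_cauchy_schwarz: "(avg (\<lambda>i. g i * h i))\<^sup>2 \<le> avg (\<lambda>i. (g i)\<^sup>2) * (avg (\<lambda>i. (h i)\<^sup>2) :: real)"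
  using Cauchy_Schwarz_ineq_sum[of g h "{..<k}"] k_pos
  by (auto simp: avg_def power_divide power2_eq_square[of "of_nat k"] intro!: divide_right_mono)

lemma var_nonneg: "var \<ge> 0"
  unfolding var_def by (rule avg_nonneg) simp

lemma var_eq: "var = avg (\<lambda>i. (\<alpha> i)\<^sup>2) - mean\<^sup>2"
proof -
  have "var = avg (\<lambda>i. (\<alpha> i)\<^sup>2 - (2 * mean) * \<alpha> i + mean\<^sup>2)"
    unfolding var_def by (simp add: power2_diff algebra_simps)
  also have "\<dots> = avg (\<lambda>i. (\<alpha> i)\<^sup>2) - (2 * mean) * mean + mean\<^sup>2"
    by (simp only: avg_add avg_diff avg_mult_left avg_const flip: mean_def)
  finally show ?thesis by (simp add: power2_eq_square)
qed

lemma \<kappa>_nonneg: "\<kappa> w \<ge> 0"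
  unfolding \<kappa>_def by (rule avg_nonneg) simp

section \<open>Difference formula for \<open>F\<close> and its distance from the identity\<close>

lemma dev_eq:
  assumes "regular w" "i < k"
  shows "(w - of_real (\<alpha> i)) * (1 + dev w i) = F w"
  using assms by (simp add: dev_def regular_def)

lemma avg_dev:
  assumes "regular w"
  shows "avg (dev w) = 0"
proof -
  have "dev w = (\<lambda>i. F w * (1 / (w - of_real (\<alpha> i))) - 1)"
    by (simp add: fun_eq_iff dev_def)
  then have "avg (dev w) = F w * G w - 1"
    by (simp only: avg_diff avg_mult_left avg_const G_def)
  then show ?thesis using assms by (simp add: F_def regular_def)
qed

text \<open>The resolvent identity writes \<open>G w' - G w\<close> as \<open>w - w'\<close> times
  the mean product of the two kernels, and multiplying by \<open>F w * F w'\<close> turns each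
  kernel into \<open>1 + dev\<close>. Because \<open>dev\<close> has mean zero, the cross terms
  vanish. The formula for \<open>Im F\<close> and the injectivity proofs for \<open>H\<close> and
  \<open>F\<close> all start here.\<close>

lemma F_diff:
  assumes "regular w" "regular w'"
  shows "F w - F w' = (w - w') * (1 + avg (\<lambda>i. dev w i * dev w' i))"
proof -
  have "avg (\<lambda>i. dev w i * dev w' i)
      = avg (\<lambda>i. F w * F w' * (1 / ((w - of_real (\<alpha> i)) * (w' - of_real (\<alpha> i)))) - dev w i - dev w' i - 1)"
    by (rule avg_cong) (simp add: dev_def algebra_simps)
  also have "\<dots> = F w * F w' * avg (\<lambda>i. 1 / ((w - of_real (\<alpha> i)) * (w' - of_real (\<alpha> i)))) - 1"
    using avg_dev[OF assms(1)] avg_dev[OF assms(2)] by (simp only: avg_diff avg_mult_left avg_const) simp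
  finally have 1: "1 + avg (\<lambda>i. dev w i * dev w' i)
      = F w * F w' * avg (\<lambda>i. 1 / ((w - of_real (\<alpha> i)) * (w' - of_real (\<alpha> i))))" by simp
  have "(w - w') * avg (\<lambda>i. 1 / ((w - of_real (\<alpha> i)) * (w' - of_real (\<alpha> i)))) = G w' - G w"
    unfolding G_def avg_diff[symmetric] avg_mult_left[symmetric]
    using assms by (intro avg_cong) (simp add: regular_def field_simps)
  then have "(w - w') * (1 + avg (\<lambda>i. dev w i * dev w' i)) = F w * F w' * (G w' - G w)"
    unfolding 1 by (simp only: mult.left_commute[of "w - w'" "F w * F w'"])
  also have "\<dots> = F w - F w'"
    using assms by (simp add: F_def regular_def field_simps)
  finally show ?thesis by simp
qed

text \<open>Average \<open>dev_eq\<close> over the atoms: as \<open>dev\<close> has mean zero, it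
  pairs only with the fluctuation of \<alpha> about its mean. Cauchy-Schwarz then brings in the
  variance.\<close>

lemma F_minus_id:
  assumes "regular w"
  shows "F w - w + of_real mean = - avg (\<lambda>i. of_real (\<alpha> i - mean) * dev w i)"
proof -
  have "avg (\<lambda>i. (w - of_real (\<alpha> i)) * (1 + dev w i)) = F w"
    using avg_cong[of "\<lambda>i. (w - of_real (\<alpha> i)) * (1 + dev w i)" "\<lambda>_. F w"] dev_eq[OF assms] by simp
  moreover have "avg (\<lambda>i. (w - of_real (\<alpha> i)) * (1 + dev w i))
     = avg (\<lambda>i. w - of_real (\<alpha> i) + (w - of_real mean) * dev w i - of_real (\<alpha> i - mean) * dev w i)"
    by (simp add: algebra_simps)
  moreover have "\<dots> = w - of_real mean - avg (\<lambda>i. of_real (\<alpha> i - mean) * dev w i)"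
    unfolding avg_diff avg_add avg_mult_left using avg_dev[OF assms]
    by (simp add: avg_of_real mean_def)
  ultimately show ?thesis by (simp add: algebra_simps)
qed

lemma F_minus_id_sq:
  assumes "regular w"
  shows "(norm (F w - w + of_real mean))\<^sup>2 \<le> var * \<kappa> w"
proof -
  have "norm (F w - w + of_real mean) \<le> avg (\<lambda>i. \<bar>\<alpha> i - mean\<bar> * norm (dev w i))"
    using norm_avg_le[of "\<lambda>i. of_real (\<alpha> i - mean) * dev w i"]
    by (simp only: F_minus_id[OF assms] norm_minus_cancel norm_mult norm_of_real)
  then have "(norm (F w - w + of_real mean))\<^sup>2 \<le> (avg (\<lambda>i. \<bar>\<alpha> i - mean\<bar> * norm (dev w i)))\<^sup>2"
    by (simp add: power_mono)
  also have "\<dots> \<le> var * \<kappa> w"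
    using avg_cauchy_schwarz[of "\<lambda>i. \<bar>\<alpha> i - mean\<bar>" "\<lambda>i. norm (dev w i)"]
    by (simp add: var_def \<kappa>_def)
  finally show ?thesis .
qed

lemma norm_avg_dev_mult: "norm (avg (\<lambda>i. dev w i * dev w' i)) \<le> (\<kappa> w + \<kappa> w') / 2"
proof -
  have "norm (avg (\<lambda>i. dev w i * dev w' i)) \<le> avg (\<lambda>i. norm (dev w i) * norm (dev w' i))"
    using norm_avg_le[of "\<lambda>i. dev w i * dev w' i"] by (simp add: norm_mult)
  also have "\<dots> \<le> avg (\<lambda>i. ((norm (dev w i))\<^sup>2 + (norm (dev w' i))\<^sup>2) * (1/2))"
  proof (rule avg_mono)
    fix i
    show "norm (dev w i) * norm (dev w' i) \<le> ((norm (dev w i))\<^sup>2 + (norm (dev w' i))\<^sup>2) * (1/2)"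
      using sum_squares_bound[of "norm (dev w i)" "norm (dev w' i)"] by simp
  qed
  also have "\<dots> = (\<kappa> w + \<kappa> w') / 2"
    by (simp only: avg_mult_right avg_add \<kappa>_def)
  finally show ?thesis .
qed

section \<open>Derivatives, and estimates on the real axis\<close>

lemma has_field_derivative_G:
  assumes "\<forall>i<k. w \<noteq> of_real (\<alpha> i)"
  shows "(G has_field_derivative - avg (\<lambda>i. 1 / (w - of_real (\<alpha> i))\<^sup>2)) (at w)"
  unfolding G_def[abs_def] avg_def using assms
  by (auto intro!: derivative_eq_intros simp: sum_negf power2_eq_square simp flip: sum_divide_distrib)
    (use k_pos in simp)

lemma has_field_derivative_F:
  assumes "regular w"
  shows "(F has_field_derivative 1 + avg (\<lambda>i. (dev w i)\<^sup>2)) (at w)"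
proof -
  have "avg (\<lambda>i. (dev w i)\<^sup>2)
      = avg (\<lambda>i. (F w)\<^sup>2 * (1 / (w - of_real (\<alpha> i))\<^sup>2) - 2 * dev w i - 1)"
    by (rule avg_cong) (simp add: dev_def power2_eq_square algebra_simps)
  also have "\<dots> = (F w)\<^sup>2 * avg (\<lambda>i. 1 / (w - of_real (\<alpha> i))\<^sup>2) - 1"
    using avg_dev[OF assms] by (simp only: avg_diff avg_mult_left avg_const) simp
  finally have 1: "1 + avg (\<lambda>i. (dev w i)\<^sup>2) = (F w)\<^sup>2 * avg (\<lambda>i. 1 / (w - of_real (\<alpha> i))\<^sup>2)" by simp
  have "((\<lambda>w. inverse (G w)) has_field_derivative
      - (inverse (G w) * (- avg (\<lambda>i. 1 / (w - of_real (\<alpha> i))\<^sup>2)) * inverse (G w))) (at w)"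
    using assms by (intro DERIV_inverse' has_field_derivative_G) (auto simp: regular_def)
  then show ?thesis
    unfolding 1 by (simp add: F_def[abs_def] power2_eq_square field_simps)
qed

lemma norm_G_le:
  assumes "\<And>i. i < k \<Longrightarrow> d \<le> norm (w - of_real (\<alpha> i))" "d > 0"
  shows "norm (G w) \<le> 1 / d"
proof -
  have "norm (G w) \<le> avg (\<lambda>i. norm (1 / (w - of_real (\<alpha> i))))"
    unfolding G_def by (rule norm_avg_le)
  also have "\<dots> \<le> avg (\<lambda>i. 1 / d)"
    using assms by (intro avg_mono) (simp add: norm_divide frac_le)
  finally show ?thesis by simp
qed

lemma regular_right:
  fixes w :: real
  assumes "\<And>i. i < k \<Longrightarrow> \<alpha> i < w"
  shows "G w > 0" "regular w"
proof -
  show "G w > 0"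
    unfolding G_def using assms by (intro avg_pos) simp
  then show "regular w"
    unfolding regular_def using assms by fastforce
qed

text \<open>A self-improving estimate for \<open>q = w - mean - F w\<close>. Multiplying
  \<open>dev_eq\<close> by \<open>dev\<close> and averaging shows that \<open>q\<close> is the mean
  of \<open>(w - \<alpha> i) * dev^2\<close>, hence at least \<open>(w - L) * \<kappa> w\<close>;
  Cauchy-Schwarz gives \<open>q^2 \<le> var * \<kappa> w\<close>. Playing these against each other
  bounds \<open>q\<close> and \<open>\<kappa>\<close> by the variance alone.\<close>

lemma right_bounds:
  fixes w L :: real
  assumes L: "\<And>i. i < k \<Longrightarrow> \<alpha> i \<le> L" and w: "L < w"
  shows "(w - L) * \<kappa> w \<le> w - mean - F w" "0 \<le> w - mean - F w"
    "w - mean - F w \<le> var / (w - L)" "(w - L)\<^sup>2 * \<kappa> w \<le> var"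
proof -
  have r: "regular w" using assms by (intro regular_right) force
  let ?q = "w - mean - F w"
  have q: "?q = avg (\<lambda>i. (\<alpha> i - mean) * dev w i)"
    using F_minus_id[OF r] by simp
  have "avg (\<lambda>i. (w - \<alpha> i) * (dev w i)\<^sup>2)
      = avg (\<lambda>i. F w * dev w i - (w - mean) * dev w i + (\<alpha> i - mean) * dev w i)"
  proof (rule avg_cong)
    fix i assume "i < k"
    from dev_eq[OF r this] have "(w - \<alpha> i) * (1 + dev w i) * dev w i = F w * dev w i" by simp
    then show "(w - \<alpha> i) * (dev w i)\<^sup>2 = F w * dev w i - (w - mean) * dev w i + (\<alpha> i - mean) * dev w i"
      by (simp add: algebra_simps power2_eq_square)
  qed
  also have "\<dots> = ?q"
    unfolding avg_diff avg_add avg_mult_left avg_dev[OF r] q by simp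
  finally have *: "avg (\<lambda>i. (w - \<alpha> i) * (dev w i)\<^sup>2) = ?q" .
  have "avg (\<lambda>i. (w - L) * (dev w i)\<^sup>2) \<le> avg (\<lambda>i. (w - \<alpha> i) * (dev w i)\<^sup>2)"
    using L by (intro avg_mono mult_right_mono) auto
  then show 1: "(w - L) * \<kappa> w \<le> ?q"
    unfolding * avg_mult_left by (simp add: \<kappa>_def)
  show 2: "0 \<le> ?q"
    using w \<kappa>_nonneg[of w] by (intro order.trans[OF _ 1] mult_nonneg_nonneg) auto
  have 3: "?q\<^sup>2 \<le> var * \<kappa> w"
    using F_minus_id_sq[OF r] by (simp add: power2_eq_square algebra_simps)
  have "(w - L) * ?q\<^sup>2 \<le> (w - L) * (var * \<kappa> w)" using 3 w by (intro mult_left_mono) auto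
  also have "\<dots> = var * ((w - L) * \<kappa> w)" by (rule mult.left_commute)
  also have "\<dots> \<le> var * ?q" using 1 var_nonneg by (rule mult_left_mono)
  finally have 4: "(w - L) * ?q\<^sup>2 \<le> var * ?q" .
  show 5: "?q \<le> var / (w - L)"
  proof (cases "?q = 0")
    case True
    then show ?thesis using var_nonneg w by simp
  next
    case False
    then have "(w - L) * ?q \<le> var" using 2 4 by (simp add: power2_eq_square)
    then show ?thesis using w by (simp add: pos_le_divide_eq mult.commute)
  qed
  show "(w - L)\<^sup>2 * \<kappa> w \<le> var"
  proof -
    have "(w - L) * ((w - L) * \<kappa> w) \<le> (w - L) * ?q" using 1 w by (intro mult_left_mono) auto
    also have "\<dots> \<le> var" using 5 w by (simp add: pos_le_divide_eq mult.commute)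
    finally show ?thesis by (simp add: power2_eq_square mult.assoc)
  qed
qed

section \<open>Estimates on the upper half plane\<close>

lemma Im_G:
  assumes "Im w > 0"
  shows "Im (G w) < 0"
proof -
  have "Im (G w) = - avg (\<lambda>i. Im w / (cmod (w - of_real (\<alpha> i)))\<^sup>2)"
    unfolding G_def avg_def
    by (simp add: Im_divide cmod_def sum_negf Re_divide power2_eq_square Im_divide_of_nat)
  moreover have "avg (\<lambda>i. Im w / (cmod (w - of_real (\<alpha> i)))\<^sup>2) > 0"
    using assms by (intro avg_pos divide_pos_pos) auto
  ultimately show ?thesis by simp
qed

lemma regular_upper: "Im w > 0 \<Longrightarrow> regular w"
  using Im_G[of w] unfolding regular_def by auto

lemma cnj_G: "G (cnj w) = cnj (G w)"
  by (simp add: G_def avg_def)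

lemma regular_cnj: "regular w \<Longrightarrow> regular (cnj w)"
  unfolding regular_def cnj_G by (metis complex_cnj_cancel_iff complex_cnj_complex_of_real complex_cnj_zero)

text \<open>\<open>F_diff\<close> at \<open>w\<close> and \<open>cnj w\<close>: there
  \<open>dev\<close> is conjugated too, so the mean product becomes
  \<open>\<kappa> w\<close>.\<close>

lemma Im_F:
  assumes "Im w > 0"
  shows "Im (F w) = Im w * (1 + \<kappa> w)"
proof -
  have c: "F (cnj w) = cnj (F w)" by (simp add: F_def cnj_G)
  have d: "dev (cnj w) i = cnj (dev w i)" for i by (simp add: dev_def c)
  have "F w - F (cnj w) = (w - cnj w) * (1 + avg (\<lambda>i. dev w i * dev (cnj w) i))"
    using regular_upper[OF assms] by (intro F_diff regular_cnj)
  also have "avg (\<lambda>i. dev w i * dev (cnj w) i) = of_real (\<kappa> w)"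
    unfolding \<kappa>_def avg_of_real[symmetric] d by (simp only: complex_norm_square)
  finally have "Im (F w - F (cnj w)) = Im ((w - cnj w) * (1 + of_real (\<kappa> w)))" by simp
  then show ?thesis by (simp add: c)
qed

text \<open>The half-plane analogue of \<open>right_bounds\<close>: \<open>Im w * \<kappa> w\<close>
  is the imaginary part of \<open>F w - w\<close>, hence at most the norm \<open>d\<close> to be
  estimated, while \<open>d^2 \<le> var * \<kappa> w\<close>.\<close>

lemma F_minus_id_le:
  assumes "Im w > 0"
  shows "cmod (F w - w + of_real mean) \<le> var / Im w"
proof -
  let ?d = "F w - w + of_real mean"
  have "(cmod ?d)\<^sup>2 \<le> var * \<kappa> w" by (rule F_minus_id_sq[OF regular_upper[OF assms]])
  moreover have "Im w * \<kappa> w \<le> cmod ?d"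
    using abs_Im_le_cmod[of ?d] Im_F[OF assms] by (simp add: algebra_simps)
  ultimately have "Im w * (cmod ?d)\<^sup>2 \<le> Im w * (var * \<kappa> w)" "var * (Im w * \<kappa> w) \<le> var * cmod ?d"
    using assms var_nonneg by (auto intro!: mult_left_mono)
  then have "Im w * (cmod ?d)\<^sup>2 \<le> var * cmod ?d"
    by (simp only: mult.left_commute[of var])
  then show ?thesis
    using assms var_nonneg by (cases "cmod ?d = 0") (auto simp: power2_eq_square field_simps)
qed

lemma holomorphic_G: "G holomorphic_on {w. Im w > 0}"
  using regular_upper unfolding regular_def G_def[abs_def] avg_def by (intro holomorphic_intros) force+

lemma holomorphic_F: "F holomorphic_on {w. Im w > 0}"
  unfolding F_def[abs_def] using regular_upper unfolding regular_def
  by (intro holomorphic_intros holomorphic_G) auto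

end

section \<open>The subordination function\<close>

text \<open>\<open>s\<close> is \<open>T - 1\<close> for the convolution power with exponent
  \<open>T\<close>.\<close>

locale subordination = uniform_atoms +
  fixes s :: real
  assumes s_nonneg: "s \<ge> 0"
begin

definition H :: "'a::real_normed_field \<Rightarrow> 'a"
  where "H w = w + of_real s * (w - F w)"

definition \<Omega> :: "complex set"
  where "\<Omega> = {w. Im w > 0 \<and> Im (H w) > 0}"

definition \<omega> :: "complex \<Rightarrow> complex"
  where "\<omega> = the_inv_into \<Omega> H"

lemma Im_H:
  assumes "Im w > 0"
  shows "Im (H w) = Im w * (1 - s * \<kappa> w)"
  using Im_F[OF assms] by (simp add: H_def algebra_simps)

lemma H_diff:
  assumes "regular w" "regular w'"
  shows "H w - H w' = (w - w') * (1 - of_real s * avg (\<lambda>i. dev w i * dev w' i))"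
proof -
  have "H w - H w' = (w - w') + of_real s * ((w - w') - (F w - F w'))"
    by (simp add: H_def algebra_simps)
  then show ?thesis
    unfolding F_diff[OF assms] by (simp add: algebra_simps)
qed

text \<open>On \<open>\<Omega>\<close> the formula \<open>Im_H\<close> forces
  \<open>s * \<kappa> < 1\<close>, so the second factor of \<open>H_diff\<close> differs from 1 by
  less than 1.\<close>

lemma inj_on_H: "inj_on H \<Omega>"
proof (rule inj_onI)
  fix w w' assume w: "w \<in> \<Omega>" "w' \<in> \<Omega>" and eq: "H w = H w'"
  have "s * \<kappa> w < 1" "s * \<kappa> w' < 1"
    using w by (auto simp: \<Omega>_def Im_H zero_less_mult_iff)
  moreover have "norm (of_real s * avg (\<lambda>i. dev w i * dev w' i)) \<le> s * ((\<kappa> w + \<kappa> w') / 2)"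
    unfolding norm_mult using mult_left_mono[OF norm_avg_dev_mult[of w w'] s_nonneg] s_nonneg by simp
  ultimately have "norm (of_real s * avg (\<lambda>i. dev w i * dev w' i)) < 1"
    by (simp add: algebra_simps)
  then have "of_real s * avg (\<lambda>i. dev w i * dev w' i) \<noteq> 1" by force
  moreover have "regular w" "regular w'" using w regular_upper by (auto simp: \<Omega>_def)
  ultimately show "w = w'" using H_diff[of w w'] eq by auto
qed

text \<open>\<open>H w = z\<close> is the fixed point equation of
  \<open>w \<mapsto> z + s (F w - w)\<close>. The half plane \<open>Im w \<ge> Im z\<close> is
  preserved because \<open>F\<close> does not lower imaginary parts, and
  \<open>F_minus_id_le\<close> confines the values to a disc; the intersection is compact and
  convex.\<close>

lemma H_surj:
  assumes "Im z > 0"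
  shows "\<exists>w. Im w \<ge> Im z \<and> H w = z"
proof -
  define K where "K = {w. Im z \<le> Im w} \<inter> cball (z - of_real (s * mean)) (s * (var / Im z))"
  define \<Phi> where "\<Phi> w = z + of_real s * (F w - w)" for w
  have bound: "dist (z - of_real (s * mean)) (\<Phi> w) \<le> s * (var / Im z)" if "Im z \<le> Im w" for w
  proof -
    have "dist (z - of_real (s * mean)) (\<Phi> w) = norm (of_real s * (F w - w + of_real mean))"
      by (simp add: dist_norm norm_minus_commute \<Phi>_def algebra_simps)
    also have "\<dots> \<le> s * (var / Im w)"
      unfolding norm_mult using mult_left_mono[OF F_minus_id_le[of w] s_nonneg] that assms s_nonneg by simp
    also have "\<dots> \<le> s * (var / Im z)"
      using that assms s_nonneg var_nonneg by (intro mult_left_mono divide_left_mono) auto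
    finally show ?thesis .
  qed
  have Im: "Im z \<le> Im (\<Phi> w)" if "Im z \<le> Im w" for w
    using Im_F[of w] that assms \<kappa>_nonneg[of w] s_nonneg by (simp add: \<Phi>_def algebra_simps)
  show ?thesis
  proof (rule brouwer[of K \<Phi>])
    show "compact K" unfolding K_def
      by (intro closed_Int_compact compact_cball closed_halfspace_Im_ge)
    show "convex K" unfolding K_def
      by (intro convex_Int convex_cball convex_halfspace_Im_ge)
    show "K \<noteq> {}" using Im[of z] bound[of z] by (auto simp: K_def)
    show "continuous_on K \<Phi>"
      using assms unfolding \<Phi>_def K_def
      by (intro continuous_intros holomorphic_on_imp_continuous_on
          holomorphic_on_subset[OF holomorphic_F]) auto
    show "\<Phi> \<in> K \<rightarrow> K" using Im bound by (auto simp: K_def)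
    fix w assume "w \<in> K" "\<Phi> w = w"
    then show ?thesis
      by (intro exI[of _ w]) (auto simp: K_def \<Phi>_def H_def algebra_simps)
  qed
qed

lemma H_image: "H ` \<Omega> = {z. Im z > 0}"
proof -
  have "z \<in> H ` \<Omega>" if z: "Im z > 0" for z
    using H_surj[OF z] z by (force simp: \<Omega>_def)
  then show ?thesis by (auto simp: \<Omega>_def)
qed

lemma \<omega>_H: "w \<in> \<Omega> \<Longrightarrow> \<omega> (H w) = w"
  unfolding \<omega>_def by (rule the_inv_into_f_f[OF inj_on_H])

lemma
  assumes "Im z > 0"
  shows \<omega>_mem: "\<omega> z \<in> \<Omega>" and H_\<omega>: "H (\<omega> z) = z"
proof -
  from assms have z: "z \<in> H ` \<Omega>" by (simp add: H_image)
  show "\<omega> z \<in> \<Omega>" unfolding \<omega>_def using the_inv_into_into[OF inj_on_H z] by simp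
  show "H (\<omega> z) = z" unfolding \<omega>_def by (rule f_the_inv_into_f[OF inj_on_H z])
qed

lemma Im_\<omega>_ge:
  assumes "Im z > 0"
  shows "Im z \<le> Im (\<omega> z)"
proof -
  have "Im (\<omega> z) > 0" using \<omega>_mem[OF assms] by (simp add: \<Omega>_def)
  from Im_H[OF this] show ?thesis
    using mult_nonneg_nonneg[OF less_imp_le[OF \<open>Im (\<omega> z) > 0\<close>] mult_nonneg_nonneg[OF s_nonneg \<kappa>_nonneg[of "\<omega> z"]]]
    unfolding H_\<omega>[OF assms] by (simp add: algebra_simps)
qed

lemma \<omega>_minus_id:
  assumes "Im z > 0"
  shows "cmod (\<omega> z - z + of_real (s * mean)) \<le> s * (var / Im z)"
proof -
  have w: "Im z \<le> Im (\<omega> z)" by (rule Im_\<omega>_ge[OF assms])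
  have "\<omega> z - z + of_real (s * mean) = of_real s * (F (\<omega> z) - \<omega> z + of_real mean)"
    using H_\<omega>[OF assms] by (simp add: H_def algebra_simps)
  then have "cmod (\<omega> z - z + of_real (s * mean)) = s * cmod (F (\<omega> z) - \<omega> z + of_real mean)"
    using s_nonneg by (simp add: norm_mult)
  also have "\<dots> \<le> s * (var / Im (\<omega> z))"
    using F_minus_id_le[of "\<omega> z"] w assms s_nonneg by (intro mult_left_mono) auto
  also have "\<dots> \<le> s * (var / Im z)"
    using w assms s_nonneg var_nonneg by (intro mult_left_mono divide_left_mono) auto
  finally show ?thesis .
qed

section \<open>Holomorphy and growth of the subordination function\<close>

lemma holomorphic_H: "H holomorphic_on {w. Im w > 0}"
  unfolding H_def[abs_def] by (intro holomorphic_intros holomorphic_F)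

lemma open_\<Omega>: "open \<Omega>"
proof -
  have "open ({w. Im w > 0} \<inter> (\<lambda>w. H w) -` {z. Im z > 0})"
    by (intro continuous_open_preimage holomorphic_on_imp_continuous_on holomorphic_H open_halfspace_Im_gt)
  moreover have "{w. Im w > 0} \<inter> (\<lambda>w. H w) -` {z. Im z > 0} = \<Omega>"
    by (auto simp: \<Omega>_def)
  ultimately show ?thesis by simp
qed

lemma holomorphic_\<omega>: "\<omega> holomorphic_on {z. Im z > 0}"
proof -
  have "H holomorphic_on \<Omega>"
    by (rule holomorphic_on_subset[OF holomorphic_H]) (auto simp: \<Omega>_def)
  from holomorphic_has_inverse[OF this open_\<Omega> inj_on_H] obtain g
    where g: "g holomorphic_on (H ` \<Omega>)" "\<And>w. w \<in> \<Omega> \<Longrightarrow> g (H w) = w" by metis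
  show ?thesis
    by (rule holomorphic_transform[OF g(1)[unfolded H_image]]) (metis g(2) \<omega>_mem H_\<omega> mem_Collect_eq)
qed

lemma Im_\<omega>_pos: "Im z > 0 \<Longrightarrow> Im (\<omega> z) > 0"
  using Im_\<omega>_ge[of z] by simp

lemma holomorphic_G_\<omega>: "(\<lambda>z. G (\<omega> z)) holomorphic_on {z. Im z > 0}"
  using holomorphic_on_compose_gen[OF holomorphic_\<omega> holomorphic_G] Im_\<omega>_pos by (auto simp: o_def)

lemma Im_G_\<omega>: "Im z > 0 \<Longrightarrow> Im (G (\<omega> z)) < 0"
  by (intro Im_G Im_\<omega>_pos)

text \<open>On \<open>Im z \<ge> \<epsilon>\<close> the function \<open>\<omega>\<close> stays
  within a fixed distance of the identity, so for large \<open>z\<close> every atom is at distance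
  at least \<open>cmod z / 2\<close>. For the remaining \<open>z\<close> the height
  \<open>Im (\<omega> z) \<ge> \<epsilon>\<close> suffices.\<close>

lemma G_\<omega>_decay:
  assumes "\<epsilon> > 0"
  shows "\<exists>C. \<forall>z. Im z \<ge> \<epsilon> \<longrightarrow> cmod (G (\<omega> z)) \<le> C / cmod z"
proof -
  define A where "A = (\<Sum>i<k. \<bar>\<alpha> i\<bar>)"
  define B where "B = \<bar>s * mean\<bar> + s * (var / \<epsilon>)"
  have A: "\<bar>\<alpha> i\<bar> \<le> A" if "i < k" for i
    unfolding A_def using that by (intro member_le_sum) auto
  have A0: "A \<ge> 0" unfolding A_def by (rule sum_nonneg) simp
  have B0: "B \<ge> 0" unfolding B_def using s_nonneg var_nonneg assms by simp
  \<comment> \<open>The summand 2 serves the large \<open>z\<close>, the other one those with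
    \<open>cmod z < 2 * (A + B)\<close>.\<close>
  define C where "C = 2 + 2 * (A + B) / \<epsilon>"
  have "cmod (G (\<omega> z)) \<le> C / cmod z" if z: "Im z \<ge> \<epsilon>" for z
  proof -
    have zpos: "Im z > 0" using z assms by simp
    have z0: "cmod z > 0" using zpos by auto
    have wIm: "Im (\<omega> z) \<ge> \<epsilon>" using Im_\<omega>_ge[OF zpos] z by simp
    have "cmod (\<omega> z - z) \<le> cmod (\<omega> z - z + of_real (s * mean)) + \<bar>s * mean\<bar>"
      using norm_triangle_ineq4[of "\<omega> z - z + of_real (s * mean)" "of_real (s * mean)"]
      by (simp add: del: of_real_mult)
    also have "\<dots> \<le> s * (var / Im z) + \<bar>s * mean\<bar>"
      using \<omega>_minus_id[OF zpos] by simp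
    also have "s * (var / Im z) \<le> s * (var / \<epsilon>)"
      using z assms s_nonneg var_nonneg by (intro mult_left_mono divide_left_mono) auto
    finally have wz: "cmod (\<omega> z - z) \<le> B" by (simp add: B_def)
    show ?thesis
    proof (cases "cmod z \<ge> 2 * (A + B)")
      case True
      have "cmod z / 2 \<le> cmod (\<omega> z - of_real (\<alpha> i))" if "i < k" for i
      proof -
        have "cmod z \<le> cmod (\<omega> z - of_real (\<alpha> i)) + cmod (\<omega> z - z) + \<bar>\<alpha> i\<bar>"
          using norm_triangle_ineq4[of "\<omega> z - of_real (\<alpha> i)" "\<omega> z - z"]
            norm_triangle_ineq[of "z - of_real (\<alpha> i)" "of_real (\<alpha> i)"] by simp
        then show ?thesis using A[OF that] wz True by (simp add: field_simps)
      qed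
      then have "cmod (G (\<omega> z)) \<le> 1 / (cmod z / 2)" by (rule norm_G_le) (use z0 in auto)
      also have "\<dots> \<le> C / cmod z"
        unfolding C_def using z0 A0 B0 assms by (auto simp: field_simps)
      finally show ?thesis .
    next
      case False
      have "cmod (G (\<omega> z)) \<le> 1 / \<epsilon>"
      proof (rule norm_G_le)
        fix i
        show "\<epsilon> \<le> cmod (\<omega> z - of_real (\<alpha> i))"
          using wIm abs_Im_le_cmod[of "\<omega> z - of_real (\<alpha> i)"] by simp
      qed (rule assms)
      also have "\<dots> \<le> C / cmod z"
      proof -
        have "cmod z / \<epsilon> \<le> 2 * (A + B) / \<epsilon>" using False assms by (intro divide_right_mono) auto
        also have "\<dots> \<le> C" by (simp add: C_def)
        finally show ?thesis using z0 by (simp add: field_simps)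
      qed
      finally show ?thesis .
    qed
  qed
  then show ?thesis by blast
qed

text \<open>This normalisation will give the measure total mass 1. It holds because
  \<open>F (\<omega> z) - z\<close> stays bounded along the imaginary axis.\<close>

lemma G_\<omega>_at_infinity: "((\<lambda>y. \<i> * of_real y * G (\<omega> (\<i> * of_real y))) \<longlongrightarrow> 1) at_top"
proof -
  define C where "C = var + s * var + \<bar>mean\<bar> + \<bar>s * mean\<bar>"
  have "((\<lambda>y. F (\<omega> (\<i> * of_real y)) / (\<i> * of_real y) - 1) \<longlongrightarrow> 0) at_top"
  proof (rule Lim_null_comparison)
    show "((\<lambda>y. C * inverse y) \<longlongrightarrow> 0) at_top"
      by (intro tendsto_mult_right_zero tendsto_inverse_0_at_top filterlim_ident)
    show "\<forall>\<^sub>F y in at_top. norm (F (\<omega> (\<i> * of_real y)) / (\<i> * of_real y) - 1) \<le> C * inverse y"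
      using eventually_ge_at_top[of "1::real"]
    proof eventually_elim
      case (elim y)
      define z where "z = \<i> * complex_of_real y"
      have z: "Im z = y" "z \<noteq> 0" "cmod z = y" using elim by (auto simp: z_def norm_mult)
      let ?a = "F (\<omega> z) - \<omega> z + of_real mean" and ?b = "\<omega> z - z + of_real (s * mean)"
      have w: "Im (\<omega> z) \<ge> 1" using Im_\<omega>_ge[of z] z elim by simp
      have "cmod ?a \<le> var / Im (\<omega> z)" using F_minus_id_le[of "\<omega> z"] w by simp
      also have "\<dots> \<le> var" using w var_nonneg by (simp add: divide_le_eq mult_le_cancel_left1)
      finally have a: "cmod ?a \<le> var" .
      have "cmod ?b \<le> s * (var / y)" using \<omega>_minus_id[of z] z elim by simp
      also have "\<dots> \<le> s * var"
        using elim s_nonneg var_nonneg by (intro mult_left_mono) (simp add: divide_le_eq mult_le_cancel_left1)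
      finally have b: "cmod ?b \<le> s * var" .
      have "F (\<omega> z) - z = ?a + ?b - of_real mean - of_real (s * mean)" by simp
      moreover have "cmod (?a + ?b - of_real mean - of_real (s * mean)) \<le> cmod ?a + cmod ?b + \<bar>mean\<bar> + \<bar>s * mean\<bar>"
        using norm_triangle_ineq4[of "?a + ?b - of_real mean" "of_real (s * mean)"]
          norm_triangle_ineq4[of "?a + ?b" "of_real mean"] norm_triangle_ineq[of ?a ?b]
        unfolding norm_of_real by linarith
      ultimately have "cmod (F (\<omega> z) - z) \<le> cmod ?a + cmod ?b + \<bar>mean\<bar> + \<bar>s * mean\<bar>"
        by simp
      then have "cmod (F (\<omega> z) - z) \<le> C" using a b by (simp add: C_def)
      then have "cmod ((F (\<omega> z) - z) / z) \<le> C / y"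
        unfolding norm_divide z(3) using elim by (intro divide_right_mono) auto
      moreover have "(F (\<omega> z) - z) / z = F (\<omega> z) / z - 1" using z(2) by (simp add: diff_divide_distrib)
      ultimately have "cmod (F (\<omega> z) / z - 1) \<le> C / y" by (simp only:)
      then show ?case unfolding z_def by (simp only: divide_inverse[of C])
    qed
  qed
  then have "((\<lambda>y. F (\<omega> (\<i> * of_real y)) / (\<i> * of_real y)) \<longlongrightarrow> 1) at_top"
    by (simp add: LIM_zero_iff)
  then have "((\<lambda>y. inverse (F (\<omega> (\<i> * of_real y)) / (\<i> * of_real y))) \<longlongrightarrow> inverse 1) at_top"
    by (rule tendsto_inverse) simp
  then show ?thesis by (simp add: F_def field_simps)
qed

end

section \<open>Cauchy transforms and the Poisson kernel\<close>

lemma cauchy_denom_nonzero: "Im z > 0 \<Longrightarrow> z - complex_of_real s \<noteq> 0"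
  by (auto simp: complex_eq_iff)

lemma Im_le_cauchy_denom: "Im z \<le> cmod (z - complex_of_real s)"
  using abs_Im_le_cmod[of "z - complex_of_real s"] by simp

lemma norm_cauchy_kernel_le: "Im z > 0 \<Longrightarrow> norm (1 / (z - complex_of_real s)) \<le> 1 / Im z"
  using Im_le_cauchy_denom[of z s] by (simp add: norm_divide frac_le)

lemma continuous_cauchy_kernel:
  "Im z > 0 \<Longrightarrow> continuous_on UNIV (\<lambda>s. 1 / (z - complex_of_real s))"
  by (intro continuous_intros) (auto simp: cauchy_denom_nonzero)

lemma integrable_cauchy_kernel:
  assumes "prob_space M" "sets M = sets borel" "Im z > 0"
  shows "integrable M (\<lambda>s. 1 / (z - complex_of_real s))"
proof (rule finite_measure.integrable_const_bound)
  show "finite_measure M" using assms(1) by (rule prob_space.finite_measure)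
  show "AE s in M. norm (1 / (z - complex_of_real s)) \<le> 1 / Im z"
    using norm_cauchy_kernel_le[OF assms(3)] by simp
  show "(\<lambda>s. 1 / (z - complex_of_real s)) \<in> borel_measurable M"
    using continuous_cauchy_kernel[OF assms(3)] assms(2)
    by (metis borel_measurable_continuous_onI measurable_cong_sets)
qed

text \<open>The Poisson kernel of the half plane without its factor \<open>1 / pi\<close>, so that
  it is exactly minus the imaginary part of the Cauchy kernel.\<close>

definition poisson :: "real \<Rightarrow> real \<Rightarrow> real"
  where "poisson y x = y / (x\<^sup>2 + y\<^sup>2)"

lemma poisson_eq: "poisson y (x - s) = - Im (1 / (Complex x y - complex_of_real s))"
  by (simp add: poisson_def Im_divide power2_eq_square)

lemma integrable_poisson_1: "integrable lborel (poisson 1)"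
proof -
  have "set_integrable lborel UNIV (\<lambda>x::real. inverse (1 + x\<^sup>2))"
    using integrable_inverse_1_plus_square by (simp add: einterval_def)
  then show ?thesis
    by (simp add: poisson_def[abs_def] set_integrable_def add.commute divide_inverse)
qed

lemma poisson_scale:
  assumes "y > 0"
  shows "poisson y (y * v) = poisson 1 v / y"
proof -
  have "(y * v)\<^sup>2 + y\<^sup>2 = y * (y * (v\<^sup>2 + 1))" by (simp add: power2_eq_square algebra_simps)
  then show ?thesis using assms by (simp add: poisson_def)
qed

lemma continuous_on_poisson [continuous_intros]:
  assumes "y > 0" "continuous_on A f"
  shows "continuous_on A (\<lambda>x. poisson y (f x))"
  unfolding poisson_def using assms by (intro continuous_intros) (auto simp: add_nonneg_eq_0_iff)

lemma measurable_poisson [measurable]: "y > 0 \<Longrightarrow> poisson y \<in> borel_measurable borel"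
  using continuous_on_poisson[of y UNIV "\<lambda>x. x"] by (intro borel_measurable_continuous_onI) simp

lemma poisson_nonneg: "y > 0 \<Longrightarrow> poisson y x \<ge> 0"
  by (simp add: poisson_def)

lemma integrable_poisson:
  assumes "y > 0"
  shows "integrable lborel (\<lambda>x. poisson y (x - s))"
proof -
  have "integrable lborel (\<lambda>v. poisson y ((s + y * v) - s))"
    using integrable_poisson_1 assms by (simp add: poisson_scale)
  then show ?thesis
    using lborel_integrable_real_affine_iff[of y "\<lambda>x. poisson y (x - s)" s] assms by simp
qed

text \<open>In closed form \<open>pi * exp (- abs u)\<close>. The uniqueness proof relies on its
  continuity at 0 and its nonzero value there.\<close>

definition poisson_char :: "real \<Rightarrow> complex"
  where "poisson_char u = (CLINT v|lborel. poisson 1 v *\<^sub>R iexp (u * v))"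

lemma poisson_fourier:
  assumes "y > 0"
  shows "(CLINT x|lborel. poisson y (x - s) *\<^sub>R iexp (u * x)) = iexp (u * s) * poisson_char (u * y)"
proof -
  have "(CLINT x|lborel. poisson y (x - s) *\<^sub>R iexp (u * x))
     = \<bar>y\<bar> *\<^sub>R (CLINT v|lborel. poisson y ((s + y * v) - s) *\<^sub>R iexp (u * (s + y * v)))"
    using assms by (intro lborel_integral_real_affine) simp
  also have "\<dots> = (CLINT v|lborel. iexp (u * s) * (poisson 1 v *\<^sub>R iexp (u * y * v)))"
    unfolding integral_scaleR_right[symmetric]
  proof (intro Bochner_Integration.integral_cong refl)
    fix v
    have "poisson y (s + y * v - s) = poisson 1 v / y" using poisson_scale[OF assms] by simp
    then show "\<bar>y\<bar> *\<^sub>R poisson y (s + y * v - s) *\<^sub>R iexp (u * (s + y * v)) = iexp (u * s) * (poisson 1 v *\<^sub>R iexp (u * y * v))"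
      using assms by (simp add: scaleR_conv_of_real ring_distribs exp_add mult_ac)
  qed
  finally show ?thesis unfolding poisson_char_def integral_mult_right_zero .
qed

lemma tendsto_poisson_char:
  assumes h: "h \<longlonglongrightarrow> (0::real)"
  shows "(\<lambda>n. poisson_char (h n)) \<longlonglongrightarrow> poisson_char 0"
  unfolding poisson_char_def
proof (rule integral_dominated_convergence[where w = "poisson 1"])
  show "(\<lambda>x. poisson 1 x *\<^sub>R iexp (c * x)) \<in> borel_measurable lborel" for c
    unfolding measurable_lborel2 by (intro borel_measurable_continuous_onI continuous_intros) auto
  show "AE x in lborel. (\<lambda>n. poisson 1 x *\<^sub>R iexp (h n * x)) \<longlonglongrightarrow> poisson 1 x *\<^sub>R iexp (0 * x)"
    by (intro AE_I2 tendsto_scaleR tendsto_exp tendsto_mult tendsto_of_real tendsto_const h)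
  show "AE x in lborel. norm (poisson 1 x *\<^sub>R iexp (h n * x)) \<le> poisson 1 x" for n
    by (simp add: norm_exp_i_times poisson_nonneg)
qed (use integrable_poisson_1 in auto)

lemma poisson_char_0: "poisson_char 0 \<noteq> 0"
proof
  assume "poisson_char 0 = 0"
  then have "complex_of_real (integral\<^sup>L lborel (poisson 1)) = 0"
    by (simp add: poisson_char_def scaleR_conv_of_real)
  then have "integral\<^sup>L lborel (poisson 1) = 0" by simp
  then have "AE v in lborel. poisson 1 v = 0"
    using integral_nonneg_eq_0_iff_AE[OF integrable_poisson_1] by (simp add: poisson_nonneg)
  moreover have "poisson 1 v \<noteq> 0" for v by (simp add: poisson_def add_nonneg_eq_0_iff)
  ultimately have "AE v in (lborel::real measure). False" by simp
  then have "emeasure (lborel::real measure) UNIV = 0"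
    using AE_iff_null_sets[of UNIV "lborel::real measure"] by auto
  then show False by simp
qed

text \<open>The height \<open>y\<close> may depend on the frequency \<open>u\<close>: a small
  \<open>y\<close> brings the argument close to 0.\<close>

lemma poisson_char_nonzero: "\<exists>y>0. poisson_char (u * y) \<noteq> 0"
proof -
  have "(\<lambda>n. u * inverse (real (Suc n))) \<longlonglongrightarrow> 0"
    by (rule tendsto_mult_right_zero[OF LIMSEQ_inverse_real_of_nat])
  then have "(\<lambda>n. poisson_char (u * inverse (real (Suc n)))) \<longlonglongrightarrow> poisson_char 0"
    by (rule tendsto_poisson_char)
  then have "\<forall>\<^sub>F n in sequentially. poisson_char (u * inverse (real (Suc n))) \<noteq> 0"
    using poisson_char_0 by (rule tendsto_imp_eventually_ne)
  then obtain n where "poisson_char (u * inverse (real (Suc n))) \<noteq> 0"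
    by (auto simp: eventually_sequentially)
  then show ?thesis by (intro exI[of _ "inverse (real (Suc n))"]) simp
qed

lemma Im_cauchy_transform:
  assumes "prob_space M" "sets M = sets borel" "y > 0"
  shows "(\<integral>s. poisson y (x - s) \<partial>M) = - Im (cauchy_transform M (Complex x y))"
    "integrable M (\<lambda>s. poisson y (x - s))"
proof -
  have i: "integrable M (\<lambda>s. 1 / (Complex x y - complex_of_real s))"
    using assms by (intro integrable_cauchy_kernel) auto
  show "(\<integral>s. poisson y (x - s) \<partial>M) = - Im (cauchy_transform M (Complex x y))"
    unfolding cauchy_transform_def poisson_eq integral_minus integral_Im[OF i] ..
  show "integrable M (\<lambda>s. poisson y (x - s))"
    unfolding poisson_eq by (intro integrable_minus integrable_Im i)
qed

text \<open>
  Smoothing a measure by the Poisson kernel multiplies its characteristic function by that of the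
  kernel, so the imaginary part of the Cauchy transform on a horizontal line determines it.
\<close>

lemma char_poisson:
  assumes P: "prob_space M" and M: "sets M = sets borel" and y: "y > 0"
  shows "(CLINT x|lborel. (- Im (cauchy_transform M (Complex x y))) *\<^sub>R iexp (u * x))
       = char M u * poisson_char (u * y)"
proof -
  have sp: "space M = UNIV" using sets_eq_imp_space_eq[OF M] by simp
  interpret prob_space M by (rule P)
  interpret pair_sigma_finite M lborel ..
  let ?f = "\<lambda>s x. poisson y (x - s) *\<^sub>R iexp (u * x)"
  have meas[measurable]: "(\<lambda>(s, x). ?f s x) \<in> borel_measurable (M \<Otimes>\<^sub>M lborel)"
  proof -
    have "continuous_on UNIV (\<lambda>(s, x). ?f s x)"
      using y unfolding split_beta by (intro continuous_intros) auto
    then have "(\<lambda>(s, x). ?f s x) \<in> borel_measurable borel" by (rule borel_measurable_continuous_onI)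
    moreover have "sets (M \<Otimes>\<^sub>M lborel) = sets (borel :: (real \<times> real) measure)"
      by (metis M borel_prod sets_lborel sets_pair_measure_cong)
    ultimately show ?thesis using measurable_cong_sets[OF _ refl] by blast
  qed
  have int: "integrable (M \<Otimes>\<^sub>M lborel) (\<lambda>(s, x). ?f s x)"
  proof (rule Fubini_integrable[OF meas])
    have "(LINT x|lborel. norm (?f s x)) = (LINT v|lborel. poisson 1 v)" for s
    proof -
      have "(LINT x|lborel. norm (?f s x)) = (LINT x|lborel. poisson y (x - s))"
        using y by (simp add: norm_exp_i_times poisson_nonneg)
      also have "\<dots> = \<bar>y\<bar> *\<^sub>R (LINT v|lborel. poisson y ((s + y * v) - s))"
        using y by (intro lborel_integral_real_affine) simp
      also have "\<dots> = (LINT v|lborel. poisson 1 v)" using y by (simp add: poisson_scale)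
      finally show ?thesis .
    qed
    then show "integrable M (\<lambda>s. LINT x|lborel. norm (case (s, x) of (s, x) \<Rightarrow> ?f s x))" by simp
    show "AE s in M. integrable lborel (\<lambda>x. case (s, x) of (s, x) \<Rightarrow> ?f s x)"
    proof (rule AE_I2)
      fix s
      have "integrable lborel (\<lambda>x. poisson y (x - s) *\<^sub>R iexp (u * x))"
      proof (rule Bochner_Integration.integrable_bound[OF integrable_poisson[OF y, of s]])
        show "(\<lambda>x. poisson y (x - s) *\<^sub>R iexp (u * x)) \<in> borel_measurable lborel"
          using y unfolding measurable_lborel2 by (intro borel_measurable_continuous_onI continuous_intros) auto
      qed (simp add: norm_exp_i_times)
      then show "integrable lborel (\<lambda>x. case (s, x) of (s, x) \<Rightarrow> ?f s x)" by simp
    qed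
  qed
  have "(CLINT x|lborel. (- Im (cauchy_transform M (Complex x y))) *\<^sub>R iexp (u * x))
      = (CLINT x|lborel. CLINT s|M. ?f s x)"
    unfolding Im_cauchy_transform(1)[OF P M y, symmetric]
  proof (intro Bochner_Integration.integral_cong refl)
    fix x
    show "(\<integral>s. poisson y (x - s) \<partial>M) *\<^sub>R iexp (u * x) = (CLINT s|M. ?f s x)"
      by (rule integral_scaleR_left[symmetric]) (rule Im_cauchy_transform(2)[OF P M y])
  qed
  also have "\<dots> = (CLINT s|M. CLINT x|lborel. ?f s x)" by (rule Fubini_integral[OF int])
  also have "\<dots> = char M u * poisson_char (u * y)"
    unfolding poisson_fourier[OF y] char_def by simp
  finally show ?thesis .
qed

text \<open>For each frequency there is a height at which the kernel factor in
  \<open>char_poisson\<close> can be cancelled, so the characteristic functions agree.\<close>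

lemma cauchy_transform_inj:
  assumes "prob_space M" "prob_space N" and sets: "sets M = sets borel" "sets N = sets borel"
    and eq: "\<And>z. Im z > 0 \<Longrightarrow> cauchy_transform M z = cauchy_transform N z"
  shows "M = N"
proof -
  have "real_distribution M" "real_distribution N"
    using sets sets_eq_imp_space_eq[of M borel] sets_eq_imp_space_eq[of N borel]
    by (auto simp: real_distribution_def real_distribution_axioms_def assms)
  moreover have "char M u = char N u" for u
  proof -
    obtain y where "y > 0" "poisson_char (u * y) \<noteq> 0" using poisson_char_nonzero by blast
    moreover from \<open>y > 0\<close> have "char M u * poisson_char (u * y) = char N u * poisson_char (u * y)"
      unfolding char_poisson[OF assms(1) sets(1) \<open>y > 0\<close>, symmetric] char_poisson[OF assms(2) sets(2) \<open>y > 0\<close>, symmetric]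
      by (simp add: eq)
    ultimately show ?thesis by simp
  qed
  ultimately show ?thesis by (intro Levy_uniqueness) auto
qed

section \<open>Functions that are Cauchy transforms\<close>

text \<open>The three sides off the real axis have total length \<open>4 n\<close> and lie where the
  integrand is at most \<open>K / n^2\<close>, so they contribute at most
  \<open>4 K / n\<close>.\<close>

lemma line_integral_eq_rectpath_integral:
  fixes \<phi> :: "complex \<Rightarrow> complex"
  assumes N: "N > 0"
    and cont: "\<And>n. n \<ge> N \<Longrightarrow> continuous_on (path_image (rectpath (- of_nat n) (Complex n n))) \<phi>"
    and J: "\<And>n. n \<ge> N \<Longrightarrow> contour_integral (rectpath (- of_nat n) (Complex n n)) \<phi> = J"
    and bound: "\<And>w. Im w \<ge> 0 \<Longrightarrow> cmod w \<ge> real N \<Longrightarrow> cmod (\<phi> w) \<le> K / (cmod w)\<^sup>2"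
    and int: "integrable lborel (\<lambda>x. \<phi> (complex_of_real x))"
  shows "(CLINT x|lborel. \<phi> (complex_of_real x)) = J"
proof -
  let ?I = "\<lambda>n. CLINT x|lborel. indicator {- real n..real n} x *\<^sub>R \<phi> (complex_of_real x)"
  have K: "K \<ge> 0"
    using bound[of "complex_of_real (real N)"] N norm_ge_zero[of "\<phi> (complex_of_real (real N))"]
    by (simp add: zero_le_divide_iff del: norm_ge_zero) (smt (verit) zero_le_divide_iff of_nat_0_less_iff zero_less_power)
  have est: "cmod (?I n - J) \<le> 4 * K / real n" if n: "n \<ge> N" for n
  proof -
    have n0: "real n > 0" using n N by simp
    define a b c d :: complex where "a = - of_nat n" and "b = of_nat n" and "c = Complex n n" and "d = Complex (- real n) n"
    have r: "rectpath a c = linepath a b +++ linepath b c +++ linepath c d +++ linepath d a"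
      unfolding rectpath_def Let_def a_def b_def c_def d_def by (simp add: complex_eq_iff Complex_eq)
    have sub: "closed_segment a b \<subseteq> path_image (rectpath a c)" "closed_segment b c \<subseteq> path_image (rectpath a c)"
      "closed_segment c d \<subseteq> path_image (rectpath a c)" "closed_segment d a \<subseteq> path_image (rectpath a c)"
      unfolding r by (auto simp: path_image_join)
    have ci: "\<phi> contour_integrable_on linepath a b" "\<phi> contour_integrable_on linepath b c"
      "\<phi> contour_integrable_on linepath c d" "\<phi> contour_integrable_on linepath d a"
      using cont[OF n] sub unfolding a_def[symmetric] c_def[symmetric]
      by (auto intro!: contour_integrable_continuous_linepath elim: continuous_on_subset)
    have eq: "J = contour_integral (linepath a b) \<phi> + (contour_integral (linepath b c) \<phi>
        + (contour_integral (linepath c d) \<phi> + contour_integral (linepath d a) \<phi>))"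
      using J[OF n] ci unfolding a_def[symmetric] c_def[symmetric] r
      by (simp add: contour_integrable_joinI)
    have side: "cmod (contour_integral (linepath p q) \<phi>) \<le> K / (real n)\<^sup>2 * cmod (q - p)"
      if "\<phi> contour_integrable_on linepath p q"
        "\<And>w. w \<in> closed_segment p q \<Longrightarrow> Im w \<ge> 0 \<and> real n \<le> cmod w" for p q
    proof (rule contour_integral_bound_linepath[OF that(1)])
      show "0 \<le> K / (real n)\<^sup>2" using K by simp
      fix w assume w: "w \<in> closed_segment p q"
      have "cmod (\<phi> w) \<le> K / (cmod w)\<^sup>2" using that(2)[OF w] n by (intro bound) auto
      also have "\<dots> \<le> K / (real n)\<^sup>2"
        using that(2)[OF w] K n0 by (intro divide_left_mono power_mono mult_pos_pos) (auto intro: zero_less_power)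
      finally show "cmod (\<phi> w) \<le> K / (real n)\<^sup>2" .
    qed
    have bc: "cmod (contour_integral (linepath b c) \<phi>) \<le> K / (real n)\<^sup>2 * cmod (c - b)"
    proof (rule side[OF ci(2)])
      fix w assume "w \<in> closed_segment b c"
      then have "Re w = n \<and> 0 \<le> Im w"
        using closed_segment_same_Re[of b c] by (auto simp: b_def c_def closed_segment_eq_real_ivl)
      then show "Im w \<ge> 0 \<and> real n \<le> cmod w" using complex_Re_le_cmod[of w] by auto
    qed
    have cd: "cmod (contour_integral (linepath c d) \<phi>) \<le> K / (real n)\<^sup>2 * cmod (d - c)"
    proof (rule side[OF ci(3)])
      fix w assume "w \<in> closed_segment c d"
      then have "Im w = n"
        using closed_segment_same_Im[of c d] by (auto simp: c_def d_def)
      then show "Im w \<ge> 0 \<and> real n \<le> cmod w" using abs_Im_le_cmod[of w] by auto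
    qed
    have da: "cmod (contour_integral (linepath d a) \<phi>) \<le> K / (real n)\<^sup>2 * cmod (a - d)"
    proof (rule side[OF ci(4)])
      fix w assume "w \<in> closed_segment d a"
      then have "Re w = - n \<and> 0 \<le> Im w"
        using closed_segment_same_Re[of d a] n0 by (auto simp: a_def d_def closed_segment_eq_real_ivl)
      then show "Im w \<ge> 0 \<and> real n \<le> cmod w" using abs_Re_le_cmod[of w] by auto
    qed
    have len: "cmod (c - b) = n" "cmod (d - c) = 2 * n" "cmod (a - d) = n"
      by (auto simp: a_def b_def c_def d_def cmod_def real_sqrt_mult)
    have "contour_integral (linepath a b) \<phi> = integral {- real n..real n} (\<lambda>x. \<phi> (complex_of_real x))"
      using contour_integral_linepath_Reals_eq[of a b \<phi>] n0 by (simp add: a_def b_def)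
    also have "\<dots> = ?I n"
    proof -
      have "set_integrable lborel {- real n..real n} (\<lambda>x. \<phi> (complex_of_real x))"
        using int unfolding set_integrable_def by (intro integrable_mult_indicator) auto
      from set_borel_integral_eq_integral(2)[OF this] show ?thesis by (simp add: set_lebesgue_integral_def)
    qed
    finally have "?I n - J = - (contour_integral (linepath b c) \<phi>
        + (contour_integral (linepath c d) \<phi> + contour_integral (linepath d a) \<phi>))"
      using eq by (simp add: algebra_simps)
    then have "cmod (?I n - J) \<le> cmod (contour_integral (linepath b c) \<phi>)
        + (cmod (contour_integral (linepath c d) \<phi>) + cmod (contour_integral (linepath d a) \<phi>))"
      by (simp only: norm_minus_cancel) (intro order.trans[OF norm_triangle_ineq] add_left_mono norm_triangle_ineq)
    also have "\<dots> \<le> K / (real n)\<^sup>2 * n + (K / (real n)\<^sup>2 * (2 * n) + K / (real n)\<^sup>2 * n)"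
      using bc cd da unfolding len by (intro add_mono)
    also have "\<dots> = 4 * K / real n" using n0 by (simp add: field_simps power2_eq_square)
    finally show ?thesis .
  qed
  have "?I \<longlonglongrightarrow> J"
  proof (rule LIM_zero_cancel, rule Lim_null_comparison)
    show "\<forall>\<^sub>F n in sequentially. cmod (?I n - J) \<le> 4 * K / real n"
      using est by (auto simp: eventually_sequentially)
    show "(\<lambda>n. 4 * K / real n) \<longlonglongrightarrow> 0" by (rule lim_const_over_n)
  qed
  moreover have "?I \<longlonglongrightarrow> (CLINT x|lborel. \<phi> (complex_of_real x))"
  proof (rule integral_dominated_convergence[where w = "\<lambda>x. norm (\<phi> (complex_of_real x))"])
    show "(\<lambda>x. \<phi> (complex_of_real x)) \<in> borel_measurable lborel" using int by simp
    show "(\<lambda>x. indicator {- real n..real n} x *\<^sub>R \<phi> (complex_of_real x)) \<in> borel_measurable lborel" for n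
      using int by (intro borel_measurable_scaleR) auto
    show "integrable lborel (\<lambda>x. norm (\<phi> (complex_of_real x)))" using int by simp
    show "AE x in lborel. (\<lambda>n. indicator {- real n..real n} x *\<^sub>R \<phi> (complex_of_real x)) \<longlonglongrightarrow> \<phi> (complex_of_real x)"
    proof (rule AE_I2, rule tendsto_eventually)
      fix x :: real
      obtain m where "\<bar>x\<bar> \<le> real m" using real_arch_simple by blast
      then show "\<forall>\<^sub>F n in sequentially. indicator {- real n..real n} x *\<^sub>R \<phi> (complex_of_real x) = \<phi> (complex_of_real x)"
        unfolding eventually_sequentially by (intro exI[of _ m]) (auto simp: indicator_def)
    qed
    show "AE x in lborel. norm (indicator {- real n..real n} x *\<^sub>R \<phi> (complex_of_real x)) \<le> norm (\<phi> (complex_of_real x))" for n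
      by (auto simp: indicator_def)
  qed
  ultimately show ?thesis by (rule LIMSEQ_unique[symmetric])
qed

text \<open>Each factor decays only like \<open>1 / abs x\<close>. The product is dominated by the
  mean of the two squares, which are multiples of shifted Poisson kernels.\<close>

lemma integrable_product_kernel:
  fixes g :: "real \<Rightarrow> complex" and \<epsilon> C :: real
  assumes [measurable]: "g \<in> borel_measurable borel" and "\<epsilon> > 0"
    and g: "\<And>x. cmod (g x) \<le> C / cmod (complex_of_real x + \<i> * complex_of_real \<epsilon>)" and c: "Im c \<noteq> 0"
  shows "integrable lborel (\<lambda>x. g x / (complex_of_real x - c))"
proof (rule Bochner_Integration.integrable_bound)
  let ?w = "\<lambda>x. \<bar>C\<bar> / 2 * (poisson \<epsilon> (x - 0) / \<epsilon> + poisson \<bar>Im c\<bar> (x - Re c) / \<bar>Im c\<bar>)"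
  show "integrable lborel ?w"
    using c \<open>\<epsilon> > 0\<close>
    by (intro integrable_mult_right Bochner_Integration.integrable_add integrable_divide integrable_poisson) auto
  have "continuous_on UNIV (\<lambda>x. 1 / (complex_of_real x - c))"
    using c by (intro continuous_intros) auto
  then have [measurable]: "(\<lambda>x. 1 / (complex_of_real x - c)) \<in> borel_measurable borel"
    by (rule borel_measurable_continuous_onI)
  have "(\<lambda>x. g x * (1 / (complex_of_real x - c))) \<in> borel_measurable borel" by measurable
  then show "(\<lambda>x. g x / (complex_of_real x - c)) \<in> borel_measurable lborel" by simp
  show "AE x in lborel. norm (g x / (complex_of_real x - c)) \<le> norm (?w x)"
  proof (rule AE_I2)
    fix x
    define p q where pq: "p = 1 / cmod (complex_of_real x + \<i> * complex_of_real \<epsilon>)" "q = 1 / cmod (complex_of_real x - c)"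
    have p: "p\<^sup>2 = poisson \<epsilon> (x - 0) / \<epsilon>"
      using \<open>\<epsilon> > 0\<close> by (simp add: pq power_divide cmod_power2 poisson_def)
    have q: "q\<^sup>2 = poisson \<bar>Im c\<bar> (x - Re c) / \<bar>Im c\<bar>"
      using c by (simp add: pq power_divide cmod_power2 poisson_def)
    have "norm (g x / (complex_of_real x - c)) \<le> \<bar>C\<bar> * p * q"
    proof -
      have "cmod (g x) \<le> C * p" using g[of x] by (simp add: pq)
      also have "\<dots> \<le> \<bar>C\<bar> * p" by (intro mult_right_mono) (auto simp: pq)
      finally have "cmod (g x) * q \<le> \<bar>C\<bar> * p * q" by (intro mult_right_mono) (auto simp: pq)
      then show ?thesis by (simp add: norm_divide pq(2))
    qed
    also have "\<dots> \<le> \<bar>C\<bar> / 2 * (p\<^sup>2 + q\<^sup>2)"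
      using mult_left_mono[OF sum_squares_bound[of p q], of "\<bar>C\<bar> / 2"] by (simp add: mult_ac)
    also have "\<dots> \<le> norm (?w x)" unfolding p q by simp
    finally show "norm (g x / (complex_of_real x - c)) \<le> norm (?w x)" .
  qed
qed

text \<open>Cauchy's formula at \<open>z\<close> gives \<open>2 pi i g z\<close> as the integral of
  \<open>g x / (x - z)\<close>, and Cauchy's theorem at the reflected point \<open>cnj z\<close>
  gives 0. Subtracting the conjugate of the second from the first leaves only the imaginary part of
  \<open>g\<close> on the line.\<close>

lemma half_plane_poisson:
  fixes g :: "complex \<Rightarrow> complex" and \<epsilon> C :: real
  assumes hol: "g holomorphic_on {w. Im w > - \<epsilon>}" and \<epsilon>: "\<epsilon> > 0"
    and g: "\<And>w. Im w \<ge> 0 \<Longrightarrow> cmod (g w) \<le> C / cmod (w + \<i> * complex_of_real \<epsilon>)"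
    and z: "Im z > 0"
  shows "(CLINT x|lborel. (- Im (g (complex_of_real x)) / pi) *\<^sub>R (1 / (z - complex_of_real x))) = g z"
    and "integrable lborel (\<lambda>x. (- Im (g (complex_of_real x)) / pi) *\<^sub>R (1 / (z - complex_of_real x)))"
proof -
  let ?S = "{w. Im w > - \<epsilon>}"
  have cvx: "convex ?S" by (rule convex_halfspace_Im_gt)
  have contg: "continuous_on UNIV (\<lambda>x. g (complex_of_real x))"
    using \<epsilon> by (intro continuous_on_compose2[OF holomorphic_on_imp_continuous_on[OF hol]] continuous_intros) auto
  then have meas[measurable]: "(\<lambda>x. g (complex_of_real x)) \<in> borel_measurable borel"
    by (rule borel_measurable_continuous_onI)
  have int: "integrable lborel (\<lambda>x. g (complex_of_real x) / (complex_of_real x - c))" if "Im c \<noteq> 0" for c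
    using g that by (intro integrable_product_kernel[OF meas \<epsilon>, of C]) auto
  have C0: "C \<ge> 0"
    using g[of 0] \<epsilon> norm_ge_zero[of "g 0"] by (simp add: norm_mult zero_le_divide_iff del: norm_ge_zero)
      (smt (verit) zero_le_divide_iff)
  have bound: "cmod (g w / (w - c)) \<le> (2 * C) / (cmod w)\<^sup>2"
    if w: "Im w \<ge> 0" "cmod w \<ge> 2 * cmod c" "w \<noteq> 0" for w c
  proof -
    have "(cmod w)\<^sup>2 \<le> (cmod (w + \<i> * complex_of_real \<epsilon>))\<^sup>2"
      unfolding cmod_power2 using w(1) \<epsilon> by (simp add: power2_sum)
    then have "cmod w \<le> cmod (w + \<i> * complex_of_real \<epsilon>)" by (simp add: power_mono_iff)
    then have "C / cmod (w + \<i> * complex_of_real \<epsilon>) \<le> C / cmod w"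
      using C0 w(3) by (intro divide_left_mono mult_pos_pos) (auto intro: less_le_trans)
    then have 1: "cmod (g w) \<le> C / cmod w" using g[OF w(1)] by simp
    have 2: "cmod w / 2 \<le> cmod (w - c)" using norm_triangle_ineq2[of w c] w(2) by simp
    have "cmod (g w / (w - c)) \<le> (C / cmod w) / (cmod w / 2)"
      unfolding norm_divide using 1 2 w(3) C0 by (intro frac_le) auto
    then show ?thesis by (simp add: power2_eq_square field_simps)
  qed
  obtain N :: nat where N: "2 * cmod z + 1 \<le> real N" using real_arch_simple by blast
  then have N0: "N > 0" using norm_ge_zero[of z] by (cases N) auto
  have path: "path_image (rectpath (- of_nat n) (Complex n n)) \<subseteq> {w. Im w \<ge> 0} - {z, cnj z}"
    and zbox: "z \<in> box (- of_nat n) (Complex n n)" if n: "n \<ge> N" for n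
  proof -
    have zn: "cmod z < real n" using n N norm_ge_zero[of z] by linarith
    then show zbox: "z \<in> box (- of_nat n) (Complex n n)"
      using z abs_Re_le_cmod[of z] abs_Im_le_cmod[of z] by (auto simp: in_box_complex_iff)
    have "path_image (rectpath (- of_nat n) (Complex n n)) = cbox (- of_nat n) (Complex n n) - box (- of_nat n) (Complex n n)"
      by (rule path_image_rectpath_cbox_minus_box) auto
    then have "w \<in> cbox (- of_nat n) (Complex n n)" "w \<notin> box (- of_nat n) (Complex n n)"
      if "w \<in> path_image (rectpath (- of_nat n) (Complex n n))" for w
      using that by auto
    moreover have "Im w \<ge> 0" if "w \<in> cbox (- of_nat n) (Complex n n)" for w
      using that by (simp add: in_cbox_complex_iff)
    moreover have "\<not> 0 \<le> Im (cnj z)" using z by simp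
    ultimately show "path_image (rectpath (- of_nat n) (Complex n n)) \<subseteq> {w. Im w \<ge> 0} - {z, cnj z}"
      using zbox by blast
  qed
  have contq: "continuous_on (path_image (rectpath (- of_nat n) (Complex n n))) (\<lambda>w. g w / (w - c))"
    if "n \<ge> N" "c \<in> {z, cnj z}" for n c
    using path[OF that(1)] that(2) \<epsilon>
    by (intro continuous_intros continuous_on_subset[OF holomorphic_on_imp_continuous_on[OF hol]]) force+
  have A: "(CLINT x|lborel. g (complex_of_real x) / (complex_of_real x - z)) = complex_of_real (2 * pi) * \<i> * g z"
  proof (rule line_integral_eq_rectpath_integral[OF N0])
    show "continuous_on (path_image (rectpath (- of_nat n) (Complex n n))) (\<lambda>w. g w / (w - z))" if "n \<ge> N" for n
      using contq[OF that] by simp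
    show "contour_integral (rectpath (- of_nat n) (Complex n n)) (\<lambda>w. g w / (w - z)) = complex_of_real (2 * pi) * \<i> * g z"
      if "n \<ge> N" for n
    proof -
      have "((\<lambda>w. g w / (w - z)) has_contour_integral complex_of_real (2 * pi) * \<i>
          * winding_number (rectpath (- of_nat n) (Complex n n)) z * g z) (rectpath (- of_nat n) (Complex n n))"
      proof (rule Cauchy_integral_formula_convex_simple[OF cvx hol])
        show "z \<in> interior ?S" using z \<epsilon> by (subst interior_open) (auto simp: open_halfspace_Im_gt)
        show "path_image (rectpath (- of_nat n) (Complex n n)) \<subseteq> ?S - {z}" using path[OF that] \<epsilon> by fastforce
      qed auto
      then show ?thesis
        using winding_number_rectpath[OF zbox[OF that]] by (simp add: contour_integral_unique)
    qed
    show "cmod (g w / (w - z)) \<le> (2 * C) / (cmod w)\<^sup>2" if "0 \<le> Im w" "real N \<le> cmod w" for w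
    proof (rule bound[OF that(1)])
      show "w \<noteq> 0" using that(2) N0 by auto
      show "2 * cmod (z) \<le> cmod w" using that(2) N by simp
    qed
    show "integrable lborel (\<lambda>x. g (complex_of_real x) / (complex_of_real x - z))" using z by (intro int) auto
  qed
  have B: "(CLINT x|lborel. g (complex_of_real x) / (complex_of_real x - cnj z)) = 0"
  proof (rule line_integral_eq_rectpath_integral[OF N0])
    show "continuous_on (path_image (rectpath (- of_nat n) (Complex n n))) (\<lambda>w. g w / (w - cnj z))" if "n \<ge> N" for n
      using contq[OF that] by simp
    show "contour_integral (rectpath (- of_nat n) (Complex n n)) (\<lambda>w. g w / (w - cnj z)) = 0"
      if "n \<ge> N" for n
    proof (rule contour_integral_unique, rule Cauchy_theorem_convex_simple)
      \<comment> \<open>The half plane is cut above the pole \<open>cnj z\<close>, which sits at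
        height \<open>- Im z\<close>.\<close>
      show "(\<lambda>w. g w / (w - cnj z)) holomorphic_on {w. Im w > - min \<epsilon> (Im z)}"
        by (intro holomorphic_intros holomorphic_on_subset[OF hol]) auto
      show "convex {w. Im w > - min \<epsilon> (Im z)}" by (rule convex_halfspace_Im_gt)
      show "path_image (rectpath (- of_nat n) (Complex n n)) \<subseteq> {w. Im w > - min \<epsilon> (Im z)}"
        using path[OF that] \<epsilon> z by fastforce
    qed auto
    show "cmod (g w / (w - cnj z)) \<le> (2 * C) / (cmod w)\<^sup>2" if "0 \<le> Im w" "real N \<le> cmod w" for w
    proof (rule bound[OF that(1)])
      show "w \<noteq> 0" using that(2) N0 by auto
      show "2 * cmod (cnj z) \<le> cmod w" using that(2) N by simp
    qed
    show "integrable lborel (\<lambda>x. g (complex_of_real x) / (complex_of_real x - cnj z))" using z by (intro int) auto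
  qed
  let ?h = "\<lambda>x. (- Im (g (complex_of_real x)) / pi) *\<^sub>R (1 / (z - complex_of_real x))"
  have h: "?h x = (1 / (complex_of_real (2 * pi) * \<i>)) * (g (complex_of_real x) / (complex_of_real x - z)
      - cnj (g (complex_of_real x) / (complex_of_real x - cnj z)))" for x
  proof -
    define D where "D = z - complex_of_real x"
    have "D \<noteq> 0" unfolding D_def using z by (rule cauchy_denom_nonzero)
    have D: "complex_of_real x - z = - D" "cnj (complex_of_real x - cnj z) = - D" by (auto simp: D_def)
    have "g (complex_of_real x) / (complex_of_real x - z) - cnj (g (complex_of_real x) / (complex_of_real x - cnj z))
        = - (g (complex_of_real x) - cnj (g (complex_of_real x))) / D"
      unfolding complex_cnj_divide D using \<open>D \<noteq> 0\<close> by (simp add: field_simps)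
    also have "g (complex_of_real x) - cnj (g (complex_of_real x)) = 2 * \<i> * complex_of_real (Im (g (complex_of_real x)))"
      by (simp add: complex_eq_iff)
    finally show ?thesis
      unfolding D_def[symmetric] by (simp add: scaleR_conv_of_real)
  qed
  have ic: "integrable lborel (\<lambda>x. cnj (g (complex_of_real x) / (complex_of_real x - cnj z)))"
    using int[of "cnj z"] z by (subst complex_cnj_cancel_iff integrable_cnj) auto
  show "integrable lborel ?h" unfolding h
    by (intro integrable_mult_right Bochner_Integration.integrable_diff int ic) (use z in simp)
  have "(CLINT x|lborel. ?h x) = (1 / (complex_of_real (2 * pi) * \<i>)) *
     ((CLINT x|lborel. g (complex_of_real x) / (complex_of_real x - z))
     - (CLINT x|lborel. cnj (g (complex_of_real x) / (complex_of_real x - cnj z))))"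
    unfolding h integral_mult_right_zero by (subst Bochner_Integration.integral_diff) (use z in \<open>auto intro!: int ic[simplified]\<close>)
  also have "\<dots> = g z"
    unfolding A Bochner_Integration.integral_cnj B by simp
  finally show "(CLINT x|lborel. ?h x) = g z" .
qed

section \<open>Measures recovered from their Cauchy transforms\<close>

lemma Re_kernel_eq_poisson:
  assumes "y > 0"
  shows "Re (\<i> * complex_of_real y * (1 / (\<i> * complex_of_real y - complex_of_real x))) = y * poisson y x"
  using assms by (simp add: poisson_def Re_divide Im_divide power2_eq_square)

lemma poisson_le: "y > 0 \<Longrightarrow> y * poisson y x \<le> 1"
  by (simp add: poisson_def divide_le_eq add_nonneg_pos power2_eq_square)

lemma tendsto_poisson: "(\<lambda>n. real n * poisson (real n) x) \<longlonglongrightarrow> 1"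
  unfolding poisson_def by real_asymp

text \<open>After the shift by \<open>\<epsilon>\<close> the function is holomorphic across the real
  axis, so its imaginary part there supplies a density. The total mass is read off at infinity,
  since \<open>y * poisson y x\<close> tends to 1 as \<open>y\<close> grows.\<close>

lemma exists_shifted_measure:
  fixes G :: "complex \<Rightarrow> complex" and \<epsilon> :: real
  assumes hol: "G holomorphic_on {z. Im z > 0}"
    and neg: "\<And>z. Im z > 0 \<Longrightarrow> Im (G z) \<le> 0"
    and C: "\<And>z. Im z \<ge> \<epsilon> \<Longrightarrow> cmod (G z) \<le> C / cmod z"
    and lim: "((\<lambda>y. \<i> * complex_of_real y * G (\<i> * complex_of_real y)) \<longlongrightarrow> 1) at_top"
    and \<epsilon>: "\<epsilon> > 0"
  shows "\<exists>\<nu>. real_distribution \<nu> \<and> (\<forall>z. Im z > 0 \<longrightarrow> cauchy_transform \<nu> z = G (z + \<i> * complex_of_real \<epsilon>))"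
proof -
  define g where "g w = G (w + \<i> * complex_of_real \<epsilon>)" for w
  define d where "d x = - Im (g (complex_of_real x)) / pi" for x
  have holg: "g holomorphic_on {w. Im w > - \<epsilon>}"
    unfolding g_def by (intro holomorphic_on_compose_gen[OF _ hol, unfolded o_def] holomorphic_intros) auto
  have gb: "cmod (g w) \<le> C / cmod (w + \<i> * complex_of_real \<epsilon>)" if "Im w \<ge> 0" for w
    unfolding g_def using that by (intro C) simp
  have P: "(CLINT x|lborel. d x *\<^sub>R (1 / (z - complex_of_real x))) = g z"
    "integrable lborel (\<lambda>x. d x *\<^sub>R (1 / (z - complex_of_real x)))" if "Im z > 0" for z
    unfolding d_def using half_plane_poisson[of g \<epsilon> C z] holg \<epsilon> gb that by auto
  have d0: "d x \<ge> 0" for x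
    using neg[of "complex_of_real x + \<i> * complex_of_real \<epsilon>"] \<epsilon> by (simp add: d_def g_def divide_nonpos_pos)
  have "continuous_on UNIV d"
    unfolding d_def using \<epsilon>
    by (intro continuous_intros continuous_on_compose2[OF holomorphic_on_imp_continuous_on[OF holg]]) auto
  then have [measurable]: "d \<in> borel_measurable borel" by (rule borel_measurable_continuous_onI)
  define \<rho> where "\<rho> y = Re (\<i> * complex_of_real y * g (\<i> * complex_of_real y))" for y
  have i\<rho>: "integrable lborel (\<lambda>x. d x * (y * poisson y x))"
    and \<rho>: "(LINT x|lborel. d x * (y * poisson y x)) = \<rho> y" if y: "y > 0" for y
  proof -
    have z: "Im (\<i> * complex_of_real y) > 0" using y by simp
    let ?f = "\<lambda>x. \<i> * complex_of_real y * (d x *\<^sub>R (1 / (\<i> * complex_of_real y - complex_of_real x)))"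
    have i: "integrable lborel ?f" by (intro integrable_mult_right P(2)[OF z])
    have f: "Re (?f x) = d x * (y * poisson y x)" for x
    proof -
      have "Re (?f x) = d x * Re (\<i> * complex_of_real y * (1 / (\<i> * complex_of_real y - complex_of_real x)))"
        by (simp only: mult_scaleR_right scaleR_complex.sel)
      then show ?thesis by (simp only: Re_kernel_eq_poisson[OF y])
    qed
    show "integrable lborel (\<lambda>x. d x * (y * poisson y x))" using integrable_Re[OF i] unfolding f .
    have "(LINT x|lborel. d x * (y * poisson y x)) = Re (CLINT x|lborel. ?f x)"
      unfolding integral_Re[OF i, symmetric] f ..
    also have "(CLINT x|lborel. ?f x) = \<i> * complex_of_real y * g (\<i> * complex_of_real y)"
      unfolding integral_mult_right_zero P(1)[OF z] ..
    finally show "(LINT x|lborel. d x * (y * poisson y x)) = \<rho> y" by (simp add: \<rho>_def)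
  qed
  have lim\<rho>: "(\<lambda>n. \<rho> (real n)) \<longlonglongrightarrow> 1"
  proof -
    have f: "filterlim (\<lambda>n. real n + \<epsilon>) at_top sequentially"
      by real_asymp
    have "(\<lambda>n. complex_of_real (real n / (real n + \<epsilon>)) *
        (\<i> * complex_of_real (real n + \<epsilon>) * G (\<i> * complex_of_real (real n + \<epsilon>)))) \<longlonglongrightarrow> complex_of_real 1 * 1"
      using filterlim_compose[OF lim f] by (intro tendsto_mult tendsto_of_real) real_asymp+
    moreover have "complex_of_real (real n / (real n + \<epsilon>)) *
        (\<i> * complex_of_real (real n + \<epsilon>) * G (\<i> * complex_of_real (real n + \<epsilon>)))
        = \<i> * complex_of_real (real n) * g (\<i> * complex_of_real (real n))" for n
    proof -
      have "complex_of_real (real n + \<epsilon>) \<noteq> 0" using \<epsilon> by (simp only: of_real_eq_0_iff)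
      then have "complex_of_real (real n / (real n + \<epsilon>)) * complex_of_real (real n + \<epsilon>) = complex_of_real (real n)"
        unfolding of_real_mult[symmetric] by (simp only: of_real_eq_0_iff) simp
      then show ?thesis unfolding g_def
        by (metis (no_types, lifting) distrib_left mult.assoc mult.commute of_real_add)
    qed
    ultimately have "(\<lambda>n. \<i> * complex_of_real (real n) * g (\<i> * complex_of_real (real n))) \<longlonglongrightarrow> 1" by simp
    from tendsto_Re[OF this] show ?thesis by (simp add: \<rho>_def)
  qed
  have lim\<rho>': "(\<lambda>n. \<rho> (real (Suc n))) \<longlonglongrightarrow> 1" using LIMSEQ_Suc[OF lim\<rho>] .
  have dlim: "(\<lambda>n. d x * (real (Suc n) * poisson (real (Suc n)) x)) \<longlonglongrightarrow> d x" for x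
    using tendsto_mult[OF tendsto_const LIMSEQ_Suc[OF tendsto_poisson[of x]], of "d x"] by simp
  \<comment> \<open>Fatou gives the integrability of \<open>d\<close>; then \<open>d\<close> itself
    is the dominating function that yields the exact mass.\<close>
  have "(\<integral>\<^sup>+x. ennreal (d x) \<partial>lborel)
      = (\<integral>\<^sup>+x. liminf (\<lambda>n. ennreal (d x * (real (Suc n) * poisson (real (Suc n)) x))) \<partial>lborel)"
    by (intro nn_integral_cong lim_imp_Liminf[symmetric] tendsto_ennrealI dlim) simp
  also have "\<dots> \<le> liminf (\<lambda>n. \<integral>\<^sup>+x. ennreal (d x * (real (Suc n) * poisson (real (Suc n)) x)) \<partial>lborel)"
    by (intro nn_integral_liminf) measurable
  also have "(\<lambda>n. \<integral>\<^sup>+x. ennreal (d x * (real (Suc n) * poisson (real (Suc n)) x)) \<partial>lborel) = (\<lambda>n. ennreal (\<rho> (real (Suc n))))"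
    using i\<rho> \<rho> d0 by (intro ext, subst nn_integral_eq_integral) (auto simp: poisson_nonneg)
  also have "liminf \<dots> = ennreal 1"
    by (intro lim_imp_Liminf tendsto_ennrealI lim\<rho>') simp
  finally have "(\<integral>\<^sup>+x. ennreal (d x) \<partial>lborel) < \<infinity>" by (simp add: le_less_trans)
  then have id: "integrable lborel d"
    using d0 by (intro integrableI_nonneg) auto
  have "(\<lambda>n. LINT x|lborel. d x * (real (Suc n) * poisson (real (Suc n)) x)) \<longlonglongrightarrow> (LINT x|lborel. d x)"
  proof (rule integral_dominated_convergence[where w = d])
    show "AE x in lborel. norm (d x * (real (Suc n) * poisson (real (Suc n)) x)) \<le> d x" for n
      using d0 poisson_le[of "real (Suc n)"] poisson_nonneg[of "real (Suc n)"]
      by (intro AE_I2) (simp add: abs_mult mult_left_le)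
  qed (use id dlim in auto)
  then have "(LINT x|lborel. d x) = 1"
    using lim\<rho>' \<rho> by (simp add: LIMSEQ_unique)
  then have one: "(\<integral>\<^sup>+x. ennreal (d x) \<partial>lborel) = 1"
    using nn_integral_eq_integral[OF id] d0 by simp
  define \<nu> where "\<nu> = density lborel (\<lambda>x. ennreal (d x))"
  have "real_distribution \<nu>"
    unfolding real_distribution_def real_distribution_axioms_def \<nu>_def
    by (auto intro!: prob_spaceI simp: emeasure_density one)
  moreover have "cauchy_transform \<nu> z = G (z + \<i> * complex_of_real \<epsilon>)" if z: "Im z > 0" for z
  proof -
    have [measurable]: "(\<lambda>s. 1 / (z - complex_of_real s)) \<in> borel_measurable borel"
      using continuous_cauchy_kernel[OF z] by (rule borel_measurable_continuous_onI)
    have "cauchy_transform \<nu> z = (CLINT x|lborel. d x *\<^sub>R (1 / (z - complex_of_real x)))"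
      unfolding cauchy_transform_def \<nu>_def using d0 by (intro integral_density) auto
    also have "\<dots> = g z" by (rule P(1)[OF z])
    finally show ?thesis by (simp add: g_def)
  qed
  ultimately show ?thesis by blast
qed

text \<open>The real part is the integral of \<open>y^2 / (x^2 + y^2)\<close>, which is at most 1 on
  the interval and at most 1/2 off it.\<close>

lemma cauchy_transform_tail:
  assumes "real_distribution M" and y: "y > 0"
  shows "measure M {- y<..y} \<ge> 1 - 2 * (1 - Re (\<i> * complex_of_real y * cauchy_transform M (\<i> * complex_of_real y)))"
proof -
  interpret real_distribution M by fact
  have z: "Im (\<i> * complex_of_real y) > 0" using y by simp
  let ?f = "\<lambda>x. \<i> * complex_of_real y * (1 / (\<i> * complex_of_real y - complex_of_real x))"
  have i: "integrable M ?f"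
    by (intro integrable_mult_right integrable_cauchy_kernel prob_space_axioms events_eq_borel z)
  have f: "Re (?f x) = y * poisson y x" for x by (rule Re_kernel_eq_poisson[OF y])
  have ip: "integrable M (\<lambda>x. y * poisson y x)" using integrable_Re[OF i] unfolding f .
  have "(\<integral>x. y * poisson y x \<partial>M) = Re (CLINT x|M. ?f x)"
    unfolding integral_Re[OF i, symmetric] f ..
  also have "\<dots> = Re (\<i> * complex_of_real y * cauchy_transform M (\<i> * complex_of_real y))"
    unfolding integral_mult_right_zero cauchy_transform_def ..
  finally have eq: "(\<integral>x. y * poisson y x \<partial>M) = Re (\<i> * complex_of_real y * cauchy_transform M (\<i> * complex_of_real y))" .
  have im: "integrable M (\<lambda>x. 1/2 + indicator {- y<..y} x / (2::real))"
    by (intro Bochner_Integration.integrable_add integrable_divide integrable_const integrable_real_indicator) (auto simp: emeasure_eq_measure)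
  have "(\<integral>x. y * poisson y x \<partial>M) \<le> (\<integral>x. 1/2 + indicator {- y<..y} x / 2 \<partial>M)"
  proof (rule integral_mono[OF ip im])
    fix x
    show "y * poisson y x \<le> 1/2 + indicator {- y<..y} x / 2"
    proof (cases "x \<in> {- y<..y}")
      case True
      then show ?thesis using poisson_le[OF y] by simp
    next
      case False
      then have "y \<le> \<bar>x\<bar>" by auto
      then have "y\<^sup>2 \<le> x\<^sup>2" using y by (metis abs_le_square_iff abs_of_pos)
      then show ?thesis using False y
        by (simp add: poisson_def field_simps power2_eq_square add_nonneg_pos)
    qed
  qed
  also have "\<dots> = 1/2 + measure M {- y<..y} / 2"
    using im prob_space
    by (subst Bochner_Integration.integral_add) (auto intro!: integrable_real_indicator simp: emeasure_eq_measure)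
  finally show ?thesis unfolding eq by (simp add: algebra_simps)
qed

text \<open>The tails of the shifted measures are controlled uniformly by the behaviour of
  \<open>G\<close> at infinity, so the family is tight. A weak limit has the right transform because
  the Cauchy kernel is bounded and continuous.\<close>

theorem exists_measure_with_cauchy_transform:
  fixes G :: "complex \<Rightarrow> complex"
  assumes hol: "G holomorphic_on {z. Im z > 0}"
    and neg: "\<And>z. Im z > 0 \<Longrightarrow> Im (G z) \<le> 0"
    and decay: "\<And>\<epsilon>. \<epsilon> > 0 \<Longrightarrow> \<exists>C. \<forall>z. Im z \<ge> \<epsilon> \<longrightarrow> cmod (G z) \<le> C / cmod z"
    and lim: "((\<lambda>y. \<i> * complex_of_real y * G (\<i> * complex_of_real y)) \<longlongrightarrow> 1) at_top"
  shows "\<exists>\<nu>. real_distribution \<nu> \<and> (\<forall>z. Im z > 0 \<longrightarrow> cauchy_transform \<nu> z = G z)"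
proof -
  define \<epsilon> where "\<epsilon> n = inverse (real (Suc n))" for n
  have \<epsilon>: "\<epsilon> n > 0" "\<epsilon> n \<le> 1" for n by (auto simp: \<epsilon>_def inverse_le_1_iff)
  have "\<exists>\<nu>. real_distribution \<nu> \<and> (\<forall>z. Im z > 0 \<longrightarrow> cauchy_transform \<nu> z = G (z + \<i> * complex_of_real (\<epsilon> n)))" for n
  proof -
    obtain C where "\<And>z. Im z \<ge> \<epsilon> n \<Longrightarrow> cmod (G z) \<le> C / cmod z" using decay[OF \<epsilon>(1)] by blast
    from exists_shifted_measure[OF hol neg this lim \<epsilon>(1)] show ?thesis by blast
  qed
  then obtain \<nu> where \<nu>: "\<And>n. real_distribution (\<nu> n)"
    "\<And>n z. Im z > 0 \<Longrightarrow> cauchy_transform (\<nu> n) z = G (z + \<i> * complex_of_real (\<epsilon> n))" by metis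
  have "tight \<nu>"
    unfolding tight_def
  proof (intro conjI allI impI \<nu>(1))
    fix \<delta> :: real assume \<delta>: "\<delta> > 0"
    have "\<forall>\<^sub>F y in at_top. Re (\<i> * complex_of_real y * G (\<i> * complex_of_real y)) > max 0 (1 - \<delta> / 4)"
      using tendsto_Re[OF lim] \<delta> by (intro order_tendstoD(1)) auto
    then obtain Y where Y: "\<And>y. y \<ge> Y \<Longrightarrow> Re (\<i> * complex_of_real y * G (\<i> * complex_of_real y)) > max 0 (1 - \<delta> / 4)"
      by (auto simp: eventually_at_top_linorder)
    \<comment> \<open>Beyond \<open>4 / \<delta>\<close> a shift of at most 1 costs a factor of at
      least \<open>1 - \<delta> / 4\<close>, and beyond \<open>Y\<close> the limit costs another
      such factor. The loss stays below \<open>\<delta> / 2\<close>, which the tail estimate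
      doubles.\<close>
    define y where "y = max (max Y 1) (4 / \<delta>)"
    have y: "y \<ge> Y" "y \<ge> 1" "y \<ge> 4 / \<delta>" by (auto simp: y_def)
    have "measure (\<nu> n) {- y<..y} > 1 - \<delta>" for n
    proof -
      let ?r = "Re (\<i> * complex_of_real (y + \<epsilon> n) * G (\<i> * complex_of_real (y + \<epsilon> n)))"
      have r: "?r > max 0 (1 - \<delta> / 4)" using y \<epsilon>[of n] by (intro Y) auto
      have "Re (\<i> * complex_of_real y * cauchy_transform (\<nu> n) (\<i> * complex_of_real y)) = y / (y + \<epsilon> n) * ?r"
        using \<nu>(2)[of "\<i> * complex_of_real y" n] y \<epsilon>[of n] by (simp add: field_simps)
      moreover have "y / (y + \<epsilon> n) \<ge> 1 - \<delta> / 4"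
      proof -
        have "\<epsilon> n \<le> \<delta> / 4 * y" using y(3) \<delta> \<epsilon>[of n] by (simp add: field_simps)
        also have "\<dots> \<le> \<delta> / 4 * (y + \<epsilon> n)" using \<delta> \<epsilon>[of n] by (intro mult_left_mono) auto
        finally have "(1 - \<delta> / 4) * (y + \<epsilon> n) \<le> y" by (simp add: algebra_simps)
        moreover have "y + \<epsilon> n > 0" using y \<epsilon>[of n] by linarith
        ultimately show ?thesis by (simp only: pos_le_divide_eq)
      qed
      moreover have "(1 - \<delta> / 4) * ?r > 1 - \<delta> / 2" if "\<delta> \<le> 4"
      proof (cases "\<delta> = 4")
        case False
        have "(1 - \<delta> / 4) * (1 - \<delta> / 4) < (1 - \<delta> / 4) * ?r"
          using r that False by (intro mult_strict_left_mono) auto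
        moreover have "1 - \<delta> / 2 < (1 - \<delta> / 4) * (1 - \<delta> / 4)"
          using \<delta> by (simp add: algebra_simps)
        ultimately show ?thesis by linarith
      qed auto
      moreover have "0 \<le> y / (y + \<epsilon> n) * ?r" using y \<epsilon>[of n] r by (intro mult_nonneg_nonneg) auto
      moreover have "y / (y + \<epsilon> n) * ?r \<ge> (1 - \<delta> / 4) * ?r"
        using calculation(2) r by (intro mult_right_mono) auto
      ultimately have "Re (\<i> * complex_of_real y * cauchy_transform (\<nu> n) (\<i> * complex_of_real y)) > 1 - \<delta> / 2"
        using \<delta> by (cases "\<delta> \<le> 4") auto
      then show ?thesis
        using cauchy_transform_tail[OF \<nu>(1)[of n], of y] y by simp
    qed
    moreover have "- y < y" using y by simp
    ultimately show "\<exists>a b. a < b \<and> (\<forall>n. 1 - \<delta> < measure (\<nu> n) {a<..b})" by blast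
  qed
  from tight_imp_convergent_subsubsequence[OF this strict_mono_id] obtain r M where
    r: "strict_mono r" and M: "real_distribution M" and wc: "weak_conv_m (\<lambda>n. \<nu> (r n)) M"
    by (auto simp: o_def id_def)
  have "cauchy_transform M z = G z" if z: "Im z > 0" for z
  proof (rule LIMSEQ_unique)
    have "isCont (\<lambda>s. 1 / (z - complex_of_real s)) x" for x
      using continuous_cauchy_kernel[OF z] by (simp add: continuous_on_eq_continuous_at)
    from weak_conv_imp_integral_bdd_continuous_conv[OF \<nu>(1) M wc this norm_cauchy_kernel_le[OF z]]
    have "(\<lambda>n. cauchy_transform (\<nu> (r n)) z) \<longlonglongrightarrow> cauchy_transform M z"
      by (simp add: cauchy_transform_def)
    then show "(\<lambda>n. G (z + \<i> * complex_of_real (\<epsilon> (r n)))) \<longlonglongrightarrow> cauchy_transform M z"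
      using \<nu>(2)[OF z] by simp
    have "(\<lambda>n. \<epsilon> (r n)) \<longlonglongrightarrow> 0"
      using LIMSEQ_subseq_LIMSEQ[OF LIMSEQ_inverse_real_of_nat r] by (simp add: \<epsilon>_def o_def)
    then have "(\<lambda>n. z + \<i> * complex_of_real (\<epsilon> (r n))) \<longlonglongrightarrow> z + \<i> * complex_of_real 0"
      by (intro tendsto_add tendsto_mult tendsto_of_real tendsto_const)
    moreover have "isCont G z"
      using holomorphic_on_imp_continuous_on[OF hol] z
      by (simp add: continuous_on_eq_continuous_at open_halfspace_Im_gt)
    ultimately show "(\<lambda>n. G (z + \<i> * complex_of_real (\<epsilon> (r n)))) \<longlonglongrightarrow> G z"
      using isCont_tendsto_compose[of z G] by simp
  qed
  then show ?thesis using M by blast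
qed

section \<open>The free convolution power and its atoms\<close>

text \<open>Inside the cone \<open>(u - x) / (u - s)\<close> is bounded by \<open>C\<close>, so
  dominated convergence applies; the pointwise limit is the indicator of \<open>x\<close>.\<close>

lemma nontangential_limit:
  fixes x C :: real
  assumes M: "prob_space M" "sets M = sets borel"
    and u: "u \<longlonglongrightarrow> complex_of_real x"
    and pos: "\<And>n. Im (u n) > 0" and cone: "\<And>n. cmod (u n - complex_of_real x) \<le> C * Im (u n)"
  shows "(\<lambda>n. (u n - complex_of_real x) * cauchy_transform M (u n)) \<longlonglongrightarrow> complex_of_real (measure M {x})"
proof -
  interpret prob_space M by fact
  note M(2)[measurable_cong]
  have meas: "(\<lambda>s. 1 / (z - complex_of_real s)) \<in> borel_measurable M" if "Im z > 0" for z
    using integrable_cauchy_kernel[OF M that] by simp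
  have "(\<lambda>n. CLINT s|M. (u n - complex_of_real x) * (1 / (u n - complex_of_real s)))
      \<longlonglongrightarrow> (CLINT s|M. complex_of_real (indicator {x} s))"
  proof (rule integral_dominated_convergence[where w = "\<lambda>_. C"])
    show "(\<lambda>s. complex_of_real (indicator {x} s)) \<in> borel_measurable M"
      by measurable
    show "(\<lambda>s. (u n - complex_of_real x) * (1 / (u n - complex_of_real s))) \<in> borel_measurable M" for n
      by (intro borel_measurable_times borel_measurable_const meas pos)
    show "AE s in M. (\<lambda>n. (u n - complex_of_real x) * (1 / (u n - complex_of_real s))) \<longlonglongrightarrow> complex_of_real (indicator {x} s)"
    proof (rule AE_I2)
      fix s
      show "(\<lambda>n. (u n - complex_of_real x) * (1 / (u n - complex_of_real s))) \<longlonglongrightarrow> complex_of_real (indicator {x} s)"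
      proof (cases "s = x")
        case True
        then show ?thesis using cauchy_denom_nonzero[OF pos] by simp
      next
        case False
        have "(\<lambda>n. (u n - complex_of_real x) * (1 / (u n - complex_of_real s)))
           \<longlonglongrightarrow> (complex_of_real x - complex_of_real x) * (1 / (complex_of_real x - complex_of_real s))"
          using False by (intro tendsto_intros u) auto
        then show ?thesis using False by simp
      qed
    qed
    show "AE s in M. norm ((u n - complex_of_real x) * (1 / (u n - complex_of_real s))) \<le> C" for n
    proof (rule AE_I2)
      fix s
      have "cmod (u n - complex_of_real x) \<le> C * cmod (u n - complex_of_real s)"
      proof -
        have "C * Im (u n) \<ge> 0" using cone[of n] norm_ge_zero order.trans by blast
        then have "C \<ge> 0" using pos[of n] by (simp add: zero_le_mult_iff)
        then show ?thesis
          using cone[of n] mult_left_mono[OF Im_le_cauchy_denom[of "u n" s], of C] by linarith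
      qed
      then show "norm ((u n - complex_of_real x) * (1 / (u n - complex_of_real s))) \<le> C"
        using cauchy_denom_nonzero[OF pos, of n s] by (simp add: norm_mult norm_divide divide_le_eq)
    qed
  qed simp
  moreover have "(CLINT s|M. complex_of_real (indicator {x} s)) = complex_of_real (measure M {x})"
    using M(2) sets_eq_imp_space_eq[OF M(2)] by (simp add: integral_indicator)
  ultimately show ?thesis
    unfolding cauchy_transform_def integral_mult_right_zero[symmetric] by (simp only:)
qed

text \<open>The direction \<open>g n\<close> tends to a positive real \<open>c\<close>, so
  eventually \<open>c / 2 < Re (g n)\<close> and \<open>cmod (g n) < 2 * c\<close>: the approach is
  nontangential with constant 4. Images of vertical sequences under \<open>H\<close> and
  \<open>\<omega>\<close> have this form.\<close>

lemma vertical_limit: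
  fixes x c :: real
  assumes M: "prob_space M" "sets M = sets borel"
    and y: "\<And>n. y n > 0" "y \<longlonglongrightarrow> (0::real)"
    and g: "g \<longlonglongrightarrow> complex_of_real c" "c > 0"
    and u: "\<And>n. u n = complex_of_real x + \<i> * complex_of_real (y n) * g n"
  shows "\<forall>\<^sub>F n in sequentially. Im (u n) > 0"
    and "(\<lambda>n. (u n - complex_of_real x) * cauchy_transform M (u n)) \<longlonglongrightarrow> complex_of_real (measure M {x})"
proof -
  have Im: "Im (u n) = y n * Re (g n)" for n by (simp add: u)
  have "(\<lambda>n. Re (g n)) \<longlonglongrightarrow> c" using tendsto_Re[OF g(1)] by simp
  then have 1: "\<forall>\<^sub>F n in sequentially. c / 2 < Re (g n)" using g(2) by (intro order_tendstoD(1)) auto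
  have "(\<lambda>n. cmod (g n)) \<longlonglongrightarrow> c" using tendsto_norm[OF g(1)] g(2) by simp
  then have 2: "\<forall>\<^sub>F n in sequentially. cmod (g n) < 2 * c" using g(2) by (intro order_tendstoD(2)) auto
  from 1 2 have "\<forall>\<^sub>F n in sequentially. c / 2 < Re (g n) \<and> cmod (g n) < 2 * c" by (rule eventually_conj)
  then obtain N where N: "\<And>n. n \<ge> N \<Longrightarrow> c / 2 < Re (g n)" "\<And>n. n \<ge> N \<Longrightarrow> cmod (g n) < 2 * c"
    by (auto simp: eventually_sequentially)
  have pos: "Im (u n) > 0" if "n \<ge> N" for n
    unfolding Im using N(1)[OF that] g(2) y(1)[of n] by (intro mult_pos_pos) auto
  then show "\<forall>\<^sub>F n in sequentially. Im (u n) > 0" by (auto simp: eventually_sequentially)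
  have "u \<longlonglongrightarrow> complex_of_real x + \<i> * complex_of_real 0 * complex_of_real c"
    unfolding u[abs_def] by (intro tendsto_add tendsto_mult tendsto_of_real tendsto_const y g)
  then have lim: "u \<longlonglongrightarrow> complex_of_real x" by simp
  have "(\<lambda>n. (u (n + N) - complex_of_real x) * cauchy_transform M (u (n + N))) \<longlonglongrightarrow> complex_of_real (measure M {x})"
  proof (rule nontangential_limit[OF M LIMSEQ_ignore_initial_segment[OF lim], where C = 4])
    fix n
    show "Im (u (n + N)) > 0" by (rule pos) simp
    have "cmod (u (n + N) - complex_of_real x) = y (n + N) * cmod (g (n + N))"
      using y(1)[of "n + N"] by (simp add: u norm_mult)
    also have "\<dots> \<le> y (n + N) * (4 * Re (g (n + N)))"
      using N(1)[of "n + N"] N(2)[of "n + N"] y(1)[of "n + N"] by (intro mult_left_mono) auto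
    finally show "cmod (u (n + N) - complex_of_real x) \<le> 4 * Im (u (n + N))" by (simp add: Im)
  qed
  then show "(\<lambda>n. (u n - complex_of_real x) * cauchy_transform M (u n)) \<longlonglongrightarrow> complex_of_real (measure M {x})"
    by (rule LIMSEQ_offset)
qed

lemma holomorphic_cauchy_transform:
  assumes M: "prob_space M" "sets M = sets borel"
  shows "cauchy_transform M holomorphic_on {z. Im z > 0}"
proof -
  interpret prob_space M by fact
  let ?r = "\<lambda>z s. 1 / (z - complex_of_real s)"
  have meas: "?r z \<in> borel_measurable M" if "Im z > 0" for z
    using integrable_cauchy_kernel[OF M that] by simp
  have int2: "integrable M (\<lambda>s. ?r z s * ?r w s)" if "Im z > 0" "Im w > 0" for z w
  proof (rule integrable_const_bound)
    show "(\<lambda>s. ?r z s * ?r w s) \<in> borel_measurable M"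
      by (intro borel_measurable_times meas that)
    show "AE s in M. norm (?r z s * ?r w s) \<le> 1 / Im z * (1 / Im w)"
      unfolding norm_mult using that by (intro AE_I2 mult_mono norm_cauchy_kernel_le) auto
  qed
  have rdiff: "?r z s - ?r w s = (w - z) * (?r w s * ?r z s)" if "Im z > 0" "Im w > 0" for z w s
    using cauchy_denom_nonzero[OF that(1)] cauchy_denom_nonzero[OF that(2)] by (simp add: field_simps)
  have "(cauchy_transform M has_field_derivative - (CLINT s|M. ?r z s * ?r z s)) (at z)" if z: "Im z > 0" for z
  proof -
    \<comment> \<open>Near \<open>z\<close> every point has height above \<open>y\<close>, which
      makes all kernels at most \<open>1 / y\<close> and the error of the difference quotient linear
      in \<open>w - z\<close>.\<close>
    define y where "y = Im z / 2"
    have y: "y > 0" using z by (simp add: y_def)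
    have near: "\<forall>\<^sub>F w in at z. Im w > y"
      using order_tendstoD(1)[OF tendsto_Im[OF tendsto_ident_at], of y z] y by (simp add: y_def)
    have "((\<lambda>w. (cauchy_transform M w - cauchy_transform M z) / (w - z) + (CLINT s|M. ?r z s * ?r z s)) \<longlongrightarrow> 0) (at z)"
    proof (rule Lim_null_comparison)
      show "\<forall>\<^sub>F w in at z. norm ((cauchy_transform M w - cauchy_transform M z) / (w - z) + (CLINT s|M. ?r z s * ?r z s))
          \<le> norm (w - z) * (1 / y ^ 3)"
        using near eventually_neq_at_within[of z z UNIV]
      proof eventually_elim
        case (elim w)
        have wz: "w \<noteq> z" and w: "Im w > y" "Im w > 0" using elim y by auto
          have "cauchy_transform M w - cauchy_transform M z = (CLINT s|M. ?r w s - ?r z s)"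
            unfolding cauchy_transform_def
            by (intro Bochner_Integration.integral_diff[symmetric] integrable_cauchy_kernel M w z)
          also have "\<dots> = (CLINT s|M. - (w - z) * (?r w s * ?r z s))"
            by (intro Bochner_Integration.integral_cong refl)
              (use cauchy_denom_nonzero[OF w(2)] cauchy_denom_nonzero[OF z] in \<open>simp add: field_simps\<close>)
          also have "\<dots> = - (w - z) * (CLINT s|M. ?r w s * ?r z s)" by (rule integral_mult_right_zero)
          finally have "(cauchy_transform M w - cauchy_transform M z) / (w - z) = - (CLINT s|M. ?r w s * ?r z s)"
            using wz by (simp add: field_simps)
          then have "(cauchy_transform M w - cauchy_transform M z) / (w - z) + (CLINT s|M. ?r z s * ?r z s)
             = (CLINT s|M. ?r z s * ?r z s - ?r w s * ?r z s)"
            by (subst Bochner_Integration.integral_diff) (use int2 w z in auto)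
          also have "\<dots> = (CLINT s|M. (w - z) * (?r w s * (?r z s * ?r z s)))"
          proof (intro Bochner_Integration.integral_cong refl)
            fix s
            have "?r z s * ?r z s - ?r w s * ?r z s = (?r z s - ?r w s) * ?r z s" by (rule left_diff_distrib[symmetric])
            then show "?r z s * ?r z s - ?r w s * ?r z s = (w - z) * (?r w s * (?r z s * ?r z s))"
              unfolding rdiff[OF z w(2)] by (simp only: mult.assoc)
          qed
          also have "\<dots> = (w - z) * (CLINT s|M. ?r w s * (?r z s * ?r z s))" by (rule integral_mult_right_zero)
          finally have eq: "(cauchy_transform M w - cauchy_transform M z) / (w - z) + (CLINT s|M. ?r z s * ?r z s)
             = (w - z) * (CLINT s|M. ?r w s * (?r z s * ?r z s))" .
          have b: "norm (?r w s * (?r z s * ?r z s)) \<le> 1 / y ^ 3" for s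
          proof -
            have "1 / Im w \<le> 1 / y" "1 / Im z \<le> 1 / y"
              using w y unfolding y_def by (intro frac_le; simp)+
            then have "norm (?r w s) \<le> 1 / y" "norm (?r z s) \<le> 1 / y"
              using norm_cauchy_kernel_le[OF w(2), of s] norm_cauchy_kernel_le[OF z, of s] by linarith+
            then have "norm (?r w s) * (norm (?r z s) * norm (?r z s)) \<le> 1 / y * (1 / y * (1 / y))"
              using y by (intro mult_mono) auto
            then show ?thesis unfolding norm_mult by (simp add: power3_eq_cube)
          qed
          have "integrable M (\<lambda>s. ?r w s * (?r z s * ?r z s))"
            using b by (intro integrable_const_bound[where B = "1 / y ^ 3"] borel_measurable_times meas w z) simp
          then have "norm (CLINT s|M. ?r w s * (?r z s * ?r z s)) \<le> (\<integral>s. 1 / y ^ 3 \<partial>M)"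
            using b by (intro Bochner_Integration.integral_norm_bound_integral) auto
          then show ?case
            unfolding eq norm_mult by (intro mult_left_mono) (auto simp: prob_space)
      qed
      have "((\<lambda>w. norm (w - z) * (1 / y ^ 3)) \<longlongrightarrow> norm (z - z) * (1 / y ^ 3)) (at z)"
        by (intro tendsto_intros)
      then show "((\<lambda>w. norm (w - z) * (1 / y ^ 3)) \<longlongrightarrow> 0) (at z)" by simp
    qed
    then have "((\<lambda>w. (cauchy_transform M w - cauchy_transform M z) / (w - z)) \<longlongrightarrow> - (CLINT s|M. ?r z s * ?r z s)) (at z)"
      by (subst LIM_zero_iff[symmetric]) simp
    then show ?thesis by (simp add: has_field_derivative_iff)
  qed
  then show ?thesis
    unfolding holomorphic_on_def field_differentiable_def
    by (blast intro: has_field_derivative_at_within)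
qed

section \<open>Identification of the free power by its Cauchy transform\<close>

context uniform_atoms
begin

lemma prob_space_diag_distribution: "prob_space (diag_distribution k \<alpha>)"
  unfolding diag_distribution_def
  using k_pos by (intro prob_space.prob_space_distr prob_space_uniform_count_measure) auto

lemma sets_diag_distribution: "sets (diag_distribution k \<alpha>) = sets borel"
  by (simp add: diag_distribution_def)

lemma cauchy_transform_diag:
  assumes "Im w > 0"
  shows "cauchy_transform (diag_distribution k \<alpha>) w = G w"
proof -
  have "(\<lambda>s. 1 / (w - complex_of_real s)) \<in> borel_measurable borel"
    using continuous_cauchy_kernel[OF assms] by (rule borel_measurable_continuous_onI)
  then have "cauchy_transform (diag_distribution k \<alpha>) w
      = (CLINT i|uniform_count_measure {..<k}. 1 / (w - complex_of_real (\<alpha> i)))"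
    unfolding cauchy_transform_def diag_distribution_def by (subst integral_distr) auto
  then show ?thesis
    using k_pos unfolding uniform_count_measure_def G_def avg_def
    by (subst (asm) lebesgue_integral_point_measure_finite) (auto simp: scaleR_conv_of_real sum_divide_distrib mult.commute)
qed

lemma F_transform_diag: "Im w > 0 \<Longrightarrow> F_transform (diag_distribution k \<alpha>) w = F w"
  by (simp add: F_transform_def F_def cauchy_transform_diag)

lemma measure_diag_distribution:
  "measure (diag_distribution k \<alpha>) {x} = card {j. j < k \<and> \<alpha> j = x} / k"
proof -
  let ?U = "uniform_count_measure {..<k}"
  have *: "\<alpha> -` {x} \<inter> space ?U = {j. j < k \<and> \<alpha> j = x}" by (auto simp: space_uniform_count_measure)
  have "\<alpha> \<in> measurable ?U borel" by (simp add: measurable_def space_uniform_count_measure sets_uniform_count_measure)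
  then have "measure (diag_distribution k \<alpha>) {x} = measure ?U {j. j < k \<and> \<alpha> j = x}"
    unfolding diag_distribution_def *[symmetric] by (rule measure_distr) simp
  also have "\<dots> = card {j. j < k \<and> \<alpha> j = x} / card {..<k}"
    by (rule measure_uniform_count_measure) auto
  finally show ?thesis by simp
qed

text \<open>Above height \<open>sqrt var\<close> the estimate \<open>F_minus_id_le\<close> forces
  \<open>\<kappa> < 1\<close>, so the second factor of \<open>F_diff\<close> cannot vanish.\<close>

lemma F_inj_upper:
  assumes "Im w > sqrt var" "Im w' > sqrt var" "F w = F w'"
  shows "w = w'"
proof -
  have *: "\<kappa> z < 1" "Im z > 0" if z: "Im z > sqrt var" for z
  proof -
    have "sqrt var \<ge> 0" using var_nonneg by simp
    then show pos: "Im z > 0" using z by linarith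
    have "Im z * \<kappa> z \<le> cmod (F z - z + of_real mean)"
      using abs_Im_le_cmod[of "F z - z + of_real mean"] Im_F[OF pos] by (simp add: algebra_simps)
    also have "\<dots> \<le> var / Im z" by (rule F_minus_id_le[OF pos])
    also have "\<dots> < Im z"
    proof -
      have "(sqrt var)\<^sup>2 < (Im z)\<^sup>2" using z var_nonneg by (intro power_strict_mono) auto
      then show ?thesis using pos var_nonneg by (simp add: divide_less_eq power2_eq_square)
    qed
    finally show "\<kappa> z < 1" using pos by simp
  qed
  have "norm (avg (\<lambda>i. dev w i * dev w' i)) < 1"
    using norm_avg_dev_mult[of w w'] *(1)[OF assms(1)] *(1)[OF assms(2)] by simp
  then have "1 + avg (\<lambda>i. dev w i * dev w' i) \<noteq> 0"
    by (metis add.inverse_unique norm_minus_cancel norm_one order_less_irrefl)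
  then show ?thesis
    using F_diff[OF regular_upper regular_upper, of w w'] * assms by simp
qed

text \<open>Brouwer for \<open>w \<mapsto> z - (F w - w)\<close> on the disc of radius
  \<open>c\<close> about \<open>z + mean\<close>. As \<open>Im z \<ge> 2 * c\<close>, the disc lies
  above height \<open>c\<close>, where the displacement is at most \<open>var / c\<close>, hence at
  most \<open>c\<close>.\<close>

lemma F_surj_upper:
  assumes c: "c > 0" "var \<le> c\<^sup>2" and z: "Im z \<ge> 2 * c"
  shows "\<exists>w. cmod (w - (z + of_real mean)) \<le> c \<and> Im w \<ge> c \<and> F w = z"
proof -
  define K where "K = cball (z + of_real mean) c"
  define \<Psi> where "\<Psi> w = z - (F w - w)" for w
  have Im: "Im w \<ge> c" if "w \<in> K" for w
    using that z abs_Im_le_cmod[of "z + of_real mean - w"] by (simp add: K_def dist_norm)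
  show ?thesis
  proof (rule brouwer[of K \<Psi>])
    show "compact K" "convex K" "K \<noteq> {}" using c by (auto simp: K_def)
    have "K \<subseteq> {w. Im w > 0}" using Im c by force
    then show "continuous_on K \<Psi>"
      unfolding \<Psi>_def by (intro continuous_intros holomorphic_on_imp_continuous_on
          holomorphic_on_subset[OF holomorphic_F])
    show "\<Psi> \<in> K \<rightarrow> K"
    proof
      fix w assume "w \<in> K"
      then have w: "Im w \<ge> c" by (rule Im)
      have "dist (z + of_real mean) (\<Psi> w) = cmod (F w - w + of_real mean)"
        by (simp add: dist_norm \<Psi>_def algebra_simps)
      also have "\<dots> \<le> var / Im w" using w c by (intro F_minus_id_le) auto
      also have "\<dots> \<le> c\<^sup>2 / c" using w c var_nonneg by (intro frac_le) auto
      finally show "\<Psi> w \<in> K" using c by (simp add: K_def power2_eq_square)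
    qed
    fix w assume w: "w \<in> K" "\<Psi> w = w"
    then have "cmod (w - (z + of_real mean)) \<le> c" by (simp add: K_def dist_norm norm_minus_commute)
    moreover have "F w = z" using w(2) by (simp add: \<Psi>_def)
    ultimately show ?thesis using Im[OF w(1)] by blast
  qed
qed

end

context subordination
begin

lemma exists_subordinate_measure:
  "\<exists>\<nu>. real_distribution \<nu> \<and> (\<forall>z. Im z > 0 \<longrightarrow> cauchy_transform \<nu> z = G (\<omega> z))"
  by (intro exists_measure_with_cauchy_transform holomorphic_G_\<omega> less_imp_le Im_G_\<omega> G_\<omega>_decay G_\<omega>_at_infinity)

text \<open>Take \<open>w\<close> with \<open>F w = z\<close> and \<open>v = H w\<close>. Then
  \<open>\<omega> v = w\<close>, so \<open>v\<close> is the preimage of \<open>z\<close> for the new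
  measure, and \<open>v - z = (1 + s) (w - z)\<close> is precisely the relation between the
  Voiculescu transforms.\<close>

lemma is_free_powerI:
  assumes \<nu>: "real_distribution \<nu>" "\<And>z. Im z > 0 \<Longrightarrow> cauchy_transform \<nu> z = G (\<omega> z)"
  shows "is_free_power (diag_distribution k \<alpha>) (1 + s) \<nu>"
proof -
  interpret \<nu>: real_distribution \<nu> by fact
  let ?\<mu> = "diag_distribution k \<alpha>"
  define c where "c = sqrt var + 1"
  define B where "B = (1 + s) * (c + \<bar>mean\<bar>)"
  \<comment> \<open>\<open>B\<close> bounds the displacement of both inverses. A point of the cone
    of aperture 1 above \<open>2 c + 3 B\<close>, moved by at most \<open>B\<close>, keeps height
    above \<open>2 c + 2 B\<close>, and its aperture grows to at most 2.\<close>
  define M where "M = 2 * c + 3 * B"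
  define \<Gamma> where "\<Gamma> = truncated_cone 2 c"
  have c: "c > 0" "var \<le> c\<^sup>2" "c > sqrt var"
    using var_nonneg by (auto simp: c_def power2_sum add_nonneg_pos)
  have B: "B \<ge> 0" "c + \<bar>mean\<bar> \<le> B"
    unfolding B_def using c s_nonneg by (auto simp: distrib_right mult_nonneg_nonneg)
  have Fnu: "F_transform \<nu> z = F (\<omega> z)" if "Im z > 0" for z
    using \<nu>(2)[OF that] by (simp add: F_transform_def F_def)
  have mem: "v \<in> \<Gamma>" if z: "z \<in> truncated_cone 1 M" and v: "cmod (v - z) \<le> B" for v z
    using z abs_Re_le_cmod[of "v - z"] abs_Im_le_cmod[of "v - z"] v B c
    by (auto simp: \<Gamma>_def truncated_cone_def M_def)
  have inj\<mu>: "inj_on (F_transform ?\<mu>) \<Gamma>"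
  proof (rule inj_onI)
    fix w w' assume "w \<in> \<Gamma>" "w' \<in> \<Gamma>" and eq: "F_transform ?\<mu> w = F_transform ?\<mu> w'"
    then have w: "Im w > c" "Im w' > c" by (auto simp: \<Gamma>_def truncated_cone_def)
    then have pos: "Im w > 0" "Im w' > 0" using c(1) by linarith+
    show "w = w'"
    proof (rule F_inj_upper)
      show "F w = F w'" using eq by (simp only: F_transform_diag pos)
    qed (use w c(3) in linarith)+
  qed
  have inj\<nu>: "inj_on (F_transform \<nu>) \<Gamma>"
  proof (rule inj_onI)
    fix w w' assume "w \<in> \<Gamma>" "w' \<in> \<Gamma>" and eq: "F_transform \<nu> w = F_transform \<nu> w'"
    then have w: "Im w > c" "Im w' > c" by (auto simp: \<Gamma>_def truncated_cone_def)
    then have pos: "Im w > 0" "Im w' > 0" using c(1) by linarith+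
    have "\<omega> w = \<omega> w'"
    proof (rule F_inj_upper)
      show "F (\<omega> w) = F (\<omega> w')" using eq by (simp only: Fnu pos)
    qed (use w c(3) Im_\<omega>_ge[OF pos(1)] Im_\<omega>_ge[OF pos(2)] in linarith)+
    then show "w = w'" using H_\<omega>[OF pos(1)] H_\<omega>[OF pos(2)] by metis
  qed
  have ex: "\<exists>w v. w \<in> \<Gamma> \<and> v \<in> \<Gamma> \<and> F_transform ?\<mu> w = z \<and> F_transform \<nu> v = z \<and> v - z = (1 + of_real s) * (w - z)"
    if z: "z \<in> truncated_cone 1 M" for z
  proof -
    have "Im z \<ge> 2 * c" using z B by (auto simp: truncated_cone_def M_def)
    from F_surj_upper[OF c(1,2) this] obtain w
      where w: "cmod (w - (z + of_real mean)) \<le> c" "Im w \<ge> c" "F w = z" by blast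
    define v where "v = H w"
    have wz: "cmod (w - z) \<le> c + \<bar>mean\<bar>"
      using norm_triangle_ineq[of "w - (z + of_real mean)" "of_real mean"] w(1) by simp
    have v: "v - z = (1 + of_real s) * (w - z)" by (simp add: v_def H_def w(3) algebra_simps)
    have "cmod (v - z) = (1 + s) * cmod (w - z)"
      unfolding v norm_mult using s_nonneg norm_of_real[where 'a = complex, of "1 + s"] by simp
    also have "\<dots> \<le> B" unfolding B_def using wz s_nonneg by (intro mult_left_mono) auto
    finally have "v \<in> \<Gamma>" by (rule mem[OF z])
    have "w \<in> \<Gamma>" using wz B(2) by (intro mem[OF z]) simp
    have "Im v > 0" "Im w > 0" using \<open>v \<in> \<Gamma>\<close> w c by (auto simp: \<Gamma>_def truncated_cone_def)
    then have "\<omega> v = w" unfolding v_def by (intro \<omega>_H) (auto simp: \<Omega>_def)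
    then have "F_transform \<nu> v = z" using Fnu[OF \<open>Im v > 0\<close>] w(3) by simp
    moreover have "F_transform ?\<mu> w = z" using \<open>Im w > 0\<close> w(3) by (simp add: F_transform_diag)
    ultimately show ?thesis using \<open>v \<in> \<Gamma>\<close> \<open>w \<in> \<Gamma>\<close> v by blast
  qed
  have "\<exists>\<eta>>0. \<exists>M>0. \<Gamma> = truncated_cone \<eta> M"
    using c(1) unfolding \<Gamma>_def by (intro exI[of _ 2] conjI exI[of _ c]) auto
  moreover have "truncated_cone 1 M \<subseteq> F_transform ?\<mu> ` \<Gamma>"
    using ex by blast
  moreover have "truncated_cone 1 M \<subseteq> F_transform \<nu> ` \<Gamma>"
  proof
    fix z assume "z \<in> truncated_cone 1 M"
    from ex[OF this] obtain v where "v \<in> \<Gamma>" "F_transform \<nu> v = z" by blast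
    then show "z \<in> F_transform \<nu> ` \<Gamma>" by blast
  qed
  ultimately have dom: "voiculescu_domain ?\<mu> \<Gamma> (truncated_cone 1 M)" "voiculescu_domain \<nu> \<Gamma> (truncated_cone 1 M)"
    unfolding voiculescu_domain_def using inj\<mu> inj\<nu> by simp_all
  have rel: "voiculescu_transform \<nu> \<Gamma> z = complex_of_real (1 + s) * voiculescu_transform ?\<mu> \<Gamma> z"
    if z: "z \<in> truncated_cone 1 M" for z
  proof -
    obtain w v where wv: "w \<in> \<Gamma>" "v \<in> \<Gamma>" "F_transform ?\<mu> w = z" "F_transform \<nu> v = z" "v - z = (1 + of_real s) * (w - z)"
      using ex[OF z] by blast
    have "the_inv_into \<Gamma> (F_transform ?\<mu>) z = w" using the_inv_into_f_f[OF inj\<mu> wv(1)] wv(3) by simp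
    moreover have "the_inv_into \<Gamma> (F_transform \<nu>) z = v" using the_inv_into_f_f[OF inj\<nu> wv(2)] wv(4) by simp
    ultimately show ?thesis using wv(5) by (simp add: voiculescu_transform_def)
  qed
  have "M > 0" using c B by (simp add: M_def)
  have "prob_space \<nu>" "sets \<nu> = sets borel" using \<nu>.prob_space_axioms \<nu>.events_eq_borel by auto
  moreover have "\<exists>\<Gamma> \<Gamma>'. voiculescu_domain ?\<mu> \<Gamma> (truncated_cone 1 M) \<and> voiculescu_domain \<nu> \<Gamma>' (truncated_cone 1 M)
      \<and> (\<forall>z\<in>truncated_cone 1 M. voiculescu_transform \<nu> \<Gamma>' z = complex_of_real (1 + s) * voiculescu_transform ?\<mu> \<Gamma> z)"
    using dom rel by (intro exI[of _ \<Gamma>] conjI ballI)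
  ultimately show ?thesis
    unfolding is_free_power_def using zero_less_one \<open>M > 0\<close> by blast
qed

text \<open>The uniqueness half. Where both inverses are available, the defining relation says
  \<open>v = H w\<close>, hence \<open>\<omega> v = w\<close>, and the transforms agree. That region
  contains a nonempty open set, from which the identity theorem reaches the whole half
  plane.\<close>

lemma cauchy_transform_free_power:
  assumes "is_free_power (diag_distribution k \<alpha>) (1 + s) \<nu>" and z0: "Im z0 > 0"
  shows "cauchy_transform \<nu> z0 = G (\<omega> z0)"
proof -
  let ?\<mu> = "diag_distribution k \<alpha>"
  obtain \<eta> M \<Gamma> \<Gamma>' where \<nu>: "prob_space \<nu>" "sets \<nu> = sets borel" and \<eta>: "\<eta> > 0" "M > 0"
    and dom: "voiculescu_domain ?\<mu> \<Gamma> (truncated_cone \<eta> M)" "voiculescu_domain \<nu> \<Gamma>' (truncated_cone \<eta> M)"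
    and rel: "\<And>z. z \<in> truncated_cone \<eta> M \<Longrightarrow>
       voiculescu_transform \<nu> \<Gamma>' z = complex_of_real (1 + s) * voiculescu_transform ?\<mu> \<Gamma> z"
    using assms(1) unfolding is_free_power_def by metis
  have open_cone: "open (truncated_cone a b)" for a b
    unfolding truncated_cone_def by (intro open_Collect_conj open_Collect_less continuous_intros)
  obtain \<eta>' M' where \<Gamma>': "\<Gamma>' = truncated_cone \<eta>' M'" "M' > 0" using dom(2) by (auto simp: voiculescu_domain_def)
  have \<Gamma>: "Im w > 0" if "w \<in> \<Gamma>" for w using that dom(1) by (auto simp: voiculescu_domain_def truncated_cone_def)
  have eq: "cauchy_transform \<nu> v = G (\<omega> v)" if v: "v \<in> \<Gamma>'" and z: "F_transform \<nu> v \<in> truncated_cone \<eta> M" for v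
  proof -
    define z where "z = F_transform \<nu> v"
    have zc: "z \<in> truncated_cone \<eta> M" using z by (simp add: z_def)
    have "inj_on (F_transform \<nu>) \<Gamma>'" using dom(2) by (simp add: voiculescu_domain_def)
    then have iv: "the_inv_into \<Gamma>' (F_transform \<nu>) z = v" unfolding z_def by (rule the_inv_into_f_f[OF _ v])
    have inj: "inj_on (F_transform ?\<mu>) \<Gamma>" using dom(1) by (simp add: voiculescu_domain_def)
    obtain w where w: "w \<in> \<Gamma>" "F_transform ?\<mu> w = z" using dom(1) zc by (auto simp: voiculescu_domain_def)
    then have iw: "the_inv_into \<Gamma> (F_transform ?\<mu>) z = w" using the_inv_into_f_f[OF inj] by blast
    have Fw: "F w = z" using w \<Gamma>[OF w(1)] by (simp add: F_transform_diag)
    have "v - z = (1 + of_real s) * (w - z)"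
      using rel[OF zc] by (simp add: voiculescu_transform_def iv iw)
    then have "v = H w" by (simp add: H_def Fw algebra_simps)
    moreover have "Im v > 0" using v \<Gamma>' by (auto simp: truncated_cone_def)
    ultimately have "\<omega> v = w" using \<omega>_H[of w] \<Gamma>[OF w(1)] by (auto simp: \<Omega>_def)
    then have "F_transform \<nu> v = F (\<omega> v)" using Fw by (simp add: z_def)
    then show ?thesis by (simp add: F_transform_def F_def)
  qed
  let ?U = "{z. Im z > 0}"
  have hol: "cauchy_transform \<nu> holomorphic_on ?U" by (rule holomorphic_cauchy_transform[OF \<nu>])
  define z1 where "z1 = Complex 0 (M + 1)"
  have z1: "z1 \<in> truncated_cone \<eta> M" using \<eta> by (simp add: z1_def truncated_cone_def)
  \<comment> \<open>A preimage of an interior point of the cone. The transform does not vanish at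
    \<open>v1\<close>, so its reciprocal is continuous there and keeps a neighbourhood of
    \<open>v1\<close> inside the cone.\<close>
  then obtain v1 where v1: "v1 \<in> \<Gamma>'" "F_transform \<nu> v1 = z1" using dom(2) by (auto simp: voiculescu_domain_def)
  have v1pos: "Im v1 > 0" using v1(1) \<Gamma>' by (auto simp: truncated_cone_def)
  have "z1 \<noteq> 0" using \<eta> by (simp add: z1_def complex_eq_iff)
  then have nz: "cauchy_transform \<nu> v1 \<noteq> 0" using v1(2) by (auto simp: F_transform_def)
  have "isCont (cauchy_transform \<nu>) v1"
    using holomorphic_on_imp_continuous_on[OF hol] v1pos
    by (simp add: continuous_on_eq_continuous_at open_halfspace_Im_gt)
  then have "isCont (F_transform \<nu>) v1"
    unfolding F_transform_def[abs_def] using nz by (intro continuous_intros)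
  then have "\<forall>\<^sub>F v in nhds v1. F_transform \<nu> v \<in> truncated_cone \<eta> M"
    using z1 v1(2) open_cone by (metis continuous_within topological_tendstoD tendsto_at_iff_tendsto_nhds)
  moreover have "\<forall>\<^sub>F v in nhds v1. v \<in> \<Gamma>'"
    using v1(1) open_cone \<Gamma>'(1) by (metis eventually_nhds_in_open)
  ultimately have "\<forall>\<^sub>F v in nhds v1. v \<in> \<Gamma>' \<and> F_transform \<nu> v \<in> truncated_cone \<eta> M" by eventually_elim simp
  then obtain V where V: "open V" "v1 \<in> V" "\<And>v. v \<in> V \<Longrightarrow> v \<in> \<Gamma>' \<and> F_transform \<nu> v \<in> truncated_cone \<eta> M"
    by (auto simp: eventually_nhds)
  show ?thesis
  proof (rule analytic_continuation_open[OF V(1), of ?U "cauchy_transform \<nu>" "\<lambda>z. G (\<omega> z)"])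
    show "open ?U" by (rule open_halfspace_Im_gt)
    show "connected ?U" by (intro convex_connected convex_halfspace_Im_gt)
    show "V \<noteq> {}" using V by blast
    show "V \<subseteq> ?U" using V(3) \<Gamma>' by (force simp: truncated_cone_def)
  qed (use V(3) eq hol holomorphic_G_\<omega> z0 in auto)
qed

lemma free_power_spec:
  shows real_distribution_free_power: "real_distribution (free_power (diag_distribution k \<alpha>) (1 + s))" (is ?A)
    and cauchy_transform_free_power_eq:
      "Im z > 0 \<Longrightarrow> cauchy_transform (free_power (diag_distribution k \<alpha>) (1 + s)) z = G (\<omega> z)"
proof -
  obtain \<nu> where \<nu>: "real_distribution \<nu>" "\<And>z. Im z > 0 \<Longrightarrow> cauchy_transform \<nu> z = G (\<omega> z)"
    using exists_subordinate_measure by blast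
  interpret \<nu>: real_distribution \<nu> by fact
  have "free_power (diag_distribution k \<alpha>) (1 + s) = \<nu>"
    unfolding free_power_def
  proof (rule the_equality)
    show "is_free_power (diag_distribution k \<alpha>) (1 + s) \<nu>" using \<nu> by (rule is_free_powerI)
    fix \<nu>' assume *: "is_free_power (diag_distribution k \<alpha>) (1 + s) \<nu>'"
    show "\<nu>' = \<nu>"
    proof (rule cauchy_transform_inj)
      show "prob_space \<nu>'" "sets \<nu>' = sets borel" using * by (auto simp: is_free_power_def)
      show "prob_space \<nu>" "sets \<nu> = sets borel" using \<nu>.prob_space_axioms \<nu>.events_eq_borel by auto
      show "cauchy_transform \<nu>' z = cauchy_transform \<nu> z" if "Im z > 0" for z
        using cauchy_transform_free_power[OF * that] \<nu>(2)[OF that] by simp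
    qed
  qed
  then show ?A "Im z > 0 \<Longrightarrow> cauchy_transform (free_power (diag_distribution k \<alpha>) (1 + s)) z = G (\<omega> z)"
    using \<nu> by auto
qed

lemma prob_free_power: "prob_space (free_power (diag_distribution k \<alpha>) (1 + s))"
  and sets_free_power: "sets (free_power (diag_distribution k \<alpha>) (1 + s)) = sets borel"
proof -
  interpret \<nu>: real_distribution "free_power (diag_distribution k \<alpha>) (1 + s)"
    by (rule real_distribution_free_power)
  show "prob_space (free_power (diag_distribution k \<alpha>) (1 + s))" by (rule \<nu>.prob_space_axioms)
  show "sets (free_power (diag_distribution k \<alpha>) (1 + s)) = sets borel" by simp
qed

text \<open>
  Both directions compare the nontangential limits of \<open>(z - x) G(z)\<close>, which detect point masses,
  along the curve \<open>z = H w\<close>.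
\<close>

lemma atom_free_power:
  fixes \<gamma> :: real
  defines "q \<equiv> measure (diag_distribution k \<alpha>) {\<gamma>}"
  assumes q: "(1 + s) * q > s"
  shows "measure (free_power (diag_distribution k \<alpha>) (1 + s)) {(1 + s) * \<gamma>} = (1 + s) * q - s"
proof -
  let ?\<mu> = "diag_distribution k \<alpha>" and ?\<nu> = "free_power (diag_distribution k \<alpha>) (1 + s)"
  have q0: "q > 0" using q s_nonneg zero_less_mult_iff[of "1 + s" q] by linarith
  define y where "y n = inverse (real (Suc n))" for n
  have y: "y n > 0" "y \<longlonglongrightarrow> 0" for n
    unfolding y_def[abs_def] by (simp, rule LIMSEQ_inverse_real_of_nat)
  define w where "w n = complex_of_real \<gamma> + \<i> * complex_of_real (y n) * 1" for n
  have wpos: "Im (w n) > 0" for n using y(1) by (simp add: w_def)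
  define r where "r n = (w n - complex_of_real \<gamma>) * G (w n)" for n
  have "(\<lambda>n. (w n - complex_of_real \<gamma>) * cauchy_transform ?\<mu> (w n)) \<longlonglongrightarrow> complex_of_real q"
    unfolding q_def
    by (rule vertical_limit(2)[OF prob_space_diag_distribution sets_diag_distribution y, of "\<lambda>_. 1" 1])
      (auto simp: w_def)
  then have r: "r \<longlonglongrightarrow> complex_of_real q" by (simp add: r_def[abs_def] cauchy_transform_diag wpos)
  define h where "h n = 1 + complex_of_real s - complex_of_real s * (1 / r n)" for n
  \<comment> \<open>The limit of \<open>(H w - (1 + s) \<gamma>) / (w - \<gamma>)\<close>. The
    hypothesis on \<open>q\<close> says exactly that it is positive, so that the curve
    \<open>H (w n)\<close> arrives from above and nontangentially.\<close>
  define c where "c = 1 + s - s * (1 / q)"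
  have c: "c > 0" using q q0 by (simp add: c_def field_simps)
  have h: "h \<longlonglongrightarrow> complex_of_real c"
  proof -
    have "h \<longlonglongrightarrow> 1 + complex_of_real s - complex_of_real s * (1 / complex_of_real q)"
      unfolding h_def[abs_def] using q0 by (intro tendsto_intros r) simp
    then show ?thesis by (simp add: c_def)
  qed
  have Hw: "H (w n) = complex_of_real ((1 + s) * \<gamma>) + \<i> * complex_of_real (y n) * h n" for n
  proof -
    have d: "w n - complex_of_real \<gamma> = \<i> * complex_of_real (y n)" by (simp add: w_def)
    have "complex_of_real (y n) \<noteq> 0" using y(1)[of n] by (simp only: of_real_eq_0_iff)
    then have "F (w n) = \<i> * complex_of_real (y n) * (1 / r n)"
      by (simp add: F_def r_def d)
    then show ?thesis by (simp add: H_def h_def w_def algebra_simps)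
  qed
  note V = vertical_limit[OF prob_free_power sets_free_power y h c Hw]
  have "\<forall>\<^sub>F n in sequentially. (H (w n) - complex_of_real ((1 + s) * \<gamma>)) * cauchy_transform ?\<nu> (H (w n)) = h n * r n"
    using V(1)
  proof eventually_elim
    case (elim n)
    then have "\<omega> (H (w n)) = w n" by (intro \<omega>_H) (simp add: \<Omega>_def wpos)
    then have "cauchy_transform ?\<nu> (H (w n)) = G (w n)"
      using cauchy_transform_free_power_eq[OF elim] by simp
    moreover have "H (w n) - complex_of_real ((1 + s) * \<gamma>) = h n * (w n - complex_of_real \<gamma>)"
      unfolding Hw by (simp add: w_def)
    ultimately show ?case by (simp only: r_def mult.assoc)
  qed
  then have "(\<lambda>n. h n * r n) \<longlonglongrightarrow> complex_of_real (measure ?\<nu> {(1 + s) * \<gamma>})"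
    by (rule Lim_transform_eventually[OF V(2)])
  moreover have "(\<lambda>n. h n * r n) \<longlonglongrightarrow> complex_of_real c * complex_of_real q"
    by (intro tendsto_mult h r)
  ultimately have "complex_of_real (measure ?\<nu> {(1 + s) * \<gamma>}) = complex_of_real (c * q)"
    by (simp add: LIMSEQ_unique)
  then have "measure ?\<nu> {(1 + s) * \<gamma>} = c * q" by (simp only: of_real_eq_iff)
  also have "\<dots> = (1 + s) * q - s" using q0 by (simp add: c_def field_simps)
  finally show ?thesis .
qed

lemma atom_of_free_power_atom:
  fixes x :: real
  defines "c \<equiv> measure (free_power (diag_distribution k \<alpha>) (1 + s)) {x}"
  assumes c: "c > 0"
  shows "measure (diag_distribution k \<alpha>) {x / (1 + s)} = (c + s) / (1 + s)"
proof -
  let ?\<mu> = "diag_distribution k \<alpha>" and ?\<nu> = "free_power (diag_distribution k \<alpha>) (1 + s)"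
  define y where "y n = inverse (real (Suc n))" for n
  have y: "y n > 0" "y \<longlonglongrightarrow> 0" for n
    unfolding y_def[abs_def] by (simp, rule LIMSEQ_inverse_real_of_nat)
  define z where "z n = complex_of_real x + \<i> * complex_of_real (y n) * 1" for n
  have zpos: "Im (z n) > 0" for n using y(1) by (simp add: z_def)
  define r where "r n = (z n - complex_of_real x) * G (\<omega> (z n))" for n
  have "(\<lambda>n. (z n - complex_of_real x) * cauchy_transform ?\<nu> (z n)) \<longlonglongrightarrow> complex_of_real c"
    unfolding c_def
    by (rule vertical_limit(2)[OF prob_free_power sets_free_power y, of "\<lambda>_. 1" 1]) (auto simp: z_def)
  then have r: "r \<longlonglongrightarrow> complex_of_real c"
    by (simp add: r_def[abs_def] cauchy_transform_free_power_eq zpos)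
  have T: "complex_of_real (1 + s) \<noteq> 0" using s_nonneg by (simp only: of_real_eq_0_iff)
  define g where "g n = (1 + complex_of_real s * (1 / r n)) / complex_of_real (1 + s)" for n
  \<comment> \<open>Here the vertical sequence lies on the side of the free power, and
    \<open>b\<close> is the limiting slope of its image under \<open>\<omega>\<close>.\<close>
  define b where "b = (1 + s * (1 / c)) / (1 + s)"
  have b: "b > 0" using c s_nonneg by (simp add: b_def add_pos_nonneg)
  have g: "g \<longlonglongrightarrow> complex_of_real b"
  proof -
    have "g \<longlonglongrightarrow> (1 + complex_of_real s * (1 / complex_of_real c)) / complex_of_real (1 + s)"
      unfolding g_def[abs_def] using c T by (intro tendsto_intros r) auto
    then show ?thesis by (simp add: b_def)
  qed
  have \<omega>z: "\<omega> (z n) = complex_of_real (x / (1 + s)) + \<i> * complex_of_real (y n) * g n" for n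
  proof -
    have d: "z n - complex_of_real x = \<i> * complex_of_real (y n)" by (simp add: z_def)
    have "complex_of_real (y n) \<noteq> 0" using y(1)[of n] by (simp only: of_real_eq_0_iff)
    then have F: "F (\<omega> (z n)) = \<i> * complex_of_real (y n) * (1 / r n)" by (simp add: F_def r_def d)
    have "complex_of_real (1 + s) * \<omega> (z n) = z n + complex_of_real s * F (\<omega> (z n))"
      using H_\<omega>[OF zpos, of n] by (simp add: H_def algebra_simps)
    also have "\<dots> = complex_of_real x + \<i> * complex_of_real (y n) * (1 + complex_of_real s * (1 / r n))"
      unfolding F by (simp add: z_def algebra_simps)
    finally have "complex_of_real (1 + s) * \<omega> (z n) = complex_of_real x + \<i> * complex_of_real (y n) * (1 + complex_of_real s * (1 / r n))" .
    moreover define K where "K = 1 + complex_of_real s * (1 / r n)"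
    ultimately have "\<omega> (z n) = (complex_of_real x + \<i> * complex_of_real (y n) * K) / complex_of_real (1 + s)"
      using T by (metis nonzero_mult_div_cancel_left)
    then show ?thesis
      unfolding g_def K_def[symmetric] by (simp only: of_real_divide times_divide_eq_right add_divide_distrib)
  qed
  note V = vertical_limit(2)[OF prob_space_diag_distribution sets_diag_distribution y g b \<omega>z]
  have "(\<omega> (z n) - complex_of_real (x / (1 + s))) * cauchy_transform ?\<mu> (\<omega> (z n)) = g n * r n" for n
  proof -
    have "\<omega> (z n) - complex_of_real (x / (1 + s)) = g n * (z n - complex_of_real x)"
    proof -
      have "z n - complex_of_real x = \<i> * complex_of_real (y n)" by (simp add: z_def)
      then show ?thesis unfolding \<omega>z by (simp only: add_diff_cancel_left' mult.commute)
    qed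
    then show ?thesis
      by (simp only: cauchy_transform_diag[OF Im_\<omega>_pos[OF zpos]] r_def mult.assoc)
  qed
  then have "(\<lambda>n. g n * r n) \<longlonglongrightarrow> complex_of_real (measure ?\<mu> {x / (1 + s)})" using V by simp
  moreover have "(\<lambda>n. g n * r n) \<longlonglongrightarrow> complex_of_real b * complex_of_real c"
    by (intro tendsto_mult g r)
  ultimately have "complex_of_real (measure ?\<mu> {x / (1 + s)}) = complex_of_real (b * c)"
    by (simp add: LIMSEQ_unique)
  then have "measure ?\<mu> {x / (1 + s)} = b * c" by (simp only: of_real_eq_iff)
  also have "\<dots> = (c + s) / (1 + s)"   proof -
    have "(1 + s * (1 / c)) * c = c + s" using c by (simp add: distrib_right)
    then show ?thesis by (simp only: b_def times_divide_eq_left)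
  qed
  finally show ?thesis .
qed

end

section \<open>Bounded operators as a real normed algebra\<close>

text \<open>
  A copy of the type of bounded operators that carries composition as its ring multiplication.
\<close>

typedef (overloaded) 'h bop = "UNIV :: 'h::chilbert_space op set"
  morphisms blinfun_of Bop ..

setup_lifting type_definition_bop

text \<open>The Hilbert space may be the zero space, where \<open>1 = 0\<close>. The classes
  therefore combine a normed algebra with a multiplicative monoid, without asking for
  \<open>norm 1 = 1\<close>.\<close>

instantiation bop :: (chilbert_space) "{real_normed_algebra, monoid_mult}"
begin

lift_definition zero_bop :: "'a bop" is 0 .
lift_definition one_bop :: "'a bop" is id_blinfun .
lift_definition plus_bop :: "'a bop \<Rightarrow> 'a bop \<Rightarrow> 'a bop" is "(+)" .
lift_definition minus_bop :: "'a bop \<Rightarrow> 'a bop \<Rightarrow> 'a bop" is "(-)" .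
lift_definition uminus_bop :: "'a bop \<Rightarrow> 'a bop" is uminus .
lift_definition times_bop :: "'a bop \<Rightarrow> 'a bop \<Rightarrow> 'a bop" is "(o\<^sub>L)" .
lift_definition scaleR_bop :: "real \<Rightarrow> 'a bop \<Rightarrow> 'a bop" is "(*\<^sub>R)" .
lift_definition norm_bop :: "'a bop \<Rightarrow> real" is norm .

definition sgn_bop :: "'a bop \<Rightarrow> 'a bop" where "sgn_bop T = scaleR (inverse (norm T)) T"
definition dist_bop :: "'a bop \<Rightarrow> 'a bop \<Rightarrow> real" where "dist_bop T U = norm (T - U)"
definition uniformity_bop_def [code del]: "(uniformity :: ('a bop \<times> 'a bop) filter) = (INF e\<in>{0<..}. principal {(x, y). dist x y < e})"
definition open_bop_def [code del]: "open (U :: 'a bop set) \<longleftrightarrow> (\<forall>x\<in>U. \<forall>\<^sub>F (x', y) in uniformity. x' = x \<longrightarrow> y \<in> U)"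

instance
proof
  fix T U V :: "'a bop" and r s :: real
  show "T + U + V = T + (U + V)" by transfer simp
  show "T + U = U + T" by transfer simp
  show "0 + T = T" by transfer simp
  show "- T + T = 0" by transfer simp
  show "T - U = T + - U" by transfer simp
  show "r *\<^sub>R (T + U) = r *\<^sub>R T + r *\<^sub>R U" by transfer (rule scaleR_add_right)
  show "(r + s) *\<^sub>R T = r *\<^sub>R T + s *\<^sub>R T" by transfer (rule scaleR_add_left)
  show "r *\<^sub>R s *\<^sub>R T = (r * s) *\<^sub>R T" by transfer simp
  show "1 *\<^sub>R T = T" by transfer simp
  show "T * U * V = T * (U * V)" by transfer (rule blinfun_eqI, simp)
  show "(T + U) * V = T * V + U * V" by transfer (rule blinfun_eqI, simp add: blinfun.bilinear_simps)
  show "T * (U + V) = T * U + T * V" by transfer (rule blinfun_eqI, simp add: blinfun.bilinear_simps)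
  show "r *\<^sub>R T * U = r *\<^sub>R (T * U)" by transfer (rule blinfun_eqI, simp add: blinfun.bilinear_simps)
  show "T * r *\<^sub>R U = r *\<^sub>R (T * U)" by transfer (rule blinfun_eqI, simp add: blinfun.bilinear_simps)
  show "1 * T = T" by transfer (rule blinfun_eqI, simp)
  show "T * 1 = T" by transfer (rule blinfun_eqI, simp)
  show "sgn T = inverse (norm T) *\<^sub>R T" by (rule sgn_bop_def)
  show "dist T U = norm (T - U)" by (rule dist_bop_def)
  show "(norm T = 0) = (T = 0)" by transfer simp
  show "norm (T + U) \<le> norm T + norm U" by transfer (rule norm_triangle_ineq)
  show "norm (r *\<^sub>R T) = \<bar>r\<bar> * norm T" by transfer simp
  show "norm (T * U) \<le> norm T * norm U" by transfer (rule norm_blinfun_compose)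
  show "(uniformity :: ('a bop \<times> 'a bop) filter) = (INF e\<in>{0<..}. principal {(x, y). dist x y < e})"
    by (rule uniformity_bop_def)
  show "open S \<longleftrightarrow> (\<forall>x\<in>S. \<forall>\<^sub>F (x', y) in uniformity. x' = x \<longrightarrow> y \<in> S)" for S :: "'a bop set"
    by (rule open_bop_def)
qed

end

lemma norm_Bop: "norm (Bop T) = norm T"
  by (simp add: norm_bop.rep_eq Bop_inverse)

instance bop :: (chilbert_space) banach
proof
  fix X :: "nat \<Rightarrow> 'a bop"
  assume "Cauchy X"
  then have "Cauchy (\<lambda>n. blinfun_of (X n))"
    unfolding Cauchy_def dist_norm by (simp add: norm_bop.rep_eq minus_bop.rep_eq)
  then obtain T where "(\<lambda>n. blinfun_of (X n)) \<longlonglongrightarrow> T"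
    using Cauchy_convergent convergent_def by blast
  then have "X \<longlonglongrightarrow> Bop T"
    unfolding LIMSEQ_def dist_norm by (simp add: norm_bop.rep_eq minus_bop.rep_eq Bop_inverse)
  then show "convergent X" by (rule convergentI)
qed

section \<open>Operators on vectors and their quadratic forms\<close>

definition app :: "'h::chilbert_space bop \<Rightarrow> 'h \<Rightarrow> 'h"
  where "app T = blinfun_apply (blinfun_of T)"

lemma app_simps [simp]:
  "app (T + U) x = app T x + app U x" "app (T - U) x = app T x - app U x"
  "app (- T) x = - app T x" "app (r *\<^sub>R T) x = r *\<^sub>R app T x"
  "app (T * U) x = app T (app U x)" "app 1 x = x" "app 0 x = 0"
  by (simp_all add: app_def plus_bop.rep_eq minus_bop.rep_eq uminus_bop.rep_eq scaleR_bop.rep_eq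
      times_bop.rep_eq one_bop.rep_eq zero_bop.rep_eq blinfun.bilinear_simps)

lemma app_linear:
  "app T (x + y) = app T x + app T y" "app T (x - y) = app T x - app T y"
  "app T (r *\<^sub>R x) = r *\<^sub>R app T x" "app T 0 = 0" "app T (- x) = - app T x"
  by (simp_all add: app_def blinfun.bilinear_simps)

lemma bop_eqI: "(\<And>x. app T x = app U x) \<Longrightarrow> T = U"
  by (metis app_def blinfun_eqI blinfun_of_inject)

lemma norm_app: "norm (app T x) \<le> norm T * norm x"
  by (simp add: app_def norm_bop.rep_eq norm_blinfun)

lemma norm_bop_le: "0 \<le> b \<Longrightarrow> (\<And>x. norm (app T x) \<le> b * norm x) \<Longrightarrow> norm T \<le> b"
  by (simp add: app_def norm_bop.rep_eq norm_blinfun_bound)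

text \<open>\<open>bop\<close> consists of real-linear maps, so forms and adjoints are taken with
  respect to the underlying real Hilbert space.\<close>

definition ip :: "'h::chilbert_space \<Rightarrow> 'h \<Rightarrow> real"
  where "ip x y = Re (cinner x y)"

lemma ip_commute: "ip x y = ip y x"
  by (metis ip_def cinner_commute cnj.sel(1))

lemma ip_add_right: "ip x (y + z) = ip x y + ip x z"
  by (simp add: ip_def cinner_add_right)

lemma ip_add_left: "ip (x + y) z = ip x z + ip y z"
  by (metis ip_commute ip_add_right)

lemma ip_scaleR_right: "ip x (r *\<^sub>R y) = r * ip x y"
  unfolding ip_def scaleC_of_real[symmetric] cinner_scaleC_right by simp

lemma ip_scaleR_left: "ip (r *\<^sub>R x) y = r * ip x y"
  by (metis ip_commute ip_scaleR_right)

lemma ip_minus_right: "ip x (- y) = - ip x y"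
  using ip_scaleR_right[of x "-1" y] by simp

lemma ip_minus_left: "ip (- x) y = - ip x y"
  using ip_scaleR_left[of "-1" x y] by simp

lemma ip_diff_right: "ip x (y - z) = ip x y - ip x z"
  using ip_add_right[of x y "- z"] by (simp add: ip_minus_right)

lemma ip_diff_left: "ip (x - y) z = ip x z - ip y z"
  using ip_add_left[of x "- y" z] by (simp add: ip_minus_left)

lemmas ip_linear = ip_add_right ip_add_left ip_scaleR_right ip_scaleR_left ip_minus_right
  ip_minus_left ip_diff_right ip_diff_left

lemma ip_self: "ip x x = (norm x)\<^sup>2"
  by (simp add: ip_def cinner_self)

text \<open>
  The adjoint with respect to the real inner product; on complex linear operators it agrees with
  \<^const>\<open>is_adjoint\<close>.
\<close>

definition adj :: "'h::chilbert_space bop \<Rightarrow> 'h bop \<Rightarrow> bool"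
  where "adj T S \<longleftrightarrow> (\<forall>x y. ip (app T x) y = ip x (app S y))"

definition psd :: "'h::chilbert_space bop \<Rightarrow> bool"
  where "psd T \<longleftrightarrow> adj T T \<and> (\<forall>x. 0 \<le> ip x (app T x))"

lemma adj_sym: "adj T S \<Longrightarrow> adj S T"
  unfolding adj_def by (metis ip_commute)

lemma adj_add: "adj T S \<Longrightarrow> adj T' S' \<Longrightarrow> adj (T + T') (S + S')"
  by (simp add: adj_def ip_linear)

lemma adj_diff: "adj T S \<Longrightarrow> adj T' S' \<Longrightarrow> adj (T - T') (S - S')"
  by (simp add: adj_def ip_linear)

lemma adj_scaleR: "adj T S \<Longrightarrow> adj (r *\<^sub>R T) (r *\<^sub>R S)"
  by (simp add: adj_def ip_linear)

lemma adj_mult: "adj T S \<Longrightarrow> adj T' S' \<Longrightarrow> adj (T * T') (S' * S)"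
  by (simp add: adj_def)

lemma adj_one: "adj 1 1" and adj_zero: "adj 0 0"
  by (simp_all add: adj_def) (metis ip_scaleR_left ip_scaleR_right mult_zero_left scaleR_zero_left)

lemma adj_power: "adj T S \<Longrightarrow> adj (T ^ n) (S ^ n)"
  using adj_mult[of T S "T ^ n" "S ^ n" for n] by (induction n) (simp_all add: adj_one power_commutes)

lemma adj_commute_mult: "adj T T \<Longrightarrow> adj U U \<Longrightarrow> T * U = U * T \<Longrightarrow> adj (T * U) (T * U)"
  using adj_mult[of T T U U] by simp

lemma adj_sum: "(\<And>i. i \<in> I \<Longrightarrow> adj (T i) (S i)) \<Longrightarrow> adj (sum T I) (sum S I)"
  by (induction I rule: infinite_finite_induct) (auto simp: adj_zero intro: adj_add)

lemma discriminant_le_of_nonneg: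
  fixes a b c :: real
  assumes q: "\<And>r. 0 \<le> c + 2 * r * b + r\<^sup>2 * a" and a: "0 \<le> a"
  shows "b\<^sup>2 \<le> c * a"
proof (cases "a = 0")
  case True
  have "b = 0"
  proof (rule ccontr)
    assume b: "b \<noteq> 0"
    \<comment> \<open>If \<open>a = 0\<close> the quadratic is linear in \<open>r\<close>; this
      \<open>r\<close> gives it the value -1.\<close>
    show False using q[of "- (c + 1) / (2 * b)"] True b by (simp add: field_simps)
  qed
  then show ?thesis using True by simp
next
  case False
  with a have a: "a > 0" by simp
  have "0 \<le> c - b\<^sup>2 / a"
    using q[of "- b / a"] a by (simp add: power2_eq_square field_simps)
  then show ?thesis using a by (simp add: field_simps)
qed

lemma psd_cauchy_schwarz:
  assumes "psd T"
  shows "(ip x (app T y))\<^sup>2 \<le> ip x (app T x) * ip y (app T y)"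
proof (rule discriminant_le_of_nonneg)
  have sym: "ip y (app T x) = ip x (app T y)"
    using assms unfolding psd_def adj_def by (metis ip_commute)
  fix r
  have "0 \<le> ip (x + r *\<^sub>R y) (app T (x + r *\<^sub>R y))" using assms by (simp add: psd_def)
  also have "\<dots> = ip x (app T x) + 2 * r * ip x (app T y) + r\<^sup>2 * ip y (app T y)"
    by (simp add: app_linear ip_linear sym power2_eq_square algebra_simps)
  finally show "0 \<le> ip x (app T x) + 2 * r * ip x (app T y) + r\<^sup>2 * ip y (app T y)" .
qed (use assms in \<open>simp add: psd_def\<close>)

lemma psd_one: "psd 1"
  by (simp add: psd_def adj_one ip_self)

lemma ip_cauchy_schwarz: "\<bar>ip x y\<bar> \<le> norm x * norm y"
proof -
  have "(ip x y)\<^sup>2 \<le> (norm x * norm y)\<^sup>2"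
    using psd_cauchy_schwarz[OF psd_one, of x y] by (simp add: ip_self power_mult_distrib)
  then show ?thesis by (simp add: abs_le_square_iff[symmetric])
qed

lemma ip_app_le: "\<bar>ip x (app T x)\<bar> \<le> norm T * (norm x)\<^sup>2"
proof -
  have "\<bar>ip x (app T x)\<bar> \<le> norm x * norm (app T x)" by (rule ip_cauchy_schwarz)
  also have "\<dots> \<le> norm x * (norm T * norm x)" by (intro mult_left_mono norm_app) simp
  finally show ?thesis by (simp add: power2_eq_square algebra_simps)
qed

text \<open>Polarisation and the parallelogram law. The vector \<open>x\<close> is
  \<open>T y\<close> rescaled to the norm of \<open>y\<close>, so that the two squared norms add up
  to \<open>4 * (norm y)^2\<close>.\<close>

lemma norm_le_of_quadratic:
  assumes T: "adj T T" and c: "0 \<le> c" "\<And>x. \<bar>ip x (app T x)\<bar> \<le> c * (norm x)\<^sup>2"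
  shows "norm T \<le> c"
proof (rule norm_bop_le[OF c(1)])
  fix y
  show "norm (app T y) \<le> c * norm y"
  proof (cases "app T y = 0 \<or> y = 0")
    case True
    then show ?thesis using c(1) by (auto simp: app_linear)
  next
    case False
    define x where "x = (norm y / norm (app T y)) *\<^sub>R app T y"
    have nx: "norm x = norm y" using False by (simp add: x_def)
    have xT: "ip x (app T y) = norm y * norm (app T y)"
      using False by (simp add: x_def ip_linear ip_self power2_eq_square)
    have sym: "ip y (app T x) = ip x (app T y)" using T unfolding adj_def by (metis ip_commute)
    have "4 * ip x (app T y) = ip (x + y) (app T (x + y)) - ip (x - y) (app T (x - y))"
      by (simp add: app_linear ip_linear sym)
    also have "\<dots> \<le> c * (norm (x + y))\<^sup>2 + c * (norm (x - y))\<^sup>2"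
      using c(2)[of "x + y"] c(2)[of "x - y"] by linarith
    also have "\<dots> = c * (4 * (norm y)\<^sup>2)"
    proof -
      have "ip x x = ip y y" by (simp add: ip_self nx)
      then show ?thesis unfolding ip_self[symmetric] by (simp add: ip_linear algebra_simps)
    qed
    finally have "norm y * norm (app T y) \<le> norm y * (c * norm y)"
      unfolding xT by (simp add: power2_eq_square algebra_simps)
    then show ?thesis using False by simp
  qed
qed

lemma tendsto_app:
  assumes "X \<longlonglongrightarrow> T"
  shows "(\<lambda>n. app (X n) x) \<longlonglongrightarrow> app T x"
proof (rule LIM_zero_cancel, rule Lim_null_comparison)
  show "\<forall>\<^sub>F n in sequentially. norm (app (X n) x - app T x) \<le> norm (X n - T) * norm x"
    using norm_app[of "X n - T" x for n] by simp
  show "(\<lambda>n. norm (X n - T) * norm x) \<longlonglongrightarrow> 0"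
    using assms by (intro tendsto_mult_left_zero tendsto_norm_zero LIM_zero)
qed

lemma tendsto_ip:
  assumes "f \<longlonglongrightarrow> y"
  shows "(\<lambda>n. ip x (f n)) \<longlonglongrightarrow> ip x y"
proof (rule LIM_zero_cancel, rule Lim_null_comparison)
  show "\<forall>\<^sub>F n in sequentially. norm (ip x (f n) - ip x y) \<le> norm x * norm (f n - y)"
    using ip_cauchy_schwarz[of x "f n - y" for n] by (simp add: ip_linear)
  show "(\<lambda>n. norm x * norm (f n - y)) \<longlonglongrightarrow> 0"
    using assms by (intro tendsto_mult_right_zero tendsto_norm_zero LIM_zero)
qed

lemma adj_limit:
  assumes "X \<longlonglongrightarrow> T" "\<And>n. adj (X n) (X n)"
  shows "adj T T"
  unfolding adj_def
proof (intro allI)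
  fix x y
  have "(\<lambda>n. ip x (app (X n) y)) \<longlonglongrightarrow> ip x (app T y)" "(\<lambda>n. ip y (app (X n) x)) \<longlonglongrightarrow> ip y (app T x)"
    by (intro tendsto_ip tendsto_app assms)+
  moreover have "ip x (app (X n) y) = ip y (app (X n) x)" for n
    using assms(2)[of n] unfolding adj_def by (metis ip_commute)
  ultimately have "ip x (app T y) = ip y (app T x)" using LIMSEQ_unique by auto
  then show "ip (app T x) y = ip x (app T y)" by (metis ip_commute)
qed

lemma psd_scaleR: "psd T \<Longrightarrow> 0 \<le> r \<Longrightarrow> psd (r *\<^sub>R T)"
  by (auto simp: psd_def ip_linear intro: adj_scaleR)

lemma psd_square: "adj S S \<Longrightarrow> psd (S * S)"
  unfolding psd_def by (metis adj_commute_mult adj_def app_simps(5) ip_self zero_le_power2)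

text \<open>Equality would fail on the zero space.\<close>

lemma norm_one_bop: "norm (1::'h::chilbert_space bop) \<le> 1"
  by (rule norm_bop_le) auto

lemma norm_le_one_of_psd:
  assumes "psd T" "psd (1 - T)"
  shows "norm T \<le> 1"
proof (rule norm_le_of_quadratic)
  show "adj T T" using assms by (simp add: psd_def)
  fix x
  have "0 \<le> ip x (app T x)" "0 \<le> ip x (app (1 - T) x)" using assms by (auto simp: psd_def)
  then show "\<bar>ip x (app T x)\<bar> \<le> 1 * (norm x)\<^sup>2" by (simp add: ip_linear ip_self)
qed simp

lemma psd_norm_minus:
  assumes "adj T T" "norm T \<le> c"
  shows "psd (c *\<^sub>R 1 - T)"
  unfolding psd_def
proof (intro conjI allI)
  show "adj (c *\<^sub>R 1 - T) (c *\<^sub>R 1 - T)" using assms by (intro adj_diff adj_scaleR adj_one)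
  fix x
  have "ip x (app T x) \<le> norm T * (norm x)\<^sup>2" using ip_app_le[of x T] by simp
  also have "\<dots> \<le> c * (norm x)\<^sup>2" using assms(2) by (rule mult_right_mono) simp
  finally show "0 \<le> ip x (app (c *\<^sub>R 1 - T) x)" by (simp add: ip_linear ip_self)
qed

section \<open>Square roots and inverses of positive operators\<close>

lemma commute_mult:
  fixes U :: "'a::semigroup_mult"
  assumes "U * S = S * U" "U * T = T * U"
  shows "U * (S * T) = (S * T) * U"
  by (metis assms mult.assoc)

lemma commute_power:
  fixes U :: "'a::monoid_mult"
  shows "U * T = T * U \<Longrightarrow> U * T ^ n = T ^ n * U"
  by (induction n) (auto simp only: power_0 mult_1 mult_1_right power_Suc intro: commute_mult)

lemma tendsto_commute:
  fixes X :: "nat \<Rightarrow> 'a::real_normed_algebra"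
  assumes "X \<longlonglongrightarrow> T" "\<And>n. U * X n = X n * U"
  shows "U * T = T * U"
proof (rule LIMSEQ_unique)
  show "(\<lambda>n. U * X n) \<longlonglongrightarrow> U * T" by (intro tendsto_mult tendsto_const assms)
  show "(\<lambda>n. U * X n) \<longlonglongrightarrow> T * U" unfolding assms(2) by (intro tendsto_mult tendsto_const assms)
qed

text \<open>
  The iteration \<open>A \<mapsto> (x + A\<^sup>2) / 2\<close> converges to \<open>1 - sqrt (1 - x)\<close>; it is dominated by the same
  iteration for the number \<open>x = 1\<close>.
\<close>

primrec sqrt_iter :: "'a::{real_normed_algebra, monoid_mult} \<Rightarrow> nat \<Rightarrow> 'a"
  where "sqrt_iter x 0 = 0"
  | "sqrt_iter x (Suc n) = (1/2) *\<^sub>R (x + sqrt_iter x n * sqrt_iter x n)"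

lemma sqrt_iter_bounds: "0 \<le> sqrt_iter (1::real) n" "sqrt_iter (1::real) n \<le> 1"
proof (induction n)
  case (Suc n)
  { case 1 show ?case using Suc by simp }
  { case 2
    have "sqrt_iter (1::real) n * sqrt_iter 1 n \<le> 1 * 1" using Suc by (intro mult_mono) auto
    then show ?case by simp }
qed simp_all

lemma sqrt_iter_commute: "U * x = x * U \<Longrightarrow> U * sqrt_iter x n = sqrt_iter x n * U"
proof (induction n)
  case (Suc n)
  then have "U * sqrt_iter x n = sqrt_iter x n * U" by simp
  then have "U * (sqrt_iter x n * sqrt_iter x n) = sqrt_iter x n * sqrt_iter x n * U"
    by (metis mult.assoc)
  then show ?case using Suc.prems by (simp add: distrib_left distrib_right)
qed simp

text \<open>All iterates commute, so a difference of squares factors into sum times difference; both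
  factors are dominated by their scalar counterparts by induction. The scalar sequence is monotone
  and bounded, which makes the operator sequence Cauchy.\<close>

lemma sqrt_iter_diff:
  fixes x :: "'a::{real_normed_algebra, monoid_mult}"
  assumes x: "norm x \<le> 1"
  shows "norm (sqrt_iter x n) \<le> sqrt_iter 1 n
    \<and> norm (sqrt_iter x (Suc n) - sqrt_iter x n) \<le> sqrt_iter 1 (Suc n) - sqrt_iter 1 n"
proof (induction n)
  case 0
  then show ?case using x by simp
next
  case (Suc n)
  let ?A = "sqrt_iter x" and ?a = "sqrt_iter (1::real)"
  have n1: "norm (?A (Suc n)) \<le> ?a (Suc n)"
  proof -
    have "norm (?A (Suc n)) \<le> norm (?A n) + norm (?A (Suc n) - ?A n)"
      using norm_triangle_ineq[of "?A n" "?A (Suc n) - ?A n"] by simp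
    then show ?thesis using Suc by linarith
  qed
  have comm: "?A n * ?A (Suc n) = ?A (Suc n) * ?A n"
    by (intro sqrt_iter_commute sqrt_iter_commute[symmetric]) simp
  have d: "?A (Suc (Suc n)) - ?A (Suc n) = (1/2) *\<^sub>R ((?A (Suc n) + ?A n) * (?A (Suc n) - ?A n))"
  proof -
    have "(?A (Suc n) + ?A n) * (?A (Suc n) - ?A n) = ?A (Suc n) * ?A (Suc n) - ?A n * ?A n"
      using comm by (simp only: distrib_right right_diff_distrib) (simp add: algebra_simps)
    then show ?thesis by (simp add: scaleR_diff_right[symmetric] del: scaleR_diff_right)
  qed
  have "norm (?A (Suc (Suc n)) - ?A (Suc n)) \<le> (1/2) * (norm (?A (Suc n) + ?A n) * norm (?A (Suc n) - ?A n))"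
    unfolding d using norm_mult_ineq by (simp del: sqrt_iter.simps)
  also have "\<dots> \<le> (1/2) * ((?a (Suc n) + ?a n) * (?a (Suc n) - ?a n))"
    using Suc n1 norm_triangle_ineq[of "?A (Suc n)" "?A n"] sqrt_iter_bounds
    by (intro mult_left_mono mult_mono) (auto simp del: sqrt_iter.simps)
  also have "\<dots> = ?a (Suc (Suc n)) - ?a (Suc n)"
    by (simp add: algebra_simps)
  finally show ?case using n1 by blast
qed

lemma sqrt_iter_convergent:
  fixes x :: "'a::{real_normed_algebra, monoid_mult, banach}"
  assumes x: "norm x \<le> 1"
  shows "\<exists>A. sqrt_iter x \<longlonglongrightarrow> A \<and> norm A \<le> 1"
proof -
  let ?A = "sqrt_iter x" and ?a = "sqrt_iter (1::real)"
  have mono: "?a n \<le> ?a (Suc n)" for n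
    using sqrt_iter_diff[of "1::real" n] norm_ge_zero[of "?a (Suc n) - ?a n"] by simp
  then have "incseq ?a" by (rule incseq_SucI)
  then have "convergent ?a" using sqrt_iter_bounds by (auto intro: incseq_convergent simp: convergent_def)
  then have C: "Cauchy ?a" by (rule convergent_Cauchy)
  have step: "norm (?A (n + m) - ?A n) \<le> ?a (n + m) - ?a n" for n m
  proof (induction m)
    case (Suc m)
    have "norm (?A (n + Suc m) - ?A n) \<le> norm (?A (Suc (n + m)) - ?A (n + m)) + norm (?A (n + m) - ?A n)"
      using norm_triangle_ineq[of "?A (Suc (n + m)) - ?A (n + m)" "?A (n + m) - ?A n"]
      by (simp del: sqrt_iter.simps)
    then show ?case using Suc sqrt_iter_diff[OF x, of "n + m"] by (simp del: sqrt_iter.simps)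
  qed simp
  have "Cauchy ?A"
  proof (rule CauchyI)
    fix e :: real assume "0 < e"
    with C obtain M where M: "\<And>m n. m \<ge> M \<Longrightarrow> n \<ge> M \<Longrightarrow> norm (?a m - ?a n) < e"
      by (metis CauchyD)
    have "norm (?A m - ?A n) < e" if "M \<le> m" "M \<le> n" for m n
    proof (cases "m \<le> n")
      case True
      then show ?thesis using step[of m "n - m"] M[of n m] that by (simp add: norm_minus_commute)
    next
      case False
      then show ?thesis using step[of n "m - n"] M[of m n] that by simp
    qed
    then show "\<exists>M. \<forall>m\<ge>M. \<forall>n\<ge>M. norm (?A m - ?A n) < e" by blast
  qed
  then obtain A where A: "?A \<longlonglongrightarrow> A" by (auto simp: Cauchy_convergent_iff convergent_def)
  have "norm A \<le> 1"
  proof (rule Lim_norm_ubound[OF _ A])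
    show "\<forall>\<^sub>F n in sequentially. norm (?A n) \<le> 1"
      using sqrt_iter_diff[OF x] sqrt_iter_bounds(2) by (intro always_eventually allI) (metis order.trans)
  qed simp
  then show ?thesis using A by blast
qed

text \<open>With \<open>x = 1 - P / K\<close> of norm at most 1 the limit \<open>A\<close> satisfies
  \<open>2 A = x + A^2\<close>, that is \<open>(1 - A)^2 = P / K\<close>. The commutation clause is
  recorded because it later places the root in the algebra.\<close>

lemma exists_psd_sqrt:
  fixes P :: "'h::chilbert_space bop"
  assumes P: "psd P"
  shows "\<exists>S. psd S \<and> S * S = P \<and> (\<forall>U. U * P = P * U \<longrightarrow> U * S = S * U)"
proof -
  define K where "K = norm P + 1"
  have K: "K > 0" "norm P \<le> K" by (auto simp: K_def add_nonneg_pos)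
  define x where "x = 1 - (1 / K) *\<^sub>R P"
  have Px: "psd ((1 / K) *\<^sub>R P)" using P K by (intro psd_scaleR) auto
  have "psd ((1 / K) *\<^sub>R (K *\<^sub>R 1 - P))"
    using P K by (intro psd_scaleR psd_norm_minus) (auto simp: psd_def)
  then have psdx: "psd x" using K by (simp add: x_def scaleR_diff_right)
  have "norm x \<le> 1" using psdx Px by (intro norm_le_one_of_psd) (auto simp: x_def)
  then obtain A where A: "sqrt_iter x \<longlonglongrightarrow> A" "norm A \<le> 1" using sqrt_iter_convergent by blast
  have eq: "A = (1/2) *\<^sub>R (x + A * A)"
  proof (rule LIMSEQ_unique)
    show "(\<lambda>n. sqrt_iter x (Suc n)) \<longlonglongrightarrow> A" using A(1) by (rule LIMSEQ_Suc)
    show "(\<lambda>n. sqrt_iter x (Suc n)) \<longlonglongrightarrow> (1/2) *\<^sub>R (x + A * A)"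
      unfolding sqrt_iter.simps by (intro tendsto_intros A)
  qed
  have "adj (sqrt_iter x n) (sqrt_iter x n)" for n
    using psdx by (induction n) (auto simp: psd_def adj_zero intro: adj_scaleR adj_add adj_mult)
  then have adjA: "adj A A" by (rule adj_limit[OF A(1)])
  have commA: "U * A = A * U" if "U * P = P * U" for U
  proof (rule tendsto_commute[OF A(1)])
    have "U * x = x * U" using that by (simp add: x_def right_diff_distrib left_diff_distrib)
    then show "U * sqrt_iter x n = sqrt_iter x n * U" for n by (rule sqrt_iter_commute)
  qed
  define S where "S = sqrt K *\<^sub>R (1 - A)"
  have "psd (1 - A)" using psd_norm_minus[OF adjA A(2)] by simp
  then have "psd S" unfolding S_def by (intro psd_scaleR) (use K in simp_all)
  moreover have "S * S = P"
  proof -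
    have "2 *\<^sub>R A = x + A * A" by (subst eq) simp
    then have "(1 - A) * (1 - A) = 1 - x"
      by (simp add: algebra_simps scaleR_2)
    then have "S * S = K *\<^sub>R (1 - x)" using K by (simp add: S_def)
    then show ?thesis using K by (simp add: x_def)
  qed
  moreover have "U * S = S * U" if "U * P = P * U" for U
    using commA[OF that] by (simp add: S_def right_diff_distrib left_diff_distrib)
  ultimately show ?thesis by blast
qed

text \<open>The lower bound \<open>d\<close> makes \<open>B = 1 - C / K\<close> a contraction, and
  the fixed point of \<open>N \<mapsto> 1 + B N\<close> is \<open>K\<close> times the inverse of
  \<open>C\<close>. The extra \<open>d\<close> in \<open>K\<close> keeps the contraction constant
  nonnegative.\<close>

lemma exists_psd_inverse:
  fixes C :: "'h::chilbert_space bop"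
  assumes C: "adj C C" and d: "0 < d" "\<And>x. d * (norm x)\<^sup>2 \<le> ip x (app C x)"
  shows "\<exists>N. psd N \<and> N * C = 1 \<and> C * N = 1 \<and> (\<forall>U. U * C = C * U \<longrightarrow> U * N = N * U)"
proof -
  define K where "K = norm C + d"
  have K: "K > 0" "norm C \<le> K" using d by (auto simp: K_def add_nonneg_pos)
  define B where "B = 1 - (1 / K) *\<^sub>R C"
  have B: "norm B \<le> 1 - d / K"
  proof (rule norm_le_of_quadratic)
    show "adj B B" using C by (auto simp: B_def intro: adj_diff adj_one adj_scaleR)
    show "0 \<le> 1 - d / K" using K d by (simp add: K_def)
    fix x
    have "ip x (app C x) \<le> K * (norm x)\<^sup>2"
      using ip_app_le[of x C] mult_right_mono[OF K(2), of "(norm x)\<^sup>2"] by simp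
    then have "0 \<le> (norm x)\<^sup>2 - ip x (app C x) / K" using K by (simp add: field_simps)
    moreover have "ip x (app C x) / K \<ge> d * (norm x)\<^sup>2 / K" using d(2) K by (intro divide_right_mono) auto
    ultimately show "\<bar>ip x (app B x)\<bar> \<le> (1 - d / K) * (norm x)\<^sup>2"
      by (simp add: B_def ip_linear ip_self algebra_simps)
  qed
  have q: "0 \<le> 1 - d / K" "1 - d / K < 1" using K d by (auto simp: K_def)
  have "dist (1 + B * N) (1 + B * N') \<le> (1 - d / K) * dist N N'" for N N'
  proof -
    have "dist (1 + B * N) (1 + B * N') = norm (B * (N - N'))"
      by (simp add: dist_norm right_diff_distrib)
    also have "\<dots> \<le> norm B * norm (N - N')" by (rule norm_mult_ineq)
    also have "\<dots> \<le> (1 - d / K) * norm (N - N')" using B by (rule mult_right_mono) simp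
    finally show ?thesis by (simp add: dist_norm)
  qed
  then have "\<exists>!N. 1 + B * N = N" by (intro banach_fix_type[OF q]) blast
  then obtain N0 where N0: "1 + B * N0 = N0" by blast
  then have CN0: "C * ((1 / K) *\<^sub>R N0) = 1"
    by (simp add: B_def left_diff_distrib algebra_simps)
  define N where "N = (1 / K) *\<^sub>R N0"
  have CN: "C * N = 1" using CN0 by (simp add: N_def)
  have inj: "x = 0" if "app C x = 0" for x
    using d(2)[of x] that d(1) ip_scaleR_right[of x 0 0] by (simp add: mult_le_0_iff)
  have NC: "N * C = 1"
  proof (rule bop_eqI)
    fix x
    have "app C (app (N * C) x - x) = app (C * N) (app C x) - app C x" by (simp add: app_linear)
    then have "app C (app (N * C) x - x) = 0" by (simp only: CN) simp
    then show "app (N * C) x = app 1 x" using inj by fastforce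
  qed
  have adjN: "adj N N"
    unfolding adj_def
  proof (intro allI)
    fix x y
    have "ip (app N x) y = ip (app N x) (app (C * N) y)" by (simp only: CN) simp
    also have "\<dots> = ip (app (C * N) x) (app N y)" using C by (simp add: adj_def)
    finally show "ip (app N x) y = ip x (app N y)" by (simp only: CN) simp
  qed
  have "0 \<le> ip x (app N x)" for x
  proof -
    have "0 \<le> d * (norm (app N x))\<^sup>2" using d by simp
    also have "\<dots> \<le> ip (app N x) (app (C * N) x)" using d(2)[of "app N x"] by simp
    finally show ?thesis by (simp only: CN) (simp add: ip_commute)
  qed
  then have "psd N" using adjN by (simp add: psd_def)
  moreover have "U * N = N * U" if "U * C = C * U" for U
    by (metis CN NC mult.assoc mult.left_neutral mult.right_neutral that)
  ultimately show ?thesis using CN NC by blast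
qed

text \<open>The root \<open>s\<close> of \<open>S\<close> commutes with \<open>T\<close> as well, so
  \<open>S T = s T s\<close>.\<close>

lemma psd_mult_commute:
  assumes "psd S" "psd T" "S * T = T * S"
  shows "psd (S * T)"
proof -
  obtain s where s: "psd s" "s * s = S" "\<And>U. U * S = S * U \<Longrightarrow> U * s = s * U"
    using exists_psd_sqrt[OF assms(1)] by blast
  have sT: "T * s = s * T" using s(3)[of T] assms(3) by simp
  then have ST: "S * T = s * T * s" using s(2) by (metis mult.assoc)
  have adj: "adj s s" "adj T T" using s(1) assms(2) by (simp_all add: psd_def)
  then have "adj (S * T) (S * T)"
    unfolding ST using adj_mult[OF adj_mult[of s s T T], of s s] by (simp add: mult.assoc)
  moreover have "0 \<le> ip x (app (S * T) x)" for x
  proof -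
    have "ip x (app (S * T) x) = ip (app s x) (app T (app s x))"
      unfolding ST using adj(1) by (simp add: adj_def)
    then show ?thesis using assms(2) by (simp add: psd_def)
  qed
  ultimately show ?thesis by (simp add: psd_def)
qed

section \<open>Tracial algebras of operators\<close>

text \<open>A von Neumann algebra seen over the reals, with the real part of its trace.
  \<open>commutant_closed\<close> is the bicommutant property for a single element, tested against
  all real-linear operators; it is how roots and inverses are shown to lie in the algebra.\<close>

locale tracial_algebra =
  fixes \<A> :: "'h::chilbert_space bop set" and \<phi> :: "'h bop \<Rightarrow> real"
  assumes add_closed: "T \<in> \<A> \<Longrightarrow> U \<in> \<A> \<Longrightarrow> T + U \<in> \<A>"
    and mult_closed: "T \<in> \<A> \<Longrightarrow> U \<in> \<A> \<Longrightarrow> T * U \<in> \<A>"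
    and scaleR_closed: "T \<in> \<A> \<Longrightarrow> r *\<^sub>R T \<in> \<A>"
    and one_closed: "1 \<in> \<A>"
    and commutant_closed: "T \<in> \<A> \<Longrightarrow> (\<And>U. U * T = T * U \<Longrightarrow> U * V = V * U) \<Longrightarrow> V \<in> \<A>"
    and \<phi>_add: "T \<in> \<A> \<Longrightarrow> U \<in> \<A> \<Longrightarrow> \<phi> (T + U) = \<phi> T + \<phi> U"
    and \<phi>_scaleR: "T \<in> \<A> \<Longrightarrow> \<phi> (r *\<^sub>R T) = r * \<phi> T"
    and \<phi>_one: "\<phi> 1 = 1"
    and \<phi>_commute: "T \<in> \<A> \<Longrightarrow> U \<in> \<A> \<Longrightarrow> \<phi> (T * U) = \<phi> (U * T)"
    and \<phi>_adj: "T \<in> \<A> \<Longrightarrow> S \<in> \<A> \<Longrightarrow> adj T S \<Longrightarrow> \<phi> S = \<phi> T"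
    and \<phi>_pos: "T \<in> \<A> \<Longrightarrow> S \<in> \<A> \<Longrightarrow> adj T S \<Longrightarrow> 0 \<le> \<phi> (S * T)"
    and \<phi>_faithful: "T \<in> \<A> \<Longrightarrow> adj T T \<Longrightarrow> \<phi> (T * T) = 0 \<Longrightarrow> T = 0"
begin

lemma diff_closed: "T \<in> \<A> \<Longrightarrow> U \<in> \<A> \<Longrightarrow> T - U \<in> \<A>"
  using add_closed[of T "-1 *\<^sub>R U"] scaleR_closed[of U "-1"] by simp

lemma \<phi>_diff: "T \<in> \<A> \<Longrightarrow> U \<in> \<A> \<Longrightarrow> \<phi> (T - U) = \<phi> T - \<phi> U"
  using \<phi>_add[of T "-1 *\<^sub>R U"] \<phi>_scaleR[of U "-1"] scaleR_closed[of U "-1"] by simp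

lemma zero_closed: "0 \<in> \<A>"
  using scaleR_closed[OF one_closed, of 0] by simp

lemma \<phi>_zero: "\<phi> 0 = 0"
  using \<phi>_scaleR[OF one_closed, of 0] by simp

lemma power_closed: "T \<in> \<A> \<Longrightarrow> T ^ n \<in> \<A>"
  by (induction n) (auto intro: one_closed mult_closed)

lemma sum_closed: "(\<And>i. i \<in> I \<Longrightarrow> T i \<in> \<A>) \<Longrightarrow> sum T I \<in> \<A>"
  by (induction I rule: infinite_finite_induct) (auto intro: add_closed zero_closed)

lemma \<phi>_sum: "(\<And>i. i \<in> I \<Longrightarrow> T i \<in> \<A>) \<Longrightarrow> \<phi> (sum T I) = (\<Sum>i\<in>I. \<phi> (T i))"
  by (induction I rule: infinite_finite_induct) (auto simp: \<phi>_zero \<phi>_add sum_closed)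

lemma sqrt_in:
  assumes "psd P" "P \<in> \<A>"
  obtains S where "S \<in> \<A>" "psd S" "S * S = P" "\<And>U. U * P = P * U \<Longrightarrow> U * S = S * U"
proof -
  obtain S where S: "psd S" "S * S = P" "\<And>U. U * P = P * U \<Longrightarrow> U * S = S * U"
    using exists_psd_sqrt[OF assms(1)] by blast
  moreover have "S \<in> \<A>" using assms(2) S(3) by (rule commutant_closed)
  ultimately show ?thesis using that by blast
qed

lemma \<phi>_psd:
  assumes "psd P" "P \<in> \<A>"
  shows "0 \<le> \<phi> P"
proof -
  obtain S where S: "S \<in> \<A>" "psd S" "S * S = P" using sqrt_in[OF assms] by metis
  then show ?thesis using \<phi>_pos[of S S] by (simp add: psd_def)
qed

lemma \<phi>_le_norm:
  assumes "T \<in> \<A>" "adj T T"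
  shows "\<bar>\<phi> T\<bar> \<le> norm T"
proof -
  have "0 \<le> \<phi> (norm T *\<^sub>R 1 - T)"
    using assms by (intro \<phi>_psd psd_norm_minus diff_closed scaleR_closed one_closed) auto
  moreover have "0 \<le> \<phi> (norm T *\<^sub>R 1 - (-1) *\<^sub>R T)"
    using assms by (intro \<phi>_psd psd_norm_minus diff_closed scaleR_closed one_closed adj_scaleR) auto
  ultimately show ?thesis
    using assms by (simp add: \<phi>_diff \<phi>_scaleR \<phi>_add \<phi>_one scaleR_closed one_closed)
qed

lemma \<phi>_cauchy_schwarz:
  assumes "X \<in> \<A>" "X' \<in> \<A>" "adj X X'" "W \<in> \<A>" "W' \<in> \<A>" "adj W W'"
  shows "(\<phi> (X * W))\<^sup>2 \<le> \<phi> (X * X') * \<phi> (W' * W)"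
proof (rule discriminant_le_of_nonneg)
  note closed = add_closed mult_closed scaleR_closed assms(1,2,4,5)
  have eq: "\<phi> (W' * X') = \<phi> (X * W)"
    using assms by (intro \<phi>_adj mult_closed adj_mult)
  show "0 \<le> \<phi> (W' * W)" using assms by (intro \<phi>_pos)
  fix r
  have "0 \<le> \<phi> ((X + r *\<^sub>R W') * (X' + r *\<^sub>R W))"
    using assms by (intro \<phi>_pos closed adj_add adj_scaleR) (auto intro: adj_sym)
  also have "(X + r *\<^sub>R W') * (X' + r *\<^sub>R W)
      = X * X' + (r *\<^sub>R (X * W) + (r *\<^sub>R (W' * X') + (r\<^sup>2) *\<^sub>R (W' * W)))"
    by (simp add: algebra_simps power2_eq_square)
  also have "\<phi> \<dots> = \<phi> (X * X') + 2 * r * \<phi> (X * W) + r\<^sup>2 * \<phi> (W' * W)"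
    by (simp add: \<phi>_add \<phi>_scaleR closed eq)
  finally show "0 \<le> \<phi> (X * X') + 2 * r * \<phi> (X * W) + r\<^sup>2 * \<phi> (W' * W)" .
qed

text \<open>
  The moments of a positive element determine its norm: otherwise the positive part \<open>Z\<close> of
  \<open>R - c\<close> would be a nonzero element on which \<open>R\<close> acts as at least \<open>c\<close>.
\<close>

lemma norm_le_of_moments:
  assumes R: "R \<in> \<A>" "psd R" and \<rho>: "0 \<le> \<rho>" and B: "\<And>n. \<phi> (R ^ Suc n) \<le> B * \<rho> ^ n"
  shows "norm R \<le> \<rho>"
proof (rule field_le_epsilon)
  fix \<epsilon> :: real assume \<epsilon>: "0 < \<epsilon>"
  define c where "c = \<rho> + \<epsilon>"
  have c: "c > \<rho>" "c > 0" using \<epsilon> \<rho> by (auto simp: c_def)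
  define S where "S = R - c *\<^sub>R 1"
  have adjS: "adj S S" using R by (auto simp: S_def psd_def intro: adj_diff adj_scaleR adj_one)
  have SA: "S \<in> \<A>" unfolding S_def by (intro diff_closed scaleR_closed one_closed R)
  obtain V where V: "V \<in> \<A>" "psd V" "V * V = S * S" "\<And>U. U * (S * S) = (S * S) * U \<Longrightarrow> U * V = V * U"
    using sqrt_in[OF psd_square[OF adjS] mult_closed[OF SA SA]] by metis
  have commS: "U * S = S * U" if "U * R = R * U" for U
    using that by (simp add: S_def algebra_simps)
  have commV: "U * V = V * U" if "U * R = R * U" for U
    by (rule V(4)) (metis commS[OF that] mult.assoc)
  \<comment> \<open>\<open>V\<close> is the absolute value of \<open>S\<close>, so \<open>Z\<close>
    is twice the positive part of \<open>S\<close>.\<close>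
  define Z where "Z = V + S"
  have ZA: "Z \<in> \<A>" unfolding Z_def by (intro add_closed V SA)
  have adjZ: "adj Z Z" using adjS V(2) by (auto simp: Z_def psd_def intro: adj_add)
  have SR: "S * R = R * S" by (rule commS[symmetric]) simp
  have VR: "V * R = R * V" by (rule commV[symmetric]) simp
  have SV: "S * V = V * S" by (rule commV[OF SR])
  have ZR: "Z * R = R * Z" by (simp add: Z_def distrib_left distrib_right SR VR)
  have ZV: "Z * V = V * Z" by (simp add: Z_def distrib_left distrib_right SV)
  have ZS: "Z * S = V * Z"
    by (simp add: Z_def distrib_left distrib_right V(3) SV add.commute)
  have psdRn: "psd (R ^ n)" for n
  proof (induction n)
    case (Suc n)
    have "psd (R * R ^ n)" using R(2) Suc by (rule psd_mult_commute) (rule commute_power, simp)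
    then show ?case by simp
  qed (simp add: psd_one)
  have psdZZ: "psd (Z * Z)" by (rule psd_square[OF adjZ])
  \<comment> \<open>Positivity makes \<open>f\<close> grow at least like \<open>c ^ n\<close>,
    whereas the moment hypothesis bounds \<open>f (Suc n)\<close> by a multiple of
    \<open>\<rho> ^ n\<close> with \<open>\<rho> < c\<close>. Hence \<open>f 0\<close>, the squared
    2-norm of \<open>Z\<close>, is 0.\<close>
  define f where "f n = \<phi> (R ^ n * (Z * Z))" for n
  have f: "c * f n \<le> f (Suc n)" for n
  proof -
    have "psd (R ^ n * V)" using psdRn V(2) by (rule psd_mult_commute) (rule commute_power[OF VR, symmetric])
    moreover have "R ^ n * V * (Z * Z) = Z * Z * (R ^ n * V)"
    proof (rule commute_mult)
      show "R ^ n * V * Z = Z * (R ^ n * V)" by (rule commute_mult[OF commute_power[OF ZR] ZV, symmetric])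
      then show "R ^ n * V * Z = Z * (R ^ n * V)" .
    qed
    ultimately have "psd (R ^ n * V * (Z * Z))" using psdZZ by (metis psd_mult_commute)
    then have "0 \<le> \<phi> (R ^ n * V * (Z * Z))"
      by (intro \<phi>_psd mult_closed power_closed R V ZA)
    also have "R ^ n * V * (Z * Z) = R ^ n * (S * (Z * Z))"
    proof -
      have "S * Z = V * Z" using ZS by (simp add: Z_def distrib_left distrib_right SV)
      then have "V * (Z * Z) = S * (Z * Z)" by (simp only: mult.assoc[symmetric])
      then show ?thesis by (simp only: mult.assoc)
    qed
    also have "\<dots> = R ^ Suc n * (Z * Z) - c *\<^sub>R (R ^ n * (Z * Z))"
      by (simp add: S_def left_diff_distrib right_diff_distrib power_Suc2 mult.assoc del: power_Suc)
    also have "\<phi> \<dots> = f (Suc n) - c * f n"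
      unfolding f_def by (simp only: \<phi>_diff \<phi>_scaleR scaleR_closed mult_closed power_closed R ZA)
    finally show ?thesis by simp
  qed
  have f0: "f 0 * c ^ n \<le> f n" for n
  proof (induction n)
    case (Suc n)
    have "f 0 * c ^ Suc n \<le> c * f n" using mult_left_mono[OF Suc, of c] c by (simp add: mult_ac)
    then show ?case using f[of n] by simp
  qed simp
  define K where "K = (norm Z)\<^sup>2"
  have nZZ: "norm (Z * Z) \<le> K" using norm_mult_ineq[of Z Z] by (simp add: K_def power2_eq_square)
  have "f 0 \<le> K * B * (\<rho> / c) ^ n * (1 / c)" for n
  proof -
    have "psd (K *\<^sub>R 1 - Z * Z)" using psdZZ nZZ by (intro psd_norm_minus) (auto simp: psd_def)
    moreover have "R ^ Suc n * (K *\<^sub>R 1 - Z * Z) = (K *\<^sub>R 1 - Z * Z) * R ^ Suc n"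
      using commute_mult[OF commute_power[OF ZR, symmetric] commute_power[OF ZR, symmetric], of "Suc n"]
      by (simp add: left_diff_distrib right_diff_distrib del: power_Suc)
    ultimately have "psd (R ^ Suc n * (K *\<^sub>R 1 - Z * Z))"
      using psdRn[of "Suc n"] by (metis psd_mult_commute)
    then have "0 \<le> \<phi> (R ^ Suc n * (K *\<^sub>R 1 - Z * Z))"
      by (intro \<phi>_psd mult_closed power_closed diff_closed scaleR_closed one_closed R ZA)
    also have "R ^ Suc n * (K *\<^sub>R 1 - Z * Z) = K *\<^sub>R R ^ Suc n - R ^ Suc n * (Z * Z)"
      by (simp add: right_diff_distrib)
    also have "\<phi> \<dots> = K * \<phi> (R ^ Suc n) - f (Suc n)"
      unfolding f_def by (simp only: \<phi>_diff \<phi>_scaleR scaleR_closed mult_closed power_closed R ZA)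
    finally have "f 0 * c ^ Suc n \<le> K * \<phi> (R ^ Suc n)" using f0[of "Suc n"] by linarith
    also have "\<dots> \<le> K * (B * \<rho> ^ n)" using B by (intro mult_left_mono) (auto simp: K_def)
    finally have "f 0 \<le> K * (B * \<rho> ^ n) / c ^ Suc n" using c by (simp add: pos_le_divide_eq)
    also have "\<dots> = K * B * (\<rho> / c) ^ n * (1 / c)" using c by (simp add: power_divide field_simps)
    finally show ?thesis .
  qed
  moreover have "(\<lambda>n. K * B * (\<rho> / c) ^ n * (1 / c)) \<longlonglongrightarrow> K * B * 0 * (1 / c)"
    using \<rho> c by (intro tendsto_intros LIMSEQ_power_zero) (simp add: divide_less_eq)
  ultimately have "f 0 \<le> 0" by (intro LIMSEQ_le_const[of _ "0::real" "f 0"]) auto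
  moreover have "0 \<le> \<phi> (Z * Z)" by (intro \<phi>_psd psdZZ mult_closed ZA)
  ultimately have "Z = 0" using \<phi>_faithful[OF ZA adjZ] by (simp add: f_def)
  then have S: "c *\<^sub>R 1 - R = V" by (simp add: Z_def S_def algebra_simps)
  show "norm R \<le> \<rho> + \<epsilon>"
    unfolding c_def[symmetric]
  proof (rule norm_le_of_quadratic)
    show "adj R R" using R by (simp add: psd_def)
    fix x
    have "0 \<le> ip x (app (c *\<^sub>R 1 - R) x)" unfolding S using V(2) by (simp add: psd_def)
    moreover have "0 \<le> ip x (app R x)" using R by (simp add: psd_def)
    ultimately show "\<bar>ip x (app R x)\<bar> \<le> c * (norm x)\<^sup>2" by (simp add: ip_linear ip_self)
  qed (use c in simp)
qed

end

section \<open>Free compressions\<close>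

text \<open>The palindromes arising from \<open>W* y W\<close>: the centre letter must differ in
  kind from its neighbour, which is the same on both sides.\<close>

lemma successively_append_singleton:
  assumes "successively R (rev xs)" "successively R xs" "xs \<noteq> [] \<Longrightarrow> R (hd xs) y \<and> R y (hd xs)"
  shows "successively R (rev xs @ y # xs)"
  using assms by (cases xs) (auto simp: successively_append_iff last_rev)

text \<open>The Boolean of a letter names its algebra: \<open>True\<close> for that of
  \<open>p\<close>, \<open>False\<close> for the diagonal one.\<close>

primrec alt_word :: "'a \<Rightarrow> 'a \<Rightarrow> bool \<Rightarrow> nat \<Rightarrow> (bool \<times> 'a) list"
  where "alt_word u v b 0 = []"
  | "alt_word u v b (Suc n) = (b, if b then v else u) # alt_word u v (\<not> b) n"

definition alt_prod :: "'a::monoid_mult \<Rightarrow> 'a \<Rightarrow> bool \<Rightarrow> nat \<Rightarrow> 'a"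
  where "alt_prod u v b n = prod_list (map snd (alt_word u v b n))"

text \<open>The adjoint of \<open>alt_prod\<close> when both letters are self-adjoint.\<close>

definition alt_prod_rev :: "'a::monoid_mult \<Rightarrow> 'a \<Rightarrow> bool \<Rightarrow> nat \<Rightarrow> 'a"
  where "alt_prod_rev u v b n = prod_list (map snd (rev (alt_word u v b n)))"

lemma alt_prod_simps [simp]:
  "alt_prod u v b 0 = 1" "alt_prod u v b (Suc n) = (if b then v else u) * alt_prod u v (\<not> b) n"
  "alt_prod_rev u v b 0 = 1" "alt_prod_rev u v b (Suc n) = alt_prod_rev u v (\<not> b) n * (if b then v else u)"
  by (simp_all add: alt_prod_def alt_prod_rev_def)

lemma hd_alt_word: "n > 0 \<Longrightarrow> hd (alt_word u v b n) = (b, if b then v else u)"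
  by (cases n) auto

lemma successively_alt_word:
  "successively (\<lambda>x y. fst x \<noteq> fst y) (alt_word u v b n)"
  "successively (\<lambda>x y. fst x \<noteq> fst y) (rev (alt_word u v b n))"
proof -
  show *: "successively (\<lambda>x y. fst x \<noteq> fst y) (alt_word u v b n)"
  proof (induction n arbitrary: b)
    case (Suc n)
    show ?case
      by (cases "n = 0") (use Suc[of "\<not> b"] in \<open>auto simp: successively_Cons hd_alt_word\<close>)
  qed simp
  show "successively (\<lambda>x y. fst x \<noteq> fst y) (rev (alt_word u v b n))"
    by (auto simp only: successively_rev intro: successively_mono[OF *])
qed

lemma set_alt_word: "set (alt_word u v b n) \<subseteq> {(False, u), (True, v)}"
  by (induction n arbitrary: b) auto

lemma power_eq_alt_prod: "(u * v) ^ j = alt_prod u v False (2 * j)"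
  by (induction j) (auto simp: mult.assoc)

lemma power_mult_eq_alt_prod: "(u * v) ^ j * u = alt_prod u v False (2 * j + 1)"
  by (induction j) (auto simp: mult.assoc)

text \<open>Freeness is phrased for lists of real letters: affine expressions in \<open>p\<close> on
  one side, real diagonal elements on the other. The centred letters \<open>u\<close>,
  \<open>v\<close> and their centred squares have this form.\<close>

locale free_compression = tracial_algebra \<A> \<phi> + uniform_atoms k \<alpha>
  for \<A> :: "'h::chilbert_space bop set" and \<phi> and k \<alpha> +
  fixes e :: "nat \<Rightarrow> 'h bop" and p :: "'h bop" and t :: real
  assumes e_in: "i < k \<Longrightarrow> e i \<in> \<A>"
    and adj_e: "i < k \<Longrightarrow> adj (e i) (e i)"
    and \<phi>_e: "i < k \<Longrightarrow> \<phi> (e i) = 1 / real k"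
    and e_mult: "i < k \<Longrightarrow> j < k \<Longrightarrow> e i * e j = (if i = j then e i else 0)"
    and sum_e: "(\<Sum>i<k. e i) = 1"
    and p_in: "p \<in> \<A>" and adj_p: "adj p p" and p_idem: "p * p = p"
    and \<phi>_p: "\<phi> p = t" and t_pos: "0 < t" and t_le: "t \<le> 1"
    and free: "xs \<noteq> [] \<Longrightarrow> successively (\<lambda>x y. fst x \<noteq> fst y) xs \<Longrightarrow>
      (\<And>b X. (b, X) \<in> set xs \<Longrightarrow> \<phi> X = 0 \<and>
        (if b then \<exists>r s. X = r *\<^sub>R 1 + s *\<^sub>R p else \<exists>c. X = (\<Sum>i<k. c i *\<^sub>R e i))) \<Longrightarrow>
      \<phi> (prod_list (map snd xs)) = 0"
begin

section \<open>Alternating words in the free pair\<close>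

definition diag :: "(nat \<Rightarrow> real) \<Rightarrow> 'h bop"
  where "diag c = (\<Sum>i<k. c i *\<^sub>R e i)"

lemma diag_cong: "(\<And>i. i < k \<Longrightarrow> c i = d i) \<Longrightarrow> diag c = diag d"
  by (simp add: diag_def)

lemma diag_in: "diag c \<in> \<A>"
  unfolding diag_def by (intro sum_closed scaleR_closed e_in) auto

lemma adj_diag: "adj (diag c) (diag c)"
  unfolding diag_def by (intro adj_sum adj_scaleR adj_e) auto

lemma \<phi>_diag: "\<phi> (diag c) = avg c"
  unfolding diag_def avg_def
  by (subst \<phi>_sum) (auto simp: \<phi>_scaleR e_in \<phi>_e scaleR_closed sum_divide_distrib)

lemma diag_add: "diag c + diag d = diag (\<lambda>i. c i + d i)"
  by (simp add: diag_def scaleR_add_left sum.distrib)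

lemma diag_diff: "diag c - diag d = diag (\<lambda>i. c i - d i)"
  by (simp add: diag_def scaleR_diff_left sum_subtractf)

lemma diag_const: "diag (\<lambda>_. r) = r *\<^sub>R 1"
  by (simp add: diag_def sum_e flip: scaleR_sum_right)

lemma diag_mult: "diag c * diag d = diag (\<lambda>i. c i * d i)"
proof -
  have "diag c * diag d = (\<Sum>i<k. \<Sum>j<k. (c i *\<^sub>R e i) * (d j *\<^sub>R e j))"
    unfolding diag_def by (rule sum_product)
  also have "\<dots> = (\<Sum>i<k. \<Sum>j<k. if i = j then (c i * d i) *\<^sub>R e i else 0)"
    by (intro sum.cong refl) (auto simp: e_mult)
  finally show ?thesis by (simp add: diag_def)
qed

definition a :: "'h bop" where "a = diag \<alpha>"

lemma a_in: "a \<in> \<A>" unfolding a_def by (rule diag_in)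

lemma adj_a: "adj a a" unfolding a_def by (rule adj_diag)

text \<open>Operator form of \<open>dev\<close>: \<open>1 + u w\<close> equals \<open>F w\<close>
  times the resolvent of \<open>a\<close> at \<open>w\<close>.\<close>

definition u :: "real \<Rightarrow> 'h bop" where "u w = diag (dev w)"

definition v :: "'h bop" where "v = (1 / t) *\<^sub>R p - 1"

lemma u_in: "u w \<in> \<A>" unfolding u_def by (rule diag_in)

lemma v_in: "v \<in> \<A>" unfolding v_def by (intro diff_closed scaleR_closed one_closed p_in)

lemma adj_u: "adj (u w) (u w)" unfolding u_def by (rule adj_diag)

lemma adj_v: "adj v v" unfolding v_def by (intro adj_diff adj_scaleR adj_one adj_p)

lemma v_eq: "v = (-1) *\<^sub>R 1 + (1 / t) *\<^sub>R p"
  by (simp add: v_def)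

lemma v_sq: "v * v = 1 *\<^sub>R 1 + ((1 / t) * (1 / t) - 2 / t) *\<^sub>R p"
proof -
  have "v * v = ((1 / t) * (1 / t)) *\<^sub>R p - ((1 / t) *\<^sub>R p + (1 / t) *\<^sub>R p) + 1"
    by (simp add: v_def left_diff_distrib right_diff_distrib p_idem scaleR_diff_right)
  also have "(1 / t) *\<^sub>R p + (1 / t) *\<^sub>R p = (2 / t) *\<^sub>R p"
    unfolding scaleR_add_left[symmetric] by simp
  finally show ?thesis by (simp only: scaleR_diff_left scaleR_one add.commute)
qed

lemma \<phi>_v: "\<phi> v = 0"
  using t_pos by (simp add: v_def \<phi>_diff \<phi>_scaleR \<phi>_one p_in one_closed scaleR_closed \<phi>_p)

lemma \<phi>_v_sq: "\<phi> (v * v) = (1 - t) / t"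
  using t_pos unfolding v_sq
  by (simp add: \<phi>_add \<phi>_scaleR \<phi>_one p_in one_closed scaleR_closed \<phi>_p field_simps)

lemma u_sq: "u w * u w = diag (\<lambda>i. (dev w i)\<^sup>2)"
  by (simp add: u_def diag_mult power2_eq_square)

lemma \<phi>_u_sq: "\<phi> (u w * u w) = \<kappa> w"
  unfolding u_sq \<phi>_diag \<kappa>_def by simp

lemma \<phi>_u: "regular w \<Longrightarrow> \<phi> (u w) = 0"
  by (simp add: u_def \<phi>_diag avg_dev)

lemma alt_prod_in: "alt_prod (u w) v b n \<in> \<A>" "alt_prod_rev (u w) v b n \<in> \<A>"
  by (induction n arbitrary: b) (auto intro: one_closed mult_closed u_in v_in)

lemma adj_alt_prod: "adj (alt_prod (u w) v b n) (alt_prod_rev (u w) v b n)"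
  by (induction n arbitrary: b) (auto intro: adj_one adj_mult adj_u adj_v)

lemma letters:
  assumes "regular w" "(b, X) \<in> {(False, u w), (True, v)}"
  shows "\<phi> X = 0 \<and> (if b then \<exists>r s. X = r *\<^sub>R 1 + s *\<^sub>R p else \<exists>c. X = (\<Sum>i<k. c i *\<^sub>R e i))"
proof (cases b)
  case True
  then have "X = v" using assms(2) by simp
  then show ?thesis using \<phi>_v v_eq True by metis
next
  case False
  then have "X = (\<Sum>i<k. dev w i *\<^sub>R e i)" "\<phi> X = 0"
    using assms \<phi>_u[of w] by (auto simp: u_def diag_def)
  then show ?thesis using False by auto
qed

lemma \<phi>_alt_prod:
  assumes "regular w" "n > 0"
  shows "\<phi> (alt_prod (u w) v b n) = 0"
  unfolding alt_prod_def
proof (rule free)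
  show "alt_word (u w) v b n \<noteq> []" using assms by (cases n) auto
  fix c X assume "(c, X) \<in> set (alt_word (u w) v b n)"
  then have "(c, X) \<in> {(False, u w), (True, v)}" by (rule subsetD[OF set_alt_word])
  then show "\<phi> X = 0 \<and> (if c then \<exists>r s. X = r *\<^sub>R 1 + s *\<^sub>R p else \<exists>c. X = (\<Sum>i<k. c i *\<^sub>R e i))"
    by (rule letters[OF assms(1)])
qed (rule successively_alt_word)

primrec sq_norm :: "real \<Rightarrow> bool \<Rightarrow> nat \<Rightarrow> real"
  where "sq_norm w b 0 = 1"
  | "sq_norm w b (Suc n) = (if b then (1 - t) / t else \<kappa> w) * sq_norm w (\<not> b) n"

text \<open>
  By freeness the square of the outermost letter may be replaced by its trace, so alternating
  words in \<open>u\<close> and \<open>v\<close> have multiplicative 2-norms.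
\<close>

lemma \<phi>_alt_prod_sq:
  assumes w: "regular w"
  shows "\<phi> (alt_prod_rev (u w) v b n * alt_prod (u w) v b n) = sq_norm w b n"
proof (induction n arbitrary: b)
  case 0
  then show ?case by (simp add: \<phi>_one)
next
  case (Suc n)
  let ?x = "if b then v else u w" and ?W = "alt_prod (u w) v (\<not> b) n" and ?W' = "alt_prod_rev (u w) v (\<not> b) n"
  define c where "c = \<phi> (?x * ?x)"
  define y where "y = ?x * ?x - c *\<^sub>R 1"
  have xin: "?x * ?x \<in> \<A>" by (auto intro: mult_closed u_in v_in)
  have y: "\<phi> y = 0 \<and> (if b then \<exists>r s. y = r *\<^sub>R 1 + s *\<^sub>R p else \<exists>c. y = (\<Sum>i<k. c i *\<^sub>R e i))"
  proof (intro conjI)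
    show "\<phi> y = 0"
      unfolding y_def by (simp only: \<phi>_diff xin scaleR_closed one_closed \<phi>_scaleR \<phi>_one) (simp add: c_def)
    show "if b then \<exists>r s. y = r *\<^sub>R 1 + s *\<^sub>R p else \<exists>c. y = (\<Sum>i<k. c i *\<^sub>R e i)"
    proof (cases b)
      case True
      have "y = (1 - c) *\<^sub>R 1 + ((1 / t) * (1 / t) - 2 / t) *\<^sub>R p"
        using True by (simp add: y_def v_sq scaleR_diff_left)
      then show ?thesis using True by auto
    next
      case False
      have "y = diag (\<lambda>i. (dev w i)\<^sup>2 - c)"
        using False by (simp add: y_def u_sq diag_diff flip: diag_const)
      then show ?thesis using False by (auto simp: diag_def)
    qed
  qed
  have yin: "y \<in> \<A>" unfolding y_def by (intro diff_closed xin scaleR_closed one_closed)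
  \<comment> \<open>The centred square is again a letter of its own algebra, so this palindrome is
    alternating and has trace 0.\<close>
  let ?ws = "rev (alt_word (u w) v (\<not> b) n) @ (b, y) # alt_word (u w) v (\<not> b) n"
  have "\<phi> (prod_list (map snd ?ws)) = 0"
  proof (rule free)
    show "successively (\<lambda>x y. fst x \<noteq> fst y) ?ws"
    proof (rule successively_append_singleton[OF successively_alt_word(2,1)])
      assume "alt_word (u w) v (\<not> b) n \<noteq> []"
      then have "n > 0" by (cases n) auto
      then show "fst (hd (alt_word (u w) v (\<not> b) n)) \<noteq> fst (b, y) \<and> fst (b, y) \<noteq> fst (hd (alt_word (u w) v (\<not> b) n))"
        by (simp add: hd_alt_word)
    qed
    fix c X assume "(c, X) \<in> set ?ws"
    then have "(c, X) = (b, y) \<or> (c, X) \<in> {(False, u w), (True, v)}"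
      using set_alt_word[of "u w" v "\<not> b" n] by auto
    then show "\<phi> X = 0 \<and> (if c then \<exists>r s. X = r *\<^sub>R 1 + s *\<^sub>R p else \<exists>c. X = (\<Sum>i<k. c i *\<^sub>R e i))"
      using y letters[OF w] by blast
  qed simp
  then have y0: "\<phi> (?W' * y * ?W) = 0"
    by (simp add: alt_prod_def alt_prod_rev_def mult.assoc)
  have "alt_prod_rev (u w) v b (Suc n) * alt_prod (u w) v b (Suc n) = ?W' * (?x * ?x) * ?W"
    by (simp add: mult.assoc)
  also have "?x * ?x = y + c *\<^sub>R 1" by (simp add: y_def)
  also have "?W' * (y + c *\<^sub>R 1) * ?W = ?W' * y * ?W + c *\<^sub>R (?W' * ?W)"
    by (simp add: distrib_left distrib_right)
  also have "\<phi> \<dots> = c * sq_norm w (\<not> b) n"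
    by (simp add: \<phi>_add \<phi>_scaleR mult_closed scaleR_closed alt_prod_in yin y0 Suc)
  also have "c = (if b then (1 - t) / t else \<kappa> w)" by (simp add: c_def \<phi>_u_sq \<phi>_v_sq)
  finally show ?case by simp
qed

lemma sq_norm_even: "sq_norm w False (2 * j) = (\<kappa> w * ((1 - t) / t)) ^ j"
  by (induction j) auto

text \<open>This is \<open>t * H w\<close> for the exponent \<open>1 / t\<close>: the spectral
  parameter of \<open>p a p\<close> that corresponds to the parameter \<open>w\<close> of
  \<open>a\<close>.\<close>

definition lam :: "'a::real_normed_field \<Rightarrow> 'a" where "lam w = w - of_real (1 - t) * F w"

text \<open>The inverse of \<open>l - p a p\<close> inside the corner cut out by \<open>p\<close>,
  extended by 0 to the complement.\<close>

definition resolvent :: "real \<Rightarrow> 'h bop \<Rightarrow> bool"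
  where "resolvent l R \<longleftrightarrow> R \<in> \<A> \<and> psd R \<and> R * p = R \<and> p * R = R
    \<and> R * (l *\<^sub>R p - p * a * p) = p \<and> (l *\<^sub>R p - p * a * p) * R = p"

text \<open>
  The factorisation of Lehner and Haagerup: with \<open>1 + v = p / t\<close> and \<open>(w - a) (1 + u) = F w\<close>, the
  compressed resolvent at \<open>lam w\<close> is \<open>1 - u v\<close> inverted, up to invertible factors.
\<close>

lemma resolvent_factor:
  assumes w: "regular w" and R: "resolvent (lam w) R"
  defines "S \<equiv> t *\<^sub>R (R * (w *\<^sub>R 1 - a))"
  shows "S * (1 - u w * v) = p" "S * (1 + u w) = (t * F w) *\<^sub>R R"
proof -
  have wa: "w *\<^sub>R 1 - a = diag (\<lambda>i. w - \<alpha> i)" by (simp add: a_def diag_diff flip: diag_const)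
  have "(w *\<^sub>R 1 - a) * (1 + u w) = diag (\<lambda>i. (w - \<alpha> i) * (1 + dev w i))"
  proof -
    have "1 + diag (dev w) = diag (\<lambda>i. 1 + dev w i)" using diag_add[of "\<lambda>_. 1" "dev w"] by (simp add: diag_const)
    then show ?thesis by (simp add: wa u_def diag_mult)
  qed
  also have "\<dots> = F w *\<^sub>R 1"
    unfolding diag_const[symmetric] using dev_eq[OF w] by (intro diag_cong) simp
  finally have f: "(w *\<^sub>R 1 - a) * (1 + u w) = F w *\<^sub>R 1" .
  show "S * (1 + u w) = (t * F w) *\<^sub>R R"
    unfolding S_def by (simp add: mult.assoc f)
  have f': "(w *\<^sub>R 1 - a) * u w = F w *\<^sub>R 1 - w *\<^sub>R 1 + a"
    using f by (simp add: algebra_simps)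
  have "1 - u w * v = 1 + u w - (1 / t) *\<^sub>R (u w * p)"
    by (simp add: v_def right_diff_distrib)
  then have "(w *\<^sub>R 1 - a) * (1 - u w * v) = (w *\<^sub>R 1 - a) * (1 + u w) - (1 / t) *\<^sub>R ((w *\<^sub>R 1 - a) * u w * p)"
    by (simp only: right_diff_distrib mult_scaleR_right mult.assoc)
  also have "\<dots> = F w *\<^sub>R 1 - (1 / t) *\<^sub>R ((F w - w) *\<^sub>R p + a * p)"
    unfolding f f' by (simp add: algebra_simps)
  finally have g: "(w *\<^sub>R 1 - a) * (1 - u w * v) = F w *\<^sub>R 1 - (1 / t) *\<^sub>R ((F w - w) *\<^sub>R p + a * p)" .
  have Rp: "R * p = R" and res: "R * (lam w *\<^sub>R p - p * a * p) = p" using R by (auto simp: resolvent_def)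
  have Rap: "R * (a * p) = R * (p * a * p)" using Rp by (metis mult.assoc)
  have "S * (1 - u w * v) = t *\<^sub>R (R * ((w *\<^sub>R 1 - a) * (1 - u w * v)))"
    by (simp add: S_def mult.assoc)
  also have "\<dots> = (t * F w) *\<^sub>R R - (F w - w) *\<^sub>R R - R * (a * p)"
    unfolding g using t_pos by (simp add: right_diff_distrib distrib_left scaleR_diff_right scaleR_add_right Rp)
  also have "\<dots> = R * (lam w *\<^sub>R p - p * a * p)"
    unfolding Rap by (simp add: right_diff_distrib Rp lam_def algebra_simps)
  finally show "S * (1 - u w * v) = p" using res by simp
qed

text \<open>\<open>S (1 - u v) = p\<close> expands \<open>S\<close> as a finite Neumann sum plus the
  remainder \<open>S (u v)^n\<close>. Only the 2-norm of \<open>(u v)^n\<close> is known to tend to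
  0, but that is enough under the trace, because the other factors are fixed operators. After
  multiplication by \<open>1 + u w\<close> all summands except the first are centred.\<close>

lemma \<phi>_resolvent:
  assumes w: "regular w" and \<kappa>: "\<kappa> w * ((1 - t) / t) < 1" and R: "resolvent (lam w) R"
  shows "\<phi> R = G w"
proof -
  define S where "S = t *\<^sub>R (R * (w *\<^sub>R 1 - a))"
  note S = resolvent_factor[OF w R, folded S_def]
  have RA: "R \<in> \<A>" "adj R R" using R by (auto simp: resolvent_def psd_def)
  define x where "x = u w * v"
  have SA: "S \<in> \<A>" unfolding S_def by (intro scaleR_closed mult_closed diff_closed RA one_closed a_in)
  have xA: "x \<in> \<A>" unfolding x_def by (intro mult_closed u_in v_in)
  have uA: "1 + u w \<in> \<A>" by (intro add_closed one_closed u_in)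
  define S' where "S' = t *\<^sub>R ((w *\<^sub>R 1 - a) * R)"
  have S'A: "S' \<in> \<A>" unfolding S'_def by (intro scaleR_closed mult_closed diff_closed RA one_closed a_in)
  have SS': "adj S S'" unfolding S_def S'_def by (intro adj_scaleR adj_mult adj_diff RA adj_one adj_a)
  have adj1u: "adj (1 + u w) (1 + u w)" by (intro adj_add adj_one adj_u)
  have S_eq: "S = (\<Sum>j<n. p * x ^ j) + S * x ^ n" for n
  proof (induction n)
    case (Suc n)
    have "S = p + S * x" using S(1) by (simp add: x_def algebra_simps)
    then have "S * x ^ n = p * x ^ n + S * x ^ Suc n"
      by (metis distrib_right mult.assoc power_Suc)
    then show ?case using Suc by (simp add: add.assoc)
  qed simp
  \<comment> \<open>Since \<open>p = t (1 + v)\<close>, the product is \<open>t\<close> times a sum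
    of four alternating words. All have positive length and trace 0, apart from the empty word that
    occurs for \<open>j = 0\<close>.\<close>
  have tr: "\<phi> (p * x ^ j * (1 + u w)) = (if j = 0 then t else 0)" for j
  proof -
    let ?P = "alt_prod (u w) v"
    have pY: "p * Y = t *\<^sub>R (Y + v * Y)" for Y
    proof -
      have "p = t *\<^sub>R (1 + v)" using t_pos by (simp add: v_def)
      then have "p * Y = t *\<^sub>R (1 + v) * Y" by (simp only:)
      then show ?thesis by (simp add: distrib_right)
    qed
    have vP: "v * ?P False n = ?P True (n + 1)" for n by simp
    have "p * x ^ j * (1 + u w) = p * (x ^ j + x ^ j * u w)" by (simp add: mult.assoc distrib_left)
    also have "\<dots> = t *\<^sub>R (((x ^ j + v * x ^ j) + x ^ j * u w) + v * (x ^ j * u w))"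
      unfolding pY by (simp add: distrib_left add_ac)
    also have "\<dots> = t *\<^sub>R (((?P False (2 * j) + ?P True (2 * j + 1)) + ?P False (2 * j + 1)) + ?P True (2 * j + 1 + 1))"
      unfolding x_def unfolding power_mult_eq_alt_prod unfolding power_eq_alt_prod unfolding vP ..
    also have "\<phi> \<dots> = t * (((\<phi> (?P False (2 * j)) + \<phi> (?P True (2 * j + 1))) + \<phi> (?P False (2 * j + 1))) + \<phi> (?P True (2 * j + 1 + 1)))"
    proof -
      have "\<phi> (t *\<^sub>R (((A + B) + C) + D)) = t * (((\<phi> A + \<phi> B) + \<phi> C) + \<phi> D)"
        if "A \<in> \<A>" "B \<in> \<A>" "C \<in> \<A>" "D \<in> \<A>" for A B C D
        using that by (simp add: \<phi>_scaleR \<phi>_add add_closed)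
      then show ?thesis by (meson alt_prod_in(1))
    qed
    also have "\<dots> = t * \<phi> (?P False (2 * j))"
    proof -
      have "\<phi> (?P b (2 * j + 1)) = 0" "\<phi> (?P b (2 * j + 1 + 1)) = 0" for b
        by (intro \<phi>_alt_prod[OF w]; simp)+
      then show ?thesis by (simp only: add_0_right)
    qed
    also have "\<dots> = (if j = 0 then t else 0)"
      using \<phi>_alt_prod[OF w, of "2 * j" False] by (cases "j = 0") (simp_all add: \<phi>_one)
    finally show ?thesis .
  qed
  define K where "K = \<phi> (((1 + u w) * S) * (S' * (1 + u w)))"
  define q where "q = \<kappa> w * ((1 - t) / t)"
  have q: "0 \<le> q" "q < 1" using \<kappa> \<kappa>_nonneg[of w] t_pos t_le by (auto simp: q_def)
  \<comment> \<open>Cauchy-Schwarz separates the remainder into the constant \<open>K\<close>,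
    independent of \<open>n\<close>, and the squared 2-norm of \<open>x ^ n\<close>, which is
    \<open>q ^ n\<close>.\<close>
  have err: "(t * F w * \<phi> R - t)\<^sup>2 \<le> K * q ^ n" if n: "n > 0" for n
  proof -
    have f1: "(t * F w) *\<^sub>R R = (\<Sum>j<n. p * x ^ j * (1 + u w)) + S * x ^ n * (1 + u w)"
    proof -
      have "(t * F w) *\<^sub>R R = S * (1 + u w)" by (rule S(2)[symmetric])
      also have "\<dots> = ((\<Sum>j<n. p * x ^ j) + S * x ^ n) * (1 + u w)"
        using arg_cong[OF S_eq[of n], of "\<lambda>X. X * (1 + u w)"] by (simp only:)
      finally show ?thesis by (simp only: distrib_right[of "\<Sum>j<n. p * x ^ j"] sum_distrib_right)
    qed
    have f2: "\<phi> ((t * F w) *\<^sub>R R) = t * F w * \<phi> R" by (rule \<phi>_scaleR[OF RA(1)])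
    have f3: "\<phi> ((\<Sum>j<n. p * x ^ j * (1 + u w)) + S * x ^ n * (1 + u w))
        = (\<Sum>j<n. \<phi> (p * x ^ j * (1 + u w))) + \<phi> (S * x ^ n * (1 + u w))"
      by (simp only: \<phi>_add \<phi>_sum sum_closed mult_closed power_closed p_in xA uA SA)
    have f4: "(\<Sum>j<n. \<phi> (p * x ^ j * (1 + u w))) = t"
      unfolding tr using n by simp
    have f5: "\<phi> (S * x ^ n * (1 + u w)) = \<phi> ((1 + u w) * (S * x ^ n))"
      by (intro \<phi>_commute mult_closed power_closed xA uA SA)
    have "t * F w * \<phi> R = t + \<phi> ((1 + u w) * (S * x ^ n))"
      by (simp only: f2[symmetric] f1 f3 f4 f5)
    then have "t * F w * \<phi> R - t = \<phi> ((1 + u w) * S * x ^ n)"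
      by (simp only: mult.assoc add_diff_cancel_left')
    moreover have "(\<phi> ((1 + u w) * S * x ^ n))\<^sup>2
        \<le> K * \<phi> (alt_prod_rev (u w) v False (2 * n) * x ^ n)"
      unfolding K_def x_def power_eq_alt_prod
      by (intro \<phi>_cauchy_schwarz mult_closed uA SA S'A alt_prod_in adj_alt_prod adj_mult adj1u SS')
    moreover have "\<phi> (alt_prod_rev (u w) v False (2 * n) * x ^ n) = q ^ n"
      unfolding x_def power_eq_alt_prod \<phi>_alt_prod_sq[OF w] sq_norm_even q_def ..
    ultimately show ?thesis by (simp only:)
  qed
  have "(\<lambda>n. K * q ^ n) \<longlonglongrightarrow> K * 0"
    using q by (intro tendsto_mult tendsto_const LIMSEQ_power_zero) simp
  then have "(t * F w * \<phi> R - t)\<^sup>2 \<le> K * 0"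
    using err by (intro LIMSEQ_le_const[of "\<lambda>n. K * q ^ n"] exI[of _ 1]) auto
  then have "t * F w * \<phi> R = t" by simp
  then show ?thesis
    using t_pos w by (simp add: F_def regular_def field_simps)
qed

end

text \<open>If a coefficient of positive index differed, the difference series would have an
  isolated zero at 0; index 0 is read off at the origin.\<close>

lemma real_powser_unique:
  fixes a b :: "nat \<Rightarrow> real"
  assumes r: "0 < r"
    and sums: "\<And>x. \<bar>x\<bar> < r \<Longrightarrow> \<exists>s. (\<lambda>n. a n * x ^ n) sums s \<and> (\<lambda>n. b n * x ^ n) sums s"
  shows "a n = b n"
proof -
  let ?c = "\<lambda>n. a n - b n"
  have c: "(\<lambda>n. ?c n * (x - 0) ^ n) sums 0" if "norm (x - 0) < r" for x :: real
  proof -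
    obtain s where "(\<lambda>n. a n * x ^ n) sums s" "(\<lambda>n. b n * x ^ n) sums s" using sums[of x] \<open>norm (x - 0) < r\<close> by auto
    from sums_diff[OF this] show ?thesis by (simp add: left_diff_distrib)
  qed
  have "?c n = 0"
  proof (cases "n = 0")
    case True
    have "?c 0 = 0" using c[of 0] r by simp
    then show ?thesis using True by simp
  next
    case False
    show ?thesis
    proof (rule ccontr)
      assume "?c n \<noteq> 0"
      then obtain s where "0 < s" "\<And>z. z \<in> cball (0::real) s - {0} \<Longrightarrow> (\<lambda>_. 0 :: real) z \<noteq> 0"
        using powser_0_nonzero[OF r c, of n] False by blast
      moreover from \<open>0 < s\<close> have "s \<in> cball (0::real) s - {0}" by simp
      ultimately show False by blast
    qed
  qed
  then show ?thesis by simp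
qed

context uniform_atoms
begin

lemma G_of_real: "G (of_real w :: complex) = of_real (G w)"
  unfolding G_def avg_of_real[symmetric] by simp

lemma F_of_real: "F (of_real w :: complex) = of_real (F w)"
  by (simp add: F_def G_of_real)

text \<open>Right of all atoms every summand of \<open>G\<close> has positive real part. This
  extends regularity to a complex neighbourhood of the real ray.\<close>

lemma regular_of_Re:
  assumes "\<And>i. i < k \<Longrightarrow> \<alpha> i < Re w"
  shows "regular w"
proof -
  have "Re (1 / (w - complex_of_real (\<alpha> i))) > 0" if "i < k" for i
    using assms[OF that] by (auto simp: Re_divide intro!: divide_pos_pos add_pos_nonneg)
  then have "avg (\<lambda>i. Re (1 / (w - complex_of_real (\<alpha> i)))) > 0" by (rule avg_pos)
  moreover have "Re (G w) = avg (\<lambda>i. Re (1 / (w - complex_of_real (\<alpha> i))))"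
    unfolding G_def avg_def by (simp add: Re_divide_of_nat)
  ultimately have "G w \<noteq> 0" by auto
  moreover have "w \<noteq> complex_of_real (\<alpha> i)" if "i < k" for i using assms[OF that] by auto
  ultimately show ?thesis by (simp add: regular_def)
qed

end

context free_compression
begin

section \<open>The compression and its resolvents\<close>

definition X :: "'h bop" where "X = p * a * p"

lemma adj_X: "adj X X"
  unfolding X_def using adj_mult[OF adj_mult[OF adj_p adj_a] adj_p] by (simp add: mult.assoc)

lemma X_in: "X \<in> \<A>"
  unfolding X_def by (intro mult_closed p_in a_in)

lemma p_X: "p * X = X" and X_p: "X * p = X"
  unfolding X_def by (metis p_idem mult.assoc)+

lemma ip_p: "ip x (app p x) = (norm (app p x))\<^sup>2"
proof -
  have "ip (app p x) (app p x) = ip x (app (p * p) x)" using adj_p by (simp add: adj_def)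
  then show ?thesis by (simp add: p_idem ip_self)
qed

lemma ip_X_le: "\<bar>ip x (app X x)\<bar> \<le> norm a * (norm (app p x))\<^sup>2"
proof -
  have "ip x (app X x) = ip (app p x) (app a (app p x))"
    using adj_p by (simp add: X_def adj_def)
  then show ?thesis using ip_app_le[of "app p x" a] by simp
qed

lemma norm_p_le: "(norm (app p x))\<^sup>2 \<le> (norm x)\<^sup>2"
proof -
  have "(norm (x - app p x))\<^sup>2 = (norm x)\<^sup>2 - (norm (app p x))\<^sup>2"
    unfolding ip_self[symmetric]
    by (simp add: ip_linear ip_commute[of "app p x" x] ip_p) (simp add: ip_self)
  then show ?thesis by (metis diff_ge_0_iff_ge zero_le_power2)
qed

text \<open>Adding \<open>1 - p\<close> makes \<open>l p - X\<close> bounded below on the whole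
  space. The inverse commutes with \<open>p\<close>, and cutting it down by \<open>p\<close> gives
  the corner inverse.\<close>

lemma exists_resolvent:
  assumes M: "\<And>x. ip x (app X x) \<le> M * (norm (app p x))\<^sup>2" and l: "M < l"
  shows "\<exists>R. resolvent l R"
proof -
  define C where "C = l *\<^sub>R p - X + (1 - p)"
  have CA: "C \<in> \<A>" unfolding C_def by (intro add_closed diff_closed scaleR_closed p_in X_in one_closed)
  have adjC: "adj C C" unfolding C_def by (intro adj_add adj_diff adj_scaleR adj_p adj_X adj_one)
  define d where "d = min (l - M) 1"
  have d: "0 < d" "d \<le> l - M" "d \<le> 1" using l by (auto simp: d_def)
  have "d * (norm x)\<^sup>2 \<le> ip x (app C x)" for x
  proof -
    have "d * (norm x)\<^sup>2 = d * (norm (app p x))\<^sup>2 + d * ((norm x)\<^sup>2 - (norm (app p x))\<^sup>2)"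
      by (simp add: algebra_simps)
    also have "\<dots> \<le> (l - M) * (norm (app p x))\<^sup>2 + 1 * ((norm x)\<^sup>2 - (norm (app p x))\<^sup>2)"
      using d norm_p_le[of x] by (intro add_mono mult_right_mono) auto
    also have "\<dots> \<le> ip x (app C x)"
      using M[of x] by (simp add: C_def ip_linear ip_p ip_self algebra_simps)
    finally show ?thesis .
  qed
  from exists_psd_inverse[OF adjC d(1) this] obtain N
    where N: "psd N" "N * C = 1" "C * N = 1" "\<And>U. U * C = C * U \<Longrightarrow> U * N = N * U" by blast
  have NA: "N \<in> \<A>" using CA N(4) by (rule commutant_closed)
  have pC: "p * C = l *\<^sub>R p - X" "C * p = l *\<^sub>R p - X"
    by (simp_all add: C_def algebra_simps p_idem p_X X_p)
  have pN: "p * N = N * p" by (rule N(4)) (simp only: pC)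
  have "psd p" using psd_square[OF adj_p] by (simp add: p_idem)
  then have "psd (p * N)" using N(1) pN by (rule psd_mult_commute)
  moreover have "p * N \<in> \<A>" by (intro mult_closed p_in NA)
  moreover have *: "p * (p * N) = p * N" by (simp add: p_idem flip: mult.assoc)
  moreover have "p * N * p = p * N" unfolding mult.assoc pN[symmetric] by (rule *)
  moreover have "p * N * (l *\<^sub>R p - X) = p"
  proof -
    have "p * N * (C * p) = p * (N * C) * p" by (simp only: mult.assoc)
    then show ?thesis by (simp add: pC(2) N(2) p_idem)
  qed
  moreover have "(l *\<^sub>R p - X) * (p * N) = p"
  proof -
    have "p * C * (N * p) = p * (C * N) * p" by (simp only: mult.assoc)
    then show ?thesis by (simp add: pC(1) pN N(3) p_idem)
  qed
  ultimately show ?thesis unfolding resolvent_def X_def[symmetric] by blast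
qed

lemma resolvent_identity:
  assumes R: "resolvent l R" and R': "resolvent (l - d) R'"
  shows "R' = R + d *\<^sub>R (R' * R)"
proof -
  have 1: "(l *\<^sub>R p - X) * R = p" "p * R = R" using R by (auto simp: resolvent_def X_def)
  have 2: "R' * ((l - d) *\<^sub>R p - X) = p" "R' * p = R'" using R' by (auto simp: resolvent_def X_def)
  have "l *\<^sub>R p - X = ((l - d) *\<^sub>R p - X) + d *\<^sub>R p" by (simp add: algebra_simps)
  then have "R' * (l *\<^sub>R p - X) = R' * (((l - d) *\<^sub>R p - X) + d *\<^sub>R p)" by (simp only:)
  then have "R' * (l *\<^sub>R p - X) = p + d *\<^sub>R R'" by (simp only: distrib_left mult_scaleR_right 2)
  then have "R' * (l *\<^sub>R p - X) * R = R + d *\<^sub>R (R' * R)" by (simp add: distrib_right 1)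
  then show ?thesis by (simp add: mult.assoc 1 2)
qed

lemma norm_power_bop: "norm (T ^ n) \<le> norm (T :: 'h bop) ^ n"
proof (induction n)
  case (Suc n)
  have "norm (T ^ Suc n) \<le> norm T * norm (T ^ n)" by (simp add: norm_mult_ineq)
  also have "\<dots> \<le> norm T * norm T ^ n" using Suc by (rule mult_left_mono) simp
  finally show ?case by simp
qed (simp add: norm_one_bop)

text \<open>The trace of the expansion of \<open>R'\<close> in powers of \<open>R\<close>. The
  remainder \<open>d ^ n R' R ^ n\<close> is controlled by Cauchy-Schwarz, as \<open>R'\<close> is a
  fixed operator.\<close>

lemma resolvent_series:
  assumes R: "resolvent l R" and R': "resolvent (l - d) R'" and d: "\<bar>d\<bar> * norm R < 1"
  shows "(\<lambda>n. \<phi> (R ^ Suc n) * d ^ n) sums \<phi> R'"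
proof -
  have RA: "R \<in> \<A>" "R' \<in> \<A>" "adj R R" "adj R' R'" using R R' by (auto simp: resolvent_def psd_def)
  have eq: "R' = (\<Sum>j<n. d ^ j *\<^sub>R R ^ Suc j) + d ^ n *\<^sub>R (R' * R ^ n)" for n
  proof (induction n)
    case (Suc n)
    have "R' * R ^ n = (R + d *\<^sub>R (R' * R)) * R ^ n"
      using resolvent_identity[OF R R'] by simp
    then have "R' * R ^ n = R ^ Suc n + d *\<^sub>R (R' * R ^ Suc n)"
      by (simp add: distrib_right mult.assoc)
    then have "d ^ n *\<^sub>R (R' * R ^ n) = d ^ n *\<^sub>R R ^ Suc n + d ^ Suc n *\<^sub>R (R' * R ^ Suc n)"
      by (simp only: scaleR_add_right scaleR_scaleR power_Suc mult.commute)
    then show ?case using Suc by (simp only: sum.lessThan_Suc add.assoc)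
  qed simp
  have \<phi>eq: "(\<Sum>j<n. \<phi> (R ^ Suc j) * d ^ j) - \<phi> R' = - (d ^ n * \<phi> (R' * R ^ n))" for n
  proof -
    have "\<phi> R' = \<phi> ((\<Sum>j<n. d ^ j *\<^sub>R R ^ Suc j) + d ^ n *\<^sub>R (R' * R ^ n))" using eq[of n] by (rule arg_cong)
    also have "\<dots> = (\<Sum>j<n. d ^ j * \<phi> (R ^ Suc j)) + d ^ n * \<phi> (R' * R ^ n)"
      by (simp only: \<phi>_add \<phi>_sum \<phi>_scaleR sum_closed scaleR_closed mult_closed power_closed RA)
    finally show ?thesis by (simp add: mult.commute)
  qed
  define K where "K = sqrt (\<phi> (R' * R'))"
  have bound: "\<bar>\<phi> (R' * R ^ n)\<bar> \<le> K * norm R ^ n" for n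
  proof -
    have "(\<phi> (R' * R ^ n))\<^sup>2 \<le> \<phi> (R' * R') * \<phi> (R ^ n * R ^ n)"
      by (intro \<phi>_cauchy_schwarz RA power_closed adj_power)
    also have "\<dots> \<le> \<phi> (R' * R') * (norm R ^ n * norm R ^ n)"
    proof (rule mult_left_mono)
      have "\<phi> (R ^ n * R ^ n) \<le> norm (R ^ n * R ^ n)"
        using \<phi>_le_norm[of "R ^ n * R ^ n"] adj_mult[OF adj_power[OF RA(3)] adj_power[OF RA(3)], of n n]
        by (simp add: mult_closed power_closed RA)
      also have "\<dots> \<le> norm (R ^ n) * norm (R ^ n)" by (rule norm_mult_ineq)
      also have "\<dots> \<le> norm R ^ n * norm R ^ n" by (intro mult_mono norm_power_bop) auto
      finally show "\<phi> (R ^ n * R ^ n) \<le> norm R ^ n * norm R ^ n" .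
      show "0 \<le> \<phi> (R' * R')" by (intro \<phi>_pos RA)
    qed
    finally have "sqrt ((\<phi> (R' * R ^ n))\<^sup>2) \<le> sqrt (\<phi> (R' * R') * (norm R ^ n)\<^sup>2)"
      unfolding power2_eq_square[of "norm R ^ n"] by (rule real_sqrt_le_mono)
    then show ?thesis by (simp add: K_def real_sqrt_mult)
  qed
  have "(\<lambda>n. (\<Sum>j<n. \<phi> (R ^ Suc j) * d ^ j) - \<phi> R') \<longlonglongrightarrow> 0"
  proof (rule Lim_null_comparison)
    show "\<forall>\<^sub>F n in sequentially. norm ((\<Sum>j<n. \<phi> (R ^ Suc j) * d ^ j) - \<phi> R') \<le> K * (\<bar>d\<bar> * norm R) ^ n"
    proof (intro always_eventually allI)
      fix n
      have "\<bar>d\<bar> ^ n * \<bar>\<phi> (R' * R ^ n)\<bar> \<le> \<bar>d\<bar> ^ n * (K * norm R ^ n)" using bound by (intro mult_left_mono) auto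
      then show "norm ((\<Sum>j<n. \<phi> (R ^ Suc j) * d ^ j) - \<phi> R') \<le> K * (\<bar>d\<bar> * norm R) ^ n"
        unfolding \<phi>eq by (simp add: abs_mult power_abs power_mult_distrib mult_ac)
    qed
    show "(\<lambda>n. K * (\<bar>d\<bar> * norm R) ^ n) \<longlonglongrightarrow> 0"
      using d by (intro tendsto_mult_right_zero LIMSEQ_power_zero) simp
  qed
  then show ?thesis unfolding sums_def by (rule LIM_zero_cancel)
qed

text \<open>On a nearly maximal vector \<open>y = p x\<close> the form of \<open>Q = l p - X\<close>
  is at most \<open>(l - M + \<epsilon>) (norm y)^2\<close>. Cauchy-Schwarz for this form at
  \<open>y\<close> and \<open>R y\<close>, where \<open>Q R y = y\<close>, bounds
  \<open>(norm y)^4\<close> by the product of the forms of \<open>Q\<close> and \<open>R\<close> at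
  \<open>y\<close>.\<close>

lemma norm_resolvent_ge:
  assumes M: "\<And>x. ip x (app X x) \<le> M * (norm (app p x))\<^sup>2"
    and least: "\<And>\<epsilon>. \<epsilon> > 0 \<Longrightarrow> \<exists>x. ip x (app X x) > (M - \<epsilon>) * (norm (app p x))\<^sup>2"
    and l: "M < l" and R: "resolvent l R"
  shows "1 \<le> (l - M) * norm R"
proof -
  define Q where "Q = l *\<^sub>R p - X"
  have "psd Q"
    unfolding psd_def
  proof (intro conjI allI)
    show "adj Q Q" unfolding Q_def by (intro adj_diff adj_scaleR adj_p adj_X)
    fix x
    have "M * (norm (app p x))\<^sup>2 \<le> l * (norm (app p x))\<^sup>2" using l by (intro mult_right_mono) auto
    then show "0 \<le> ip x (app Q x)" using M[of x] by (simp add: Q_def ip_linear ip_p)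
  qed
  have QR: "Q * R = p" using R by (simp add: resolvent_def Q_def X_def)
  have step: "1 \<le> (l - M + \<epsilon>) * norm R" if \<epsilon>: "\<epsilon> > 0" for \<epsilon>
  proof -
    obtain x where x: "ip x (app X x) > (M - \<epsilon>) * (norm (app p x))\<^sup>2" using least[OF \<epsilon>] by blast
    define y where "y = app p x"
    have "y \<noteq> 0"
    proof
      assume "y = 0"
      then have "app X x = 0" by (simp add: X_def y_def app_linear)
      then show False using x \<open>y = 0\<close> ip_scaleR_right[of x 0 0] by (simp add: y_def)
    qed
    then have y0: "(norm y)\<^sup>2 > 0" by simp
    have py: "app p y = y" by (metis app_simps(5) p_idem y_def)
    have "ip y (app X y) = ip x (app (p * X * p) x)" using adj_p by (simp add: y_def adj_def)
    then have yX: "ip y (app X y) = ip x (app X x)" by (simp only: p_X X_p)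
    have Qy: "ip y (app Q y) \<le> (l - M + \<epsilon>) * (norm y)\<^sup>2"
    proof -
      have "ip y (app Q y) = l * (norm y)\<^sup>2 - ip x (app X x)"
        unfolding Q_def by (simp add: ip_linear py yX ip_self)
      then show ?thesis using x by (simp add: y_def algebra_simps)
    qed
    have QRy: "app Q (app R y) = y" using arg_cong[OF QR, of "\<lambda>T. app T y"] by (simp add: py)
    have "((norm y)\<^sup>2)\<^sup>2 \<le> ip y (app Q y) * ip (app R y) y"
      using psd_cauchy_schwarz[OF \<open>psd Q\<close>, of y "app R y"] by (simp add: QRy ip_self)
    also have "\<dots> \<le> ((l - M + \<epsilon>) * (norm y)\<^sup>2) * (norm R * (norm y)\<^sup>2)"
    proof (rule mult_mono[OF Qy])
      show "ip (app R y) y \<le> norm R * (norm y)\<^sup>2"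
        using ip_app_le[of y R] by (simp add: ip_commute[of "app R y" y])
      show "0 \<le> ip (app R y) y"
        using R by (simp add: resolvent_def psd_def ip_commute[of "app R y" y])
      show "0 \<le> (l - M + \<epsilon>) * (norm y)\<^sup>2" using l \<epsilon> by simp
    qed
    finally have "((norm y)\<^sup>2 * (norm y)\<^sup>2) * 1 \<le> ((norm y)\<^sup>2 * (norm y)\<^sup>2) * ((l - M + \<epsilon>) * norm R)"
      by (simp only: power2_eq_square[of "(norm y)\<^sup>2"] mult_ac mult_1)
    then show ?thesis using mult_le_cancel_left_pos[OF mult_pos_pos[OF y0 y0]] by blast
  qed
  show ?thesis
  proof (rule field_le_epsilon)
    fix \<epsilon> :: real assume "0 < \<epsilon>"
    define \<delta> where "\<delta> = \<epsilon> / (norm R + 1)"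
    have R1: "norm R + 1 > 0" by (simp add: add_nonneg_pos)
    have "\<delta> > 0" using \<open>0 < \<epsilon>\<close> R1 by (simp add: \<delta>_def)
    have "\<delta> * norm R \<le> \<delta> * (norm R + 1)" using \<open>\<delta> > 0\<close> by (intro mult_left_mono) auto
    also have "\<dots> = \<epsilon>" using R1 by (simp add: \<delta>_def)
    finally show "1 \<le> (l - M) * norm R + \<epsilon>"
      using step[OF \<open>\<delta> > 0\<close>] by (simp add: distrib_right)
  qed
qed

section \<open>Continuing the trace of the resolvent down to the bound\<close>

lemma lam_cont:
  assumes "\<And>i. i < k \<Longrightarrow> \<alpha> i < w"
  shows "isCont (lam :: real \<Rightarrow> real) w"
  using DERIV_isCont[OF has_field_derivative_F[OF regular_right(2)[OF assms]]]
  unfolding lam_def[abs_def] by (intro continuous_intros)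

text \<open>
  \<open>lam\<close> takes every value above the claimed bound at a point where it is increasing; the
  critical abscissa \<open>L + sqrt (var (1 - t) / t)\<close> is where the lower bound for \<open>lam'\<close> coming from
  \<open>right_bounds\<close> vanishes.
\<close>

lemma lam_preimage:
  assumes L: "\<And>i. i < k \<Longrightarrow> \<alpha> i \<le> L"
    and M: "M > t * L + 2 * sqrt var * sqrt (t * (1 - t)) + (1 - t) * mean"
  shows "\<exists>w. w > L + sqrt var * sqrt ((1 - t) / t) \<and> lam w = M"
proof -
  let ?c = "sqrt var * sqrt ((1 - t) / t)" and ?b = "t * L + 2 * sqrt var * sqrt (t * (1 - t)) + (1 - t) * mean"
  have c: "?c \<ge> 0" using var_nonneg t_pos t_le by simp
  have tc: "t * sqrt ((1 - t) / t) = sqrt (t * (1 - t))"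
  proof -
    have "t * sqrt ((1 - t) / t) = sqrt (t\<^sup>2) * sqrt ((1 - t) / t)" using t_pos by simp
    also have "\<dots> = sqrt (t * (1 - t))"
      unfolding real_sqrt_mult[symmetric] using t_pos by (simp add: power2_eq_square)
    finally show ?thesis .
  qed
  have lam: "lam w = t * w + (1 - t) * mean + (1 - t) * (w - mean - F w)" for w :: real
    by (simp add: lam_def algebra_simps)
  \<comment> \<open>Half the surplus of \<open>M\<close>: going \<open>\<epsilon>\<close> past the
    critical abscissa raises the estimate of \<open>lam\<close> by at most
    \<open>t * \<epsilon>\<close>.\<close>
  define \<epsilon> where "\<epsilon> = (M - ?b) / 2"
  have \<epsilon>: "\<epsilon> > 0" using M by (simp add: \<epsilon>_def)
  define w2 where "w2 = L + ?c + \<epsilon>"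
  have w2: "w2 > L + ?c" "w2 > L" using \<epsilon> c by (auto simp: w2_def)
  have "lam w2 \<le> M"
  proof -
    have "(1 - t) * (w2 - mean - F w2) \<le> (1 - t) * (var / (w2 - L))"
      using right_bounds(3)[OF L w2(2)] t_le by (intro mult_left_mono) auto
    also have "\<dots> \<le> sqrt var * sqrt (t * (1 - t))"
    proof -
      have "(1 - t) * var = sqrt var * sqrt (t * (1 - t)) * ?c"
      proof -
        have "sqrt (t * (1 - t)) * sqrt ((1 - t) / t) = sqrt ((1 - t)\<^sup>2)"
          unfolding real_sqrt_mult[symmetric] using t_pos by (simp add: power2_eq_square)
        then have "sqrt (t * (1 - t)) * sqrt ((1 - t) / t) = 1 - t" using t_le by simp
        moreover have "sqrt var * sqrt var = var" using var_nonneg by simp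
        ultimately show ?thesis by (metis mult.commute mult.left_commute)
      qed
      also have "\<dots> \<le> sqrt var * sqrt (t * (1 - t)) * (w2 - L)"
        using w2(1) var_nonneg t_pos t_le by (intro mult_left_mono) auto
      finally show ?thesis using w2(2) by (simp add: divide_le_eq)
    qed
    finally have "lam w2 \<le> t * w2 + (1 - t) * mean + sqrt var * sqrt (t * (1 - t))"
      unfolding lam by simp
    also have "t * w2 = t * L + sqrt var * sqrt (t * (1 - t)) + t * \<epsilon>"
      unfolding w2_def by (simp add: distrib_left mult.left_commute[of t] tc)
    also have "t * L + sqrt var * sqrt (t * (1 - t)) + t * \<epsilon> + (1 - t) * mean + sqrt var * sqrt (t * (1 - t)) = ?b + t * \<epsilon>"
      by simp
    also have "\<dots> \<le> ?b + \<epsilon>" using t_le \<epsilon> by simp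
    also have "\<dots> \<le> M" using M by (simp add: \<epsilon>_def field_simps)
    finally show ?thesis .
  qed
  \<comment> \<open>Far enough right that \<open>t * w + (1 - t) * mean\<close> alone reaches
    \<open>M\<close>; the remaining term of \<open>lam\<close> is nonnegative by
    \<open>right_bounds\<close>.\<close>
  define w3 where "w3 = max w2 ((M - (1 - t) * mean) / t)"
  have w3: "w3 \<ge> w2" "w3 > L" using w2 by (auto simp: w3_def)
  have "M \<le> lam w3"
  proof -
    have "M - (1 - t) * mean \<le> t * w3"
      using t_pos mult_left_mono[of "(M - (1 - t) * mean) / t" w3 t] by (simp add: w3_def)
    moreover have "0 \<le> (1 - t) * (w3 - mean - F w3)"
      using right_bounds(2)[OF L w3(2)] t_le by (intro mult_nonneg_nonneg) auto
    ultimately show ?thesis unfolding lam by linarith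
  qed
  have "isCont (lam :: real \<Rightarrow> real) w" if "w2 \<le> w" for w
  proof (rule lam_cont)
    fix i assume "i < k"
    then show "\<alpha> i < w" using L[of i] that w2 by linarith
  qed
  then obtain w where "w2 \<le> w" "w \<le> w3" "lam w = M"
    using IVT[of lam w2 M w3] \<open>lam w2 \<le> M\<close> \<open>M \<le> lam w3\<close> w3(1) by blast
  then show ?thesis using w2(1) by (intro exI[of _ w]) auto
qed

text \<open>By \<open>right_bounds\<close>, \<open>\<kappa> w\<close> is at most
  \<open>var / (w - L)^2\<close>, and beyond this abscissa \<open>(w - L)^2\<close> exceeds
  \<open>var * (1 - t) / t\<close>.\<close>

lemma \<kappa>_critical:
  assumes L: "\<And>i. i < k \<Longrightarrow> \<alpha> i \<le> L" and w: "w > L + sqrt var * sqrt ((1 - t) / t)"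
  shows "\<kappa> w * ((1 - t) / t) < 1"
proof -
  let ?s = "(1 - t) / t"
  have s: "?s \<ge> 0" using t_pos t_le by simp
  have c: "sqrt var * sqrt ?s \<ge> 0" using var_nonneg s by simp
  have wL: "w > L" using w c by linarith
  have "(sqrt var * sqrt ?s)\<^sup>2 < (w - L)\<^sup>2" using w c by (intro power_strict_mono) auto
  then have 1: "var * ?s < (w - L)\<^sup>2" using var_nonneg s by (simp add: power_mult_distrib)
  have "(w - L)\<^sup>2 * (\<kappa> w * ?s) \<le> var * ?s"
    using mult_right_mono[OF right_bounds(4)[OF L wL] s] by (simp add: mult.assoc)
  also note 1
  finally have "(w - L)\<^sup>2 * (\<kappa> w * ?s) < (w - L)\<^sup>2 * 1" by simp
  then show ?thesis using wL by (simp only: mult_less_cancel_left_pos zero_less_power diff_gt_0_iff_gt)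
qed

text \<open>
  If the supremum \<open>M\<close> of the quadratic form of \<open>X\<close> were above the bound, the local inverse of \<open>lam\<close>
  at \<open>M\<close> would continue the trace of the resolvent analytically past \<open>M\<close>. Expanding around a point
  \<open>l > M\<close> then bounds the moments of the resolvent at \<open>l\<close>, hence its norm, by less than
  \<open>1 / (l - M)\<close>.
\<close>

lemma quadratic_form_le:
  assumes L: "\<And>i. i < k \<Longrightarrow> \<alpha> i \<le> L"
  shows "ip x (app X x) \<le> (t * L + 2 * sqrt var * sqrt (t * (1 - t)) + (1 - t) * mean) * (norm (app p x))\<^sup>2"
proof -
  let ?b = "t * L + 2 * sqrt var * sqrt (t * (1 - t)) + (1 - t) * mean"
  let ?c = "L + sqrt var * sqrt ((1 - t) / t)"
  define Bd where "Bd = {M. \<forall>x. ip x (app X x) \<le> M * (norm (app p x))\<^sup>2}"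
  have "p \<noteq> 0" using \<phi>_p t_pos \<phi>_zero by auto
  then obtain x0 where "app p x0 \<noteq> 0" using bop_eqI[of p 0] by auto
  then have x0: "(norm (app p x0))\<^sup>2 > 0" by simp
  have lower: "- norm a \<le> M" if "M \<in> Bd" for M
  proof -
    have "- norm a * (norm (app p x0))\<^sup>2 \<le> M * (norm (app p x0))\<^sup>2"
      using that ip_X_le[of x0] by (auto simp: Bd_def dest: spec[of _ x0])
    then show ?thesis using x0 by (simp only: mult_le_cancel_right_pos)
  qed
  have ne: "norm a \<in> Bd" using ip_X_le by (simp add: Bd_def abs_le_iff)
  \<comment> \<open>The supremum of the form of \<open>X\<close> relative to that of
    \<open>p\<close>, taken as the least admissible bound.\<close>
  define M where "M = Inf Bd"
  have bdd: "bdd_below Bd" by (rule bdd_belowI[of _ "- norm a"]) (rule lower)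
  have M: "ip x (app X x) \<le> M * (norm (app p x))\<^sup>2" for x
  proof (cases "app p x = 0")
    case True
    then show ?thesis using ip_X_le[of x] by simp
  next
    case False
    then have pos: "(norm (app p x))\<^sup>2 > 0" by simp
    have "ip x (app X x) / (norm (app p x))\<^sup>2 \<le> M"
      unfolding M_def using ne pos by (intro cInf_greatest) (auto simp: Bd_def divide_le_eq)
    then show ?thesis using pos by (simp add: divide_le_eq)
  qed
  have least: "\<exists>x. ip x (app X x) > (M - \<epsilon>) * (norm (app p x))\<^sup>2" if "\<epsilon> > 0" for \<epsilon>
  proof (rule ccontr)
    assume "\<not> ?thesis"
    then have "M - \<epsilon> \<in> Bd" by (auto simp: Bd_def not_less)
    then have "M \<le> M - \<epsilon>" unfolding M_def using bdd by (intro cInf_lower)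
    then show False using that by simp
  qed
  have "M \<le> ?b"
  proof (rule ccontr)
    assume "\<not> M \<le> ?b"
    then obtain w1 where w1: "w1 > ?c" "lam w1 = M" using lam_preimage[OF L, of M] by auto
    have cL: "?c \<ge> L" using var_nonneg t_pos t_le by simp
    define S where "S = {w. Re w > ?c}"
    have oS: "open S" unfolding S_def by (rule open_halfspace_Re_gt)
    have reg: "regular w" if "w \<in> S" for w
    proof (rule regular_of_Re)
      fix i assume "i < k"
      then show "\<alpha> i < Re w" using L[of i] that cL by (simp add: S_def)
    qed
    have dF: "(F has_field_derivative 1 + avg (\<lambda>i. (dev w i)\<^sup>2)) (at w)" if "w \<in> S" for w
      using reg[OF that] by (rule has_field_derivative_F)
    have dlam: "(lam has_field_derivative 1 - complex_of_real (1 - t) * (1 + avg (\<lambda>i. (dev w i)\<^sup>2))) (at w)"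
      if "w \<in> S" for w
      unfolding lam_def[abs_def] by (intro DERIV_diff DERIV_ident DERIV_cmult dF that)
    have hol: "lam holomorphic_on S"
      using dlam oS by (auto simp: holomorphic_on_open)
    have holG: "G holomorphic_on S"
      using has_field_derivative_G reg oS unfolding regular_def by (fastforce simp: holomorphic_on_open)
    define z1 where "z1 = complex_of_real w1"
    have z1: "z1 \<in> S" using w1 by (simp add: S_def z1_def)
    have "deriv lam z1 \<noteq> 0"
    proof -
      have "dev z1 i = complex_of_real (dev w1 i)" for i by (simp add: dev_def z1_def F_of_real)
      then have "avg (\<lambda>i. (dev z1 i)\<^sup>2) = avg (\<lambda>i. complex_of_real ((dev w1 i)\<^sup>2))" by simp
      also have "\<dots> = complex_of_real (\<kappa> w1)" unfolding avg_of_real by (simp add: \<kappa>_def)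
      finally have "deriv lam z1 = complex_of_real (1 - (1 - t) * (1 + \<kappa> w1))"
        using DERIV_imp_deriv[OF dlam[OF z1]] by simp
      moreover have "(1 - t) * (1 + \<kappa> w1) < 1"
        using \<kappa>_critical[OF L w1(1)] t_pos by (simp add: field_simps)
      ultimately show ?thesis by (simp only: of_real_eq_0_iff)
    qed
    from has_complex_derivative_locally_injective[OF hol z1 oS this] obtain r
      where r: "r > 0" "ball z1 r \<subseteq> S" "inj_on lam (ball z1 r)" by blast
    have holr: "lam holomorphic_on ball z1 r" using hol r(2) by (rule holomorphic_on_subset)
    obtain g where g: "g holomorphic_on (lam ` ball z1 r)" "\<And>w. w \<in> ball z1 r \<Longrightarrow> g (lam w) = w"
      using holomorphic_has_inverse[OF holr open_ball r(3)] by metis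
    have lam_real: "lam (complex_of_real w) = complex_of_real (lam w)" for w
      by (simp add: lam_def F_of_real)
    have oU: "open (lam ` ball z1 r)" by (rule open_mapping_thm3[OF holr open_ball r(3)])
    have "complex_of_real M \<in> lam ` ball z1 r"
      using r(1) by (intro image_eqI[of _ _ z1]) (simp_all add: z1_def lam_real w1(2))
    then obtain \<rho>0 where \<rho>0: "\<rho>0 > 0" "ball (complex_of_real M) \<rho>0 \<subseteq> lam ` ball z1 r"
      using oU by (meson open_contains_ball)
    \<comment> \<open>The disc of radius \<open>\<rho>\<close> about
      \<open>l = M + \<rho> / 2\<close> reaches at most \<open>3 * \<rho> / 2\<close> from
      \<open>M\<close>, well inside \<open>\<rho>0 = 3 * \<rho>\<close>, and it contains points
      below \<open>M\<close>.\<close>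
    define \<rho> where "\<rho> = \<rho>0 / 3"
    have \<rho>: "\<rho> > 0" using \<rho>0 by (simp add: \<rho>_def)
    define h where "h z = G (g z)" for z
    have holh: "h holomorphic_on lam ` ball z1 r"
      unfolding h_def using g r(2)
      by (intro holomorphic_on_compose_gen[OF _ holG, unfolded o_def]) auto
    \<comment> \<open>\<open>lam\<close> commutes with conjugation and is injective on a disc with
      real centre, so the preimage of a real point is real and \<open>\<phi>_resolvent\<close>
      applies to it.\<close>
    have hval: "h (complex_of_real l) = complex_of_real (\<phi> R)"
      if l: "\<bar>l - M\<bar> < 3 * \<rho>" and R: "resolvent l R" for l R
    proof -
      have "complex_of_real l \<in> ball (complex_of_real M) \<rho>0"
        using l by (simp add: \<rho>_def dist_real_def abs_minus_commute)
      then obtain w where w: "w \<in> ball z1 r" "lam w = complex_of_real l" using \<rho>0(2) by (metis imageE subsetD)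
      have "cnj w \<in> ball z1 r"
        using w(1) complex_mod_cnj[of "z1 - w"] by (simp add: z1_def dist_norm)
      moreover have "lam (cnj w) = lam w"
      proof -
        have "lam (cnj w) = cnj (lam w)" by (simp add: lam_def F_def cnj_G)
        then show ?thesis by (simp add: w(2))
      qed
      ultimately have "cnj w = w" using r(3) w(1) by (metis inj_onD)
      then have wr: "w = complex_of_real (Re w)" by (metis Reals_cnj_iff of_real_Re)
      have wc: "Re w > ?c" using w(1) r(2) by (auto simp: S_def)
      have "lam (Re w) = l" using w(2) wr lam_real by (metis of_real_eq_iff)
      then have "resolvent (lam (Re w)) R" using R by simp
      moreover have "regular (Re w)"
      proof (rule regular_right(2))
        fix i assume "i < k"
        then show "\<alpha> i < Re w" using L[of i] wc cL by linarith
      qed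
      ultimately have "\<phi> R = G (Re w)" using \<kappa>_critical[OF L wc] by (intro \<phi>_resolvent)
      moreover have "h (complex_of_real l) = G w" unfolding h_def w(2)[symmetric] g(2)[OF w(1)] ..
      ultimately show ?thesis using wr G_of_real by metis
    qed
    define l where "l = M + \<rho> / 2"
    have lM: "M < l" using \<rho> by (simp add: l_def)
    obtain R where R: "resolvent l R" using exists_resolvent[OF M lM] by blast
    have RA: "R \<in> \<A>" "psd R" using R by (auto simp: resolvent_def)
    let ?l = "complex_of_real l"
    have sub: "cball ?l \<rho> \<subseteq> lam ` ball z1 r"
    proof -
      have "cball ?l \<rho> \<subseteq> ball (complex_of_real M) \<rho>0"
      proof
        fix z assume "z \<in> cball ?l \<rho>"
        then have "dist (complex_of_real M) z \<le> \<rho> / 2 + \<rho>"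
        proof -
          have "dist (complex_of_real M) ?l = dist M l" by (rule dist_of_real)
          also have "\<dots> = \<rho> / 2" using \<rho> by (simp add: l_def dist_real_def)
          finally show ?thesis
            using dist_triangle[of "complex_of_real M" z ?l] \<open>z \<in> cball ?l \<rho>\<close> by simp
        qed
        then show "z \<in> ball (complex_of_real M) \<rho>0" using \<rho> by (simp add: \<rho>_def)
      qed
      then show ?thesis using \<rho>0(2) by blast
    qed
    have conth: "continuous_on (cball ?l \<rho>) h"
      using holh sub by (meson continuous_on_subset holomorphic_on_imp_continuous_on)
    have holb: "h holomorphic_on ball ?l \<rho>"
      using holh sub ball_subset_cball by (meson holomorphic_on_subset)
    have "bounded (h ` cball ?l \<rho>)"
      using compact_continuous_image[OF conth compact_cball] by (rule compact_imp_bounded)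
    then obtain B where B: "\<forall>z\<in>cball ?l \<rho>. cmod (h z) \<le> B"
      unfolding bounded_iff by blast
    define c where "c n = (deriv ^^ n) h ?l / fact n" for n
    have c: "cmod (c n) \<le> B / \<rho> ^ n" for n
    proof -
      have "cmod ((deriv ^^ n) h ?l) \<le> fact n * B / \<rho> ^ n"
        using B by (intro Cauchy_inequality[OF holb conth \<rho>]) (simp add: dist_norm)
      then show ?thesis by (simp add: c_def norm_divide divide_le_eq mult.commute)
    qed
    define \<delta> where "\<delta> = min (\<rho> / 2) (1 / (norm R + 1))"
    have R1: "norm R + 1 > 0" by (simp add: add_nonneg_pos)
    have \<delta>: "\<delta> > 0" using \<rho> R1 by (simp add: \<delta>_def)
    \<comment> \<open>Both sides are Taylor coefficients, in \<open>d\<close>, of the trace of the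
      resolvent at \<open>l - d\<close>: one from the operator expansion, one from \<open>h\<close>.
      The sign comes from expanding in \<open>- d\<close>.\<close>
    have coeff: "\<phi> (R ^ Suc n) = Re (c n * (-1) ^ n)" for n
    proof (rule real_powser_unique[OF \<delta>, where a = "\<lambda>n. \<phi> (R ^ Suc n)"])
      fix d :: real assume d: "\<bar>d\<bar> < \<delta>"
      have dR: "\<bar>d\<bar> * norm R < 1"
      proof -
        have "\<bar>d\<bar> * norm R \<le> \<bar>d\<bar> * (norm R + 1)" by (intro mult_left_mono) auto
        also have "\<dots> < 1" using d R1 by (simp add: \<delta>_def pos_less_divide_eq)
        finally show ?thesis .
      qed
      have d2: "\<bar>d\<bar> < \<rho> / 2" using d by (simp add: \<delta>_def)
      then have "M < l - d" by (simp add: l_def)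
      then obtain R' where R': "resolvent (l - d) R'" using exists_resolvent[OF M] by blast
      have "(\<lambda>n. \<phi> (R ^ Suc n) * d ^ n) sums \<phi> R'" by (rule resolvent_series[OF R R' dR])
      moreover have "(\<lambda>n. Re (c n * (-1) ^ n) * d ^ n) sums \<phi> R'"
      proof -
        have "complex_of_real (l - d) \<in> ball ?l \<rho>" using d2 \<rho> by (simp add: dist_norm)
        from holomorphic_power_series[OF holb this]
        have "(\<lambda>n. c n * (complex_of_real (l - d) - ?l) ^ n) sums h (complex_of_real (l - d))" by (simp add: c_def)
        moreover have "\<bar>l - d - M\<bar> < 3 * \<rho>" using d2 by (simp add: l_def)
        ultimately have "(\<lambda>n. c n * (complex_of_real (l - d) - ?l) ^ n) sums complex_of_real (\<phi> R')"
          using hval[OF _ R'] by simp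
        from sums_Re[OF this] have "(\<lambda>n. Re (c n * (complex_of_real (l - d) - ?l) ^ n)) sums \<phi> R'" by simp
        moreover have "c n * (complex_of_real (l - d) - ?l) ^ n = c n * (-1) ^ n * complex_of_real (d ^ n)" for n
        proof -
          have "complex_of_real (l - d) - ?l = (-1) * complex_of_real d" by simp
          then show ?thesis by (simp only: power_mult_distrib of_real_power mult.assoc)
        qed
        moreover have "Re (c n * (-1) ^ n * complex_of_real (d ^ n)) = Re (c n * (-1) ^ n) * d ^ n" for n
          by (simp del: of_real_power)
        ultimately show ?thesis by (simp only:)
      qed
      ultimately show "\<exists>s. (\<lambda>n. \<phi> (R ^ Suc n) * d ^ n) sums s \<and> (\<lambda>n. Re (c n * (-1) ^ n) * d ^ n) sums s" by blast
    qed
    \<comment> \<open>The moments inherit the Cauchy estimates on the disc of radius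
      \<open>\<rho>\<close>. Since \<open>l - M = \<rho> / 2\<close>, the lower bound for the norm
      then reads \<open>1 \<le> 1 / 2\<close>.\<close>
    have "norm R \<le> 1 / \<rho>"
    proof (rule norm_le_of_moments[OF RA])
      show "0 \<le> 1 / \<rho>" using \<rho> by simp
      show "\<phi> (R ^ Suc n) \<le> B * (1 / \<rho>) ^ n" for n
      proof -
        have "\<phi> (R ^ Suc n) \<le> cmod (c n * (-1) ^ n)" unfolding coeff by (rule complex_Re_le_cmod)
        also have "\<dots> = cmod (c n)" by (simp add: norm_mult norm_power)
        also have "\<dots> \<le> B * (1 / \<rho>) ^ n" using c[of n] by (simp add: power_divide)
        finally show ?thesis .
      qed
    qed
    moreover have "1 \<le> (l - M) * norm R" by (rule norm_resolvent_ge[OF M least lM R])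
    ultimately have "1 \<le> \<rho> / 2 * (1 / \<rho>)"
      using mult_left_mono[of "norm R" "1 / \<rho>" "\<rho> / 2"] \<rho> by (simp add: l_def)
    then show False using \<rho> by simp
  qed
  then have "M * (norm (app p x))\<^sup>2 \<le> ?b * (norm (app p x))\<^sup>2" by (intro mult_right_mono) auto
  then show ?thesis using M[of x] by linarith
qed

end

section \<open>From von Neumann algebras to tracial algebras\<close>

lemma Bop_add: "Bop (T + U) = Bop T + Bop U"
  by (simp add: plus_bop.rep_eq Bop_inverse flip: blinfun_of_inject)

lemma Bop_mult: "Bop (T o\<^sub>L U) = Bop T * Bop U"
  by (simp add: times_bop.rep_eq Bop_inverse flip: blinfun_of_inject)

lemma Bop_scaleR: "Bop (r *\<^sub>R T) = r *\<^sub>R Bop T"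
  by (simp add: scaleR_bop.rep_eq Bop_inverse flip: blinfun_of_inject)

lemma Bop_id: "Bop id_blinfun = 1"
  by (simp add: one_bop.rep_eq Bop_inverse flip: blinfun_of_inject)

lemma Bop_zero: "Bop 0 = 0"
  by (simp add: zero_bop.rep_eq Bop_inverse flip: blinfun_of_inject)

lemma Bop_sum: "Bop (sum f I) = (\<Sum>i\<in>I. Bop (f i))"
  by (induction I rule: infinite_finite_induct) (auto simp: Bop_zero Bop_add)

lemma app_Bop: "app (Bop T) x = blinfun_apply T x"
  by (simp add: app_def Bop_inverse)

lemma scalar_op_of_real: "scalar_op (complex_of_real r) o\<^sub>L T = r *\<^sub>R T"
  by (rule blinfun_eqI) (simp add: scalar_op_apply scaleC_of_real blinfun.bilinear_simps)

lemma adj_if_is_adjoint: "is_adjoint T S \<Longrightarrow> adj (Bop T) (Bop S)"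
  by (simp add: is_adjoint_def adj_def ip_def app_Bop)

text \<open>A complex inner product is determined by its real part through \<open>Im z = - Re (\<i> z)\<close>.\<close>

lemma is_adjoint_if_adj:
  assumes "adj (Bop T) (Bop S)" "S \<in> bounded_ops"
  shows "is_adjoint T S"
  unfolding is_adjoint_def
proof (intro allI complex_eqI)
  have re: "Re (cinner (T x) y) = Re (cinner x (S y))" for x y
    using assms(1) by (simp add: adj_def ip_def app_Bop)
  fix x y
  show "Re (cinner (T x) y) = Re (cinner x (S y))" by (rule re)
  have "S (scaleC \<i> y) = scaleC \<i> (S y)" using assms(2) by (simp add: bounded_ops_def)
  then show "Im (cinner (T x) y) = Im (cinner x (S y))"
    using re[of x "scaleC \<i> y"] by (simp add: cinner_scaleC_right)
qed

lemma commutant_iff: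
  "T \<in> commutant S \<longleftrightarrow> (\<forall>c x. T (scaleC c x) = scaleC c (T x)) \<and> (\<forall>U\<in>S. \<forall>x. T (U x) = U (T x))"
proof -
  have "T o\<^sub>L U = U o\<^sub>L T \<longleftrightarrow> (\<forall>x. T (U x) = U (T x))" for U
    by (metis blinfun_eqI blinfun_apply_blinfun_compose)
  then show ?thesis by (simp add: commutant_def bounded_ops_def)
qed

lemma commutant_add: "T \<in> commutant S \<Longrightarrow> U \<in> commutant S \<Longrightarrow> T + U \<in> commutant S"
  unfolding commutant_iff by (simp add: blinfun.bilinear_simps scaleC_add_right)

lemma commutant_mult: "T \<in> commutant S \<Longrightarrow> U \<in> commutant S \<Longrightarrow> T o\<^sub>L U \<in> commutant S"
  unfolding commutant_iff by simp

lemma scaleC_commute: "scaleC c (scaleC d x) = scaleC d (scaleC c (x::'h::chilbert_space))"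
  by (simp add: scaleC_scaleC mult.commute)

lemma scalar_op_commutant:
  assumes "S \<subseteq> bounded_ops"
  shows "scalar_op c \<in> commutant S"
  using assms unfolding commutant_iff bounded_ops_def by (auto simp: scalar_op_apply scaleC_commute)

lemma tracial_algebra_of_vna:
  fixes A :: "'h::chilbert_space op set"
  assumes vn: "von_neumann_algebra A" and tr: "tracial_state A \<tau>" and ff: "faithful_on A \<tau>"
  defines "\<A> \<equiv> {T. blinfun_of T \<in> A}" and "\<phi> \<equiv> \<lambda>T. Re (\<tau> (blinfun_of T))"
  shows "tracial_algebra \<A> \<phi>" "\<And>T. T \<in> \<A> \<Longrightarrow> adj T T \<Longrightarrow> Im (\<tau> (blinfun_of T)) = 0"
proof -
  have Ab: "A \<subseteq> bounded_ops" and cc: "commutant (commutant A) = A"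
    using vn by (auto simp: von_neumann_algebra_def)
  have add: "T + U \<in> A" and mult: "T o\<^sub>L U \<in> A" if "T \<in> A" "U \<in> A" for T U
    using commutant_add[of T "commutant A" U] commutant_mult[of T "commutant A" U] that by (simp_all add: cc)
  have "commutant A \<subseteq> bounded_ops" by (auto simp: commutant_def)
  then have scal: "scalar_op c \<in> A" for c using scalar_op_commutant[of "commutant A" c] by (simp add: cc)
  have id: "id_blinfun \<in> A"
  proof -
    have "scalar_op (complex_of_real 1) o\<^sub>L id_blinfun = (id_blinfun :: 'h op)"
      unfolding scalar_op_of_real by simp
    moreover have "scalar_op (complex_of_real 1) o\<^sub>L id_blinfun = (scalar_op (complex_of_real 1) :: 'h op)"
      by (rule blinfun_eqI) simp
    ultimately show ?thesis using scal[of "complex_of_real 1"] by simp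
  qed
  have scaleR: "r *\<^sub>R T \<in> A" if "T \<in> A" for r T
    using mult[OF scal that, of "complex_of_real r"] by (simp add: scalar_op_of_real)
  have \<tau>add: "\<tau> (T + U) = \<tau> T + \<tau> U" and \<tau>comm: "\<tau> (T o\<^sub>L U) = \<tau> (U o\<^sub>L T)" if "T \<in> A" "U \<in> A" for T U
    using tr that by (auto simp: tracial_state_def)
  have \<tau>scal: "\<tau> (scalar_op c o\<^sub>L T) = c * \<tau> T" if "T \<in> A" for T c
    using tr that by (auto simp: tracial_state_def)
  have \<tau>scaleR: "\<tau> (r *\<^sub>R T) = complex_of_real r * \<tau> T" if "T \<in> A" for T r
    using \<tau>scal[OF that, of "complex_of_real r"] by (simp add: scalar_op_of_real)
  have \<tau>pos: "0 \<le> Re (\<tau> (S o\<^sub>L T))" "Im (\<tau> (S o\<^sub>L T)) = 0" if "T \<in> A" "S \<in> A" "is_adjoint T S" for T S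
    using tr that by (auto simp: tracial_state_def complex_nonneg_Reals_iff)
  have \<tau>id: "\<tau> id_blinfun = 1" using tr by (simp add: tracial_state_def)
  have isadj: "is_adjoint (blinfun_of T) (blinfun_of S)" if "adj T S" "S \<in> \<A>" for T S
    using that Ab by (intro is_adjoint_if_adj) (auto simp: blinfun_of_inverse \<A>_def)
  have \<tau>poly: "\<tau> ((id_blinfun + (scalar_op c o\<^sub>L S)) o\<^sub>L (id_blinfun + (scalar_op d o\<^sub>L T)))
      = 1 + d * \<tau> T + c * \<tau> S + c * d * \<tau> (S o\<^sub>L T)" if "T \<in> A" "S \<in> A" for T S c d
  proof -
    have "(id_blinfun + (scalar_op c o\<^sub>L S)) o\<^sub>L (id_blinfun + (scalar_op d o\<^sub>L T))
        = ((id_blinfun + (scalar_op d o\<^sub>L T)) + (scalar_op c o\<^sub>L S)) + (scalar_op c o\<^sub>L (scalar_op d o\<^sub>L (S o\<^sub>L T)))"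
    proof (rule blinfun_eqI)
      fix x
      have "S (scaleC d (T x)) = scaleC d (S (T x))" using that(2) Ab by (auto simp: bounded_ops_def)
      then show "((id_blinfun + (scalar_op c o\<^sub>L S)) o\<^sub>L (id_blinfun + (scalar_op d o\<^sub>L T))) x
          = (((id_blinfun + (scalar_op d o\<^sub>L T)) + (scalar_op c o\<^sub>L S)) + (scalar_op c o\<^sub>L (scalar_op d o\<^sub>L (S o\<^sub>L T)))) x"
        by (simp add: blinfun.bilinear_simps scalar_op_apply scaleC_add_right)
    qed
    then show ?thesis
      using that by (simp add: \<tau>add \<tau>scal \<tau>id add mult scal id)
  qed
  \<comment> \<open>That \<open>\<tau>\<close> respects adjoints is derived from positivity:
    \<open>\<tau>\<close> is real on \<open>(1 + d T)* (1 + d T)\<close>. The value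
    \<open>d = 1\<close> handles imaginary parts, \<open>d = \<i>\<close> real parts.\<close>
  have im_sum: "Im (d * \<tau> T + cnj d * \<tau> S) = 0" if "T \<in> A" "S \<in> A" "is_adjoint T S" for T S d
  proof -
    let ?T = "id_blinfun + (scalar_op d o\<^sub>L T)" and ?S = "id_blinfun + (scalar_op (cnj d) o\<^sub>L S)"
    have "is_adjoint ?T ?S"
      unfolding is_adjoint_def
    proof (intro allI)
      fix x y
      have left_add: "cinner (u + v) y = cinner u y + cinner v y" for u v y :: 'h
        by (metis cinner_add_right cinner_commute complex_cnj_add)
      have left_scale: "cinner (scaleC d u) y = cnj d * cinner u y" for u y :: 'h
        by (metis cinner_commute cinner_scaleC_right complex_cnj_mult)
      show "cinner (?T x) y = cinner x (?S y)"
        using that(3) by (simp add: blinfun.bilinear_simps scalar_op_apply left_add left_scale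
            cinner_add_right cinner_scaleC_right is_adjoint_def)
    qed
    then have "Im (\<tau> (?S o\<^sub>L ?T)) = 0" using that by (intro \<tau>pos add mult scal id)
    then have 1: "Im (1 + d * \<tau> T + cnj d * \<tau> S + cnj d * d * \<tau> (S o\<^sub>L T)) = 0"
      unfolding \<tau>poly[OF that(1,2)] .
    have Im_real: "Im (complex_of_real r * z) = r * Im z" for r z by simp
    have "cnj d * d = complex_of_real ((cmod d)\<^sup>2)" by (metis complex_norm_square mult.commute)
    then have "Im (cnj d * d * \<tau> (S o\<^sub>L T)) = 0" by (simp only: Im_real \<tau>pos(2)[OF that] mult_zero_right)
    with 1 show ?thesis by (simp only: plus_complex.sel one_complex.sel)
  qed
  show imz: "Im (\<tau> (blinfun_of T)) = 0" if "T \<in> \<A>" "adj T T" for T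
    using im_sum[of "blinfun_of T" "blinfun_of T" 1] that isadj[OF that(2,1)] by (simp add: \<A>_def)
  show "tracial_algebra \<A> \<phi>"
  proof
    fix T U :: "'h bop" and r :: real
    show "T + U \<in> \<A>" "T * U \<in> \<A>" "\<phi> (T + U) = \<phi> T + \<phi> U" "\<phi> (T * U) = \<phi> (U * T)"
      if "T \<in> \<A>" "U \<in> \<A>"
      using that by (auto simp: \<A>_def \<phi>_def plus_bop.rep_eq times_bop.rep_eq add mult \<tau>add intro: \<tau>comm arg_cong[of _ _ Re])
    show "r *\<^sub>R T \<in> \<A>" "\<phi> (r *\<^sub>R T) = r * \<phi> T" if "T \<in> \<A>"
      using that by (auto simp: \<A>_def \<phi>_def scaleR_bop.rep_eq scaleR \<tau>scaleR)
    show "1 \<in> \<A>" "\<phi> 1 = 1" by (auto simp: \<A>_def \<phi>_def one_bop.rep_eq id \<tau>id)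
    show "0 \<le> \<phi> (U * T)" if "T \<in> \<A>" "U \<in> \<A>" "adj T U"
      using that \<tau>pos(1)[of "blinfun_of T" "blinfun_of U"] isadj[of T U] by (simp add: \<A>_def \<phi>_def times_bop.rep_eq)
    show "\<phi> U = \<phi> T" if "T \<in> \<A>" "U \<in> \<A>" "adj T U"
      using im_sum[of "blinfun_of T" "blinfun_of U" \<i>] that isadj[of T U] by (simp add: \<A>_def \<phi>_def)
    show "T = 0" if "T \<in> \<A>" "adj T T" "\<phi> (T * T) = 0"
    proof -
      have a: "is_adjoint (blinfun_of T) (blinfun_of T)" "blinfun_of T \<in> A"
        using that isadj[of T T] by (auto simp: \<A>_def)
      then have "\<tau> (blinfun_of T o\<^sub>L blinfun_of T) = 0"
        using \<tau>pos(2)[OF a(2) a(2) a(1)] that(3) by (simp add: \<phi>_def times_bop.rep_eq complex_eq_iff)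
      then have "blinfun_of T = 0" using ff a by (auto simp: faithful_on_def)
      then show ?thesis by (metis blinfun_of_inject zero_bop.rep_eq)
    qed
    \<comment> \<open>Complex scalars commute with \<open>T\<close>, hence with \<open>V\<close>, so
      \<open>V\<close> is complex linear; the commutant of \<open>A\<close> then places it in the
      bicommutant.\<close>
    show "V \<in> \<A>" if T: "T \<in> \<A>" and V: "\<And>U. U * T = T * U \<Longrightarrow> U * V = V * U" for V
    proof -
      have c: "W o\<^sub>L blinfun_of V = blinfun_of V o\<^sub>L W" if "W o\<^sub>L blinfun_of T = blinfun_of T o\<^sub>L W" for W
        using V[of "Bop W"] that by (simp add: times_bop.rep_eq Bop_inverse flip: blinfun_of_inject)
      have Tb: "blinfun_of T \<in> bounded_ops" using T Ab by (auto simp: \<A>_def)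
      have "blinfun_of V \<in> bounded_ops"
        unfolding bounded_ops_def
      proof (intro CollectI allI)
        fix d x
        have "scalar_op d o\<^sub>L blinfun_of V = blinfun_of V o\<^sub>L scalar_op d"
          using Tb by (intro c blinfun_eqI) (simp add: scalar_op_apply bounded_ops_def)
        then show "blinfun_of V (scaleC d x) = scaleC d (blinfun_of V x)"
          by (metis blinfun_apply_blinfun_compose scalar_op_apply)
      qed
      moreover have "blinfun_of V o\<^sub>L W = W o\<^sub>L blinfun_of V" if "W \<in> commutant A" for W
        using c[of W] that T by (auto simp: commutant_def \<A>_def)
      ultimately have "blinfun_of V \<in> commutant (commutant A)" by (simp add: commutant_def[of "commutant A"])
      then show ?thesis by (simp add: cc \<A>_def)
    qed
  qed
qed

section \<open>Transfer of freeness and of the norm bound\<close>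

lemma hull_diag: "(\<Sum>i<k. c i *\<^sub>R e i) \<in> star_subalgebra hull (diag_algebra k e)"
proof (rule hull_inc)
  have "(\<Sum>i<k. c i *\<^sub>R e i) = (\<Sum>i<k. scalar_op (complex_of_real (c i)) o\<^sub>L e i)"
    by (simp add: scalar_op_of_real)
  then show "(\<Sum>i<k. c i *\<^sub>R e i) \<in> diag_algebra k e" by (auto simp: diag_algebra_def)
qed

lemma hull_affine: "r *\<^sub>R id_blinfun + s *\<^sub>R q \<in> star_subalgebra hull {q :: 'h::chilbert_space op}"
  unfolding hull_def
proof (intro InterI)
  fix B assume "B \<in> {B. star_subalgebra B \<and> {q} \<subseteq> B}"
  then have B: "star_subalgebra B" "q \<in> B" by auto
  then have sc: "scalar_op c \<in> B" for c by (auto simp: star_subalgebra_def)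
  have "r *\<^sub>R id_blinfun = (scalar_op (complex_of_real r) :: 'h op)"
    by (rule blinfun_eqI) (simp add: scalar_op_apply scaleC_of_real blinfun.bilinear_simps)
  then have "r *\<^sub>R id_blinfun \<in> B" using sc by simp
  moreover have "s *\<^sub>R q \<in> B"
    unfolding scalar_op_of_real[symmetric] using B sc by (auto simp: star_subalgebra_def)
  ultimately show "r *\<^sub>R id_blinfun + s *\<^sub>R q \<in> B" using B(1) by (auto simp: star_subalgebra_def)
qed

lemma blinfun_of_prod_list:
  "blinfun_of (prod_list (map snd xs)) = foldr (\<lambda>i T. blinfun_of (snd (xs ! i)) o\<^sub>L T) [0..<length xs] id_blinfun"
proof -
  have "blinfun_of (prod_list (map snd xs)) = foldr (\<lambda>y T. blinfun_of (snd y) o\<^sub>L T) xs id_blinfun"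
    by (induction xs) (auto simp: one_bop.rep_eq times_bop.rep_eq)
  also have "\<dots> = foldr (\<lambda>y T. blinfun_of (snd y) o\<^sub>L T) (map ((!) xs) [0..<length xs]) id_blinfun"
    by (simp only: map_nth)
  finally show ?thesis by (simp only: foldr_map o_def)
qed

lemma free_compression_of_free_sets:
  fixes A :: "'h::chilbert_space op set"
  assumes vn: "von_neumann_algebra A" and tr: "tracial_state A \<tau>" and ff: "faithful_on A \<tau>"
    and k: "k \<ge> 1" and e: "equal_trace_partition A \<tau> k e"
    and t: "0 < t" "t \<le> 1" and p: "p \<in> A" "is_projection p" "\<tau> p = complex_of_real t"
    and fr: "free_sets \<tau> {p} (diag_algebra k e)"
  shows "free_compression {T. blinfun_of T \<in> A} (\<lambda>T. Re (\<tau> (blinfun_of T))) k (\<lambda>i. Bop (e i)) (Bop p) t"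
proof -
  let ?A = "{T. blinfun_of T \<in> A}" and ?\<phi> = "\<lambda>T. Re (\<tau> (blinfun_of T))"
  interpret tracial_algebra ?A ?\<phi> by (rule tracial_algebra_of_vna(1)[OF vn tr ff])
  have e_in: "Bop (e i) \<in> ?A" and adj_e: "adj (Bop (e i)) (Bop (e i))" if "i < k" for i
    using e that by (auto simp: equal_trace_partition_def is_projection_def Bop_inverse intro: adj_if_is_adjoint)
  have p_in: "Bop p \<in> ?A" and adj_p: "adj (Bop p) (Bop p)"
    using p by (auto simp: is_projection_def Bop_inverse intro: adj_if_is_adjoint)
  show ?thesis
  proof
    show "k > 0" using k by simp
    fix i j assume i: "i < k"
    show "Bop (e i) \<in> ?A" "adj (Bop (e i)) (Bop (e i))" using e_in adj_e i by auto
    have "\<tau> (e i) = complex_of_real (1 / real k)" using e i by (simp add: equal_trace_partition_def)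
    then show "?\<phi> (Bop (e i)) = 1 / real k" by (simp add: Bop_inverse)
    assume j: "j < k"
    have "e i o\<^sub>L e j = (if i = j then e i else 0)"
      using e i j by (auto simp: equal_trace_partition_def is_projection_def)
    then show "Bop (e i) * Bop (e j) = (if i = j then Bop (e i) else 0)"
      by (simp add: Bop_zero flip: Bop_mult)
  next
    show "(\<Sum>i<k. Bop (e i)) = 1"
      using e by (simp add: equal_trace_partition_def Bop_id flip: Bop_sum)
    show "Bop p \<in> ?A" "adj (Bop p) (Bop p)" using p_in adj_p by auto
    show "Bop p * Bop p = Bop p" using p by (simp add: is_projection_def flip: Bop_mult)
    show "?\<phi> (Bop p) = t" using p by (simp add: Bop_inverse)
    show "0 < t" "t \<le> 1" by (rule t)+
  next
    fix xs :: "(bool \<times> 'h bop) list"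
    assume xs: "xs \<noteq> []" and alt: "successively (\<lambda>x y. fst x \<noteq> fst y) xs"
      and letters: "\<And>b X. (b, X) \<in> set xs \<Longrightarrow> ?\<phi> X = 0 \<and>
        (if b then \<exists>r s. X = r *\<^sub>R 1 + s *\<^sub>R Bop p else \<exists>c. X = (\<Sum>i<k. c i *\<^sub>R Bop (e i)))"
    \<comment> \<open>The letters are self-adjoint, so their complex trace is real, and a vanishing
      real part makes them centred for \<open>\<tau>\<close>.\<close>
    have letter: "\<tau> (blinfun_of X) = 0 \<and> blinfun_of X \<in> star_subalgebra hull (if b then {p} else diag_algebra k e)"
      if bX: "(b, X) \<in> set xs" for b X
    proof (cases b)
      case True
      then obtain r s where X: "X = r *\<^sub>R 1 + s *\<^sub>R Bop p" using letters[OF bX] by auto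
      have "X \<in> ?A" unfolding X by (intro add_closed scaleR_closed one_closed p_in)
      moreover have "adj X X" unfolding X by (intro adj_add adj_scaleR adj_one adj_p)
      ultimately have "Im (\<tau> (blinfun_of X)) = 0" by (rule tracial_algebra_of_vna(2)[OF vn tr ff])
      moreover have "blinfun_of X = r *\<^sub>R id_blinfun + s *\<^sub>R p"
        unfolding X by (simp add: plus_bop.rep_eq scaleR_bop.rep_eq one_bop.rep_eq Bop_inverse)
      ultimately show ?thesis
        using True letters[OF bX] hull_affine[of r s p] by (simp add: complex_eq_iff)
    next
      case False
      then obtain c where X: "X = (\<Sum>i<k. c i *\<^sub>R Bop (e i))" using letters[OF bX] by auto
      have "X \<in> ?A" unfolding X by (intro sum_closed scaleR_closed e_in) auto
      moreover have "adj X X" unfolding X by (intro adj_sum adj_scaleR adj_e) auto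
      ultimately have "Im (\<tau> (blinfun_of X)) = 0" by (rule tracial_algebra_of_vna(2)[OF vn tr ff])
      moreover have "blinfun_of X = (\<Sum>i<k. c i *\<^sub>R e i)"
      proof -
        have "X = Bop (\<Sum>i<k. c i *\<^sub>R e i)" unfolding X by (simp add: Bop_sum Bop_scaleR)
        then show ?thesis by (simp add: Bop_inverse)
      qed
      ultimately show ?thesis
        using False letters[OF bX] hull_diag[of c e k] by (simp add: complex_eq_iff)
    qed
    define c where "c i = fst (xs ! i)" for i
    define x where "x i = blinfun_of (snd (xs ! i))" for i
    have "\<tau> (foldr (\<lambda>i T. x i o\<^sub>L T) [0..<length xs] id_blinfun) = 0"
    proof -
      have "length xs > 0" using xs by simp
      moreover have "\<forall>i<length xs. x i \<in> star_subalgebra hull (if c i then {p} else diag_algebra k e) \<and> \<tau> (x i) = 0"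
        using letter[of "c i" "snd (xs ! i)" for i] unfolding c_def x_def by (simp add: nth_mem)
      moreover have "\<forall>i. Suc i < length xs \<longrightarrow> c i \<noteq> c (Suc i)"
        using alt unfolding c_def successively_conv_nth by simp
      ultimately show ?thesis using fr unfolding free_sets_def by blast
    qed
    then show "?\<phi> (prod_list (map snd xs)) = 0"
      unfolding blinfun_of_prod_list x_def by simp
  qed
qed

text \<open>The form of \<open>p a p\<close> is bounded above directly, and below by applying the
  same result to \<open>- a\<close>, that is, to the same projections with coefficients
  \<open>- \<alpha> i\<close>. The variance is unchanged, while the mean and the roles of
  \<open>Lm\<close> and \<open>Lp\<close> are reversed.\<close>

lemma compression_norm_le:
  fixes A :: "'h::chilbert_space op set"
  assumes vn: "von_neumann_algebra A" and tr: "tracial_state A \<tau>" and ff: "faithful_on A \<tau>"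
    and k: "k \<ge> 1" and e: "equal_trace_partition A \<tau> k e"
    and a: "a = (\<Sum>i<k. \<alpha> i *\<^sub>R e i)"
    and \<sigma>: "\<sigma> \<ge> 0" "complex_of_real (\<sigma>\<^sup>2) = \<tau> (a o\<^sub>L a) - (\<tau> a)\<^sup>2"
    and t: "0 < t" "t \<le> 1" and p: "p \<in> A" "is_projection p" "\<tau> p = complex_of_real t"
    and fr: "free_sets \<tau> {p} (diag_algebra k e)"
    and bounds: "\<And>i. i < k \<Longrightarrow> Lm \<le> \<alpha> i" "\<And>i. i < k \<Longrightarrow> \<alpha> i \<le> Lp"
  shows "compression_norm p a \<le> max \<bar>t * Lp + 2 * \<sigma> * sqrt (t * (1 - t)) + (1 - t) * Re (\<tau> a)\<bar>
                 \<bar>t * Lm - 2 * \<sigma> * sqrt (t * (1 - t)) + (1 - t) * Re (\<tau> a)\<bar>"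
proof -
  let ?A = "{T. blinfun_of T \<in> A}" and ?\<phi> = "\<lambda>T. Re (\<tau> (blinfun_of T))"
  interpret C: free_compression ?A ?\<phi> k \<alpha> "\<lambda>i. Bop (e i)" "Bop p" t
    by (rule free_compression_of_free_sets[OF vn tr ff k e t p fr])
  interpret N: free_compression ?A ?\<phi> k "\<lambda>i. - \<alpha> i" "\<lambda>i. Bop (e i)" "Bop p" t
    by (rule free_compression_of_free_sets[OF vn tr ff k e t p fr])
  have Ca: "C.a = Bop a" unfolding C.a_def C.diag_def a by (simp add: Bop_sum Bop_scaleR)
  have Na: "N.a = - C.a" unfolding C.a_def C.diag_def N.a_def N.diag_def by (simp add: sum_negf)
  have ba: "blinfun_of C.a = a" by (simp add: Ca Bop_inverse)
  have mean: "C.mean = Re (\<tau> a)" using C.\<phi>_diag[of \<alpha>] by (simp add: C.mean_def ba flip: C.a_def)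
  have im: "Im (\<tau> a) = 0"
    using tracial_algebra_of_vna(2)[OF vn tr ff, of C.a] C.a_in C.adj_a by (simp add: ba)
  have var: "C.var = \<sigma>\<^sup>2"
  proof -
    have "C.a * C.a = C.diag (\<lambda>i. (\<alpha> i)\<^sup>2)" by (simp add: C.a_def C.diag_mult power2_eq_square)
    then have "C.avg (\<lambda>i. (\<alpha> i)\<^sup>2) = Re (\<tau> (a o\<^sub>L a))"
      using C.\<phi>_diag[of "\<lambda>i. (\<alpha> i)\<^sup>2"] by (simp add: times_bop.rep_eq ba flip: \<open>C.a * C.a = _\<close>)
    moreover have "Re ((\<tau> a)\<^sup>2) = (Re (\<tau> a))\<^sup>2" using im by (simp add: power2_eq_square)
    moreover have "\<sigma>\<^sup>2 = Re (\<tau> (a o\<^sub>L a)) - Re ((\<tau> a)\<^sup>2)"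
      using arg_cong[OF \<sigma>(2), of Re] by simp
    ultimately show ?thesis by (simp add: C.var_eq mean)
  qed
  have Nmean: "N.mean = - C.mean" by (simp add: N.mean_def C.mean_def C.avg_def N.avg_def sum_negf)
  have Nvar: "N.var = C.var"
    unfolding N.var_eq C.var_eq Nmean by (simp add: C.avg_def N.avg_def)
  have sv: "sqrt C.var = \<sigma>" using \<sigma>(1) by (simp add: var)
  have NX: "N.X = - C.X" by (simp add: N.X_def C.X_def Na)
  define b1 where "b1 = t * Lp + 2 * \<sigma> * sqrt (t * (1 - t)) + (1 - t) * Re (\<tau> a)"
  define b2 where "b2 = t * Lm - 2 * \<sigma> * sqrt (t * (1 - t)) + (1 - t) * Re (\<tau> a)"
  have up: "ip x (app C.X x) \<le> b1 * (norm (app (Bop p) x))\<^sup>2" for x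
    using C.quadratic_form_le[OF bounds(2), of x] by (simp add: sv mean b1_def)
  have low: "b2 * (norm (app (Bop p) x))\<^sup>2 \<le> ip x (app C.X x)" for x
  proof -
    have "ip x (app N.X x) \<le> (t * (- Lm) + 2 * sqrt N.var * sqrt (t * (1 - t)) + (1 - t) * N.mean) * (norm (app (Bop p) x))\<^sup>2"
      by (rule N.quadratic_form_le) (use bounds(1) in simp)
    also have "t * (- Lm) + 2 * sqrt N.var * sqrt (t * (1 - t)) + (1 - t) * N.mean = - b2"
      by (simp add: Nvar sv Nmean mean b2_def)
    finally show ?thesis by (simp add: NX ip_linear)
  qed
  have "norm C.X \<le> max \<bar>b1\<bar> \<bar>b2\<bar>"
  proof (rule norm_le_of_quadratic[OF C.adj_X])
    fix x
    let ?n = "(norm (app (Bop p) x))\<^sup>2"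
    have "\<bar>ip x (app C.X x)\<bar> \<le> max \<bar>b1\<bar> \<bar>b2\<bar> * ?n"
    proof -
      have "b1 \<le> max \<bar>b1\<bar> \<bar>b2\<bar>" "- max \<bar>b1\<bar> \<bar>b2\<bar> \<le> b2" by linarith+
      then have "b1 * ?n \<le> max \<bar>b1\<bar> \<bar>b2\<bar> * ?n" "- max \<bar>b1\<bar> \<bar>b2\<bar> * ?n \<le> b2 * ?n"
        using mult_right_mono[of _ _ ?n] by (blast intro: zero_le_power2)+
      then show ?thesis using up[of x] low[of x] by (simp add: abs_le_iff)
    qed
    also have "\<dots> \<le> max \<bar>b1\<bar> \<bar>b2\<bar> * (norm x)\<^sup>2" by (intro mult_left_mono C.norm_p_le) simp
    finally show "\<bar>ip x (app C.X x)\<bar> \<le> max \<bar>b1\<bar> \<bar>b2\<bar> * (norm x)\<^sup>2" .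
  qed simp
  moreover have "C.X = Bop (p o\<^sub>L a o\<^sub>L p)" unfolding C.X_def Ca by (simp add: Bop_mult)
  ultimately show ?thesis by (simp add: compression_norm_def norm_Bop b1_def b2_def)
qed

text \<open>\<open>e i\<close> is nonzero because its trace is \<open>1 / k\<close>, and its range
  consists of eigenvectors. They turn operator inequalities and the norm of \<open>a\<close> into
  bounds on the coefficients.\<close>

lemma diag_coefficient_eigenvector:
  assumes "equal_trace_partition A \<tau> k e" "tracial_state A \<tau>" "i < k"
  obtains x where "x \<noteq> 0" "blinfun_apply (\<Sum>j<k. \<alpha> j *\<^sub>R e j) x = \<alpha> i *\<^sub>R x"
proof -
  have tr: "\<tau> (e i) = 1 / of_nat k" and ei: "e i \<in> A" "e i o\<^sub>L e i = e i"
    and orth: "\<And>j. j < k \<Longrightarrow> j \<noteq> i \<Longrightarrow> e j o\<^sub>L e i = 0"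
    using assms by (auto simp: equal_trace_partition_def is_projection_def)
  have "e i \<noteq> 0"
  proof
    assume z: "e i = 0"
    have "\<tau> (scalar_op 0 o\<^sub>L e i) = 0 * \<tau> (e i)" using assms(2) ei(1) unfolding tracial_state_def by blast
    moreover have "scalar_op 0 o\<^sub>L e i = e i" unfolding z by (rule blinfun_eqI) (simp add: blinfun.bilinear_simps)
    ultimately show False using tr assms(3) by simp
  qed
  then obtain y where y: "e i y \<noteq> 0" by (metis blinfun_eqI blinfun.zero_left)
  have "blinfun_apply (\<Sum>j<k. \<alpha> j *\<^sub>R e j) (e i y) = (\<Sum>j<k. if j = i then \<alpha> i *\<^sub>R e i y else 0)"
    unfolding blinfun.sum_left
  proof (intro sum.cong refl)
    fix j assume j: "j \<in> {..<k}"
    show "blinfun_apply (\<alpha> j *\<^sub>R e j) (e i y) = (if j = i then \<alpha> i *\<^sub>R e i y else 0)"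
    proof (cases "j = i")
      case True
      have "e i (e i y) = e i y" using ei(2) by (metis blinfun_apply_blinfun_compose)
      then show ?thesis using True by (simp add: blinfun.bilinear_simps)
    next
      case False
      have "e j (e i y) = 0" using orth[of j] j False by (metis blinfun.zero_left blinfun_apply_blinfun_compose lessThan_iff)
      then show ?thesis using False by (simp add: blinfun.bilinear_simps)
    qed
  qed
  also have "\<dots> = \<alpha> i *\<^sub>R e i y" using assms(3) by simp
  finally show ?thesis using that y by blast
qed

lemma op_le_scaled_idD:
  assumes "op_le (r *\<^sub>R id_blinfun) a" "a x = c *\<^sub>R x" "x \<noteq> 0"
  shows "r \<le> c"
proof -
  have "cinner x ((a - r *\<^sub>R id_blinfun) x) \<in> \<real>\<^sub>\<ge>\<^sub>0" using assms(1) by (simp add: op_le_def)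
  then have "0 \<le> ip x ((a - r *\<^sub>R id_blinfun) x)" by (simp add: ip_def complex_nonneg_Reals_iff)
  also have "(a - r *\<^sub>R id_blinfun) x = (c - r) *\<^sub>R x"
    using assms(2) by (simp add: blinfun.bilinear_simps scaleR_diff_left)
  finally have "0 \<le> (c - r) * (norm x)\<^sup>2" by (simp add: ip_linear ip_self)
  then show ?thesis using assms(3) by (simp add: zero_le_mult_iff)
qed

lemma op_le_scaled_idD':
  assumes "op_le a (r *\<^sub>R id_blinfun)" "a x = c *\<^sub>R x" "x \<noteq> 0"
  shows "c \<le> r"
proof -
  have "cinner x ((r *\<^sub>R id_blinfun - a) x) \<in> \<real>\<^sub>\<ge>\<^sub>0" using assms(1) by (simp add: op_le_def)
  then have "0 \<le> ip x ((r *\<^sub>R id_blinfun - a) x)" by (simp add: ip_def complex_nonneg_Reals_iff)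
  also have "(r *\<^sub>R id_blinfun - a) x = (r - c) *\<^sub>R x"
    using assms(2) by (simp add: blinfun.bilinear_simps scaleR_diff_left)
  finally have "0 \<le> (r - c) * (norm x)\<^sup>2" by (simp add: ip_linear ip_self)
  then show ?thesis using assms(3) by (simp add: zero_le_mult_iff)
qed

text \<open>An atom of mass \<open>c\<close> of the free power at \<open>y\<close> comes from an
  atom at \<open>t * y\<close> of mass \<open>(c + s) / (1 + s)\<close>, which exceeds
  \<open>s / (1 + s) = 1 - t\<close>. Conversely, every atom heavier than \<open>1 - t\<close>
  survives, with its position scaled by \<open>1 / t\<close>.\<close>

lemma (in uniform_atoms) emeasure_free_power_atoms:
  assumes t: "0 < t" "t \<le> 1"
  shows "(\<And>x. real (card {j. j < k \<and> \<alpha> j = x}) \<le> real k * (1 - t)) \<Longrightarrow>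
      emeasure (free_power (diag_distribution k \<alpha>) (1 / t)) {y} = 0"
    and "real k * (1 - t) < real (card {j. j < k \<and> \<alpha> j = x}) \<Longrightarrow>
      \<exists>y. emeasure (free_power (diag_distribution k \<alpha>) (1 / t)) {y} \<noteq> 0"
proof -
  define s where "s = (1 - t) / t"
  interpret subordination k \<alpha> s by standard (use t in \<open>simp add: s_def\<close>)
  have s1: "1 / t = 1 + s" using t by (simp add: s_def field_simps)
  let ?\<nu> = "free_power (diag_distribution k \<alpha>) (1 + s)"
  interpret \<nu>: prob_space ?\<nu> by (rule prob_free_power)
  { assume le: "\<And>x. real (card {j. j < k \<and> \<alpha> j = x}) \<le> real k * (1 - t)"
    have "\<nu>.prob {y} = 0"
    proof (rule ccontr)
      assume "\<nu>.prob {y} \<noteq> 0"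
      then have c: "\<nu>.prob {y} > 0" by (simp add: zero_less_measure_iff)
      have "(\<nu>.prob {y} + s) / (1 + s) = real (card {j. j < k \<and> \<alpha> j = y / (1 + s)}) / k"
        unfolding atom_of_free_power_atom[OF c, symmetric] by (rule measure_diag_distribution)
      also have "\<dots> \<le> 1 - t" using le[of "y / (1 + s)"] k_pos by (simp add: divide_le_eq mult.commute)
      also have "1 - t = s / (1 + s)" unfolding s1[symmetric] using t by (simp add: s_def)
      finally show False using c s_nonneg by (simp add: divide_le_cancel)
    qed
    then show "emeasure (free_power (diag_distribution k \<alpha>) (1 / t)) {y} = 0"
      unfolding s1 by (simp add: \<nu>.emeasure_eq_measure) }
  { assume gt: "real k * (1 - t) < real (card {j. j < k \<and> \<alpha> j = x})"
    let ?q = "measure (diag_distribution k \<alpha>) {x}"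
    have "?q > 1 - t" using gt k_pos by (simp add: measure_diag_distribution less_divide_eq mult.commute)
    then have "(1 + s) * ?q > (1 + s) * (1 - t)" using s_nonneg by (intro mult_strict_left_mono) auto
    also have "(1 + s) * (1 - t) = s" unfolding s1[symmetric] by (simp add: s_def)
    finally have q: "(1 + s) * ?q > s" .
    have "\<nu>.prob {(1 + s) * x} > 0" unfolding atom_free_power[OF q] using q by simp
    then show "\<exists>y. emeasure (free_power (diag_distribution k \<alpha>) (1 / t)) {y} \<noteq> 0"
      unfolding s1 by (intro exI[of _ "(1 + s) * x"]) (simp add: \<nu>.emeasure_eq_measure) }
qed

theorem theorem2p10:
  fixes A :: "'h::chilbert_space op set"
    and \<tau> :: "'h op \<Rightarrow> complex"
    and e :: "nat \<Rightarrow> 'h op"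
    and a p :: "'h op"
    and k m :: nat
    and \<alpha> \<xi> :: "nat \<Rightarrow> real"
    and D :: "nat \<Rightarrow> nat"
    and t \<sigma> Lm Lp \<beta> :: real
  assumes "II1_factor A"
    and "tracial_state A \<tau>" and "faithful_on A \<tau>" and "normal_on A \<tau>"
    and "k \<ge> 1"
    and "equal_trace_partition A \<tau> k e"
    and "a = (\<Sum>i<k. \<alpha> i *\<^sub>R e i)"
    and "bij_betw \<xi> {1..m} (\<alpha> ` {..<k})"
    and "\<forall>i\<in>{1..m}. D i = card {j. j < k \<and> \<alpha> j = \<xi> i}"
    and "\<forall>i\<in>{1..m}. \<forall>j\<in>{1..m}. i \<le> j \<longrightarrow> D j \<le> D i"
    and "\<sigma> \<ge> 0" and "complex_of_real (\<sigma>\<^sup>2) = \<tau> (a o\<^sub>L a) - (\<tau> a)\<^sup>2"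
    and "0 < t" and "t \<le> 1"
    and "p \<in> A" and "is_projection p" and "\<tau> p = complex_of_real t"
    and "free_sets \<tau> {p} (diag_algebra k e)"
    and "op_le (Lm *\<^sub>R id_blinfun) a" and "op_le a (Lp *\<^sub>R id_blinfun)"
    and "\<beta> = max \<bar>t * Lp + 2 * \<sigma> * sqrt (t * (1 - t)) + (1 - t) * Re (\<tau> a)\<bar>
                 \<bar>t * Lm - 2 * \<sigma> * sqrt (t * (1 - t)) + (1 - t) * Re (\<tau> a)\<bar>"
  shows
    "(real (D 1) \<le> real k * (1 - t) \<longrightarrow>
        (\<forall>x. emeasure (free_power (diag_distribution k \<alpha>) (1 / t)) {x} = 0)
        \<and> compression_norm p a \<le> \<beta>)
   \<and> (m = k \<and> t \<le> 1 - 1 / real k \<longrightarrow>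
        compression_norm p a \<le> \<beta>
        \<and> (\<tau> a = 0 \<longrightarrow>
             compression_norm p a \<le> t * norm a + 2 * \<sigma> * sqrt (t * (1 - t))))
   \<and> (real (D 1) > real k * (1 - t) \<longrightarrow>
        (\<exists>x. emeasure (free_power (diag_distribution k \<alpha>) (1 / t)) {x} \<noteq> 0)
        \<and> compression_norm p a
            \<le> max (Max {\<xi> i | i. i \<in> {1..m} \<and> real (D i) > real k * (1 - t)}) \<beta>)"
proof -
  interpret uniform_atoms k \<alpha> by standard (use assms(5) in simp)
  have vn: "von_neumann_algebra A" using assms(1) by (simp add: II1_factor_def vn_factor_def)
  note bound = compression_norm_le[OF vn assms(2,3,5,6,7,11,12,13,14,15,16,17,18)]
  have eig: "\<exists>x. x \<noteq> 0 \<and> a x = \<alpha> i *\<^sub>R x" if "i < k" for i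
    using diag_coefficient_eigenvector[OF assms(6,2) that] unfolding assms(7) by metis
  have norm_bound: "compression_norm p a \<le> \<beta>"
    unfolding assms(21)
    by (rule bound) (use eig op_le_scaled_idD[OF assms(19)] op_le_scaled_idD'[OF assms(20)] in blast)+
  \<comment> \<open>The same bound with \<open>norm a\<close> and \<open>- norm a\<close> as
    spectral bounds; for trace 0 the two members of the maximum agree up to sign.\<close>
  have "compression_norm p a \<le> t * norm a + 2 * \<sigma> * sqrt (t * (1 - t))" if "\<tau> a = 0"
  proof -
    have \<alpha>: "\<bar>\<alpha> i\<bar> \<le> norm a" if i: "i < k" for i
    proof -
      obtain x where x: "x \<noteq> 0" "a x = \<alpha> i *\<^sub>R x" using eig[OF i] by blast
      then have "\<bar>\<alpha> i\<bar> * norm x \<le> norm a * norm x" using norm_blinfun[of a x] by simp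
      then show ?thesis using x(1) by simp
    qed
    have "compression_norm p a \<le> max \<bar>t * norm a + 2 * \<sigma> * sqrt (t * (1 - t)) + (1 - t) * Re (\<tau> a)\<bar>
        \<bar>t * (- norm a) - 2 * \<sigma> * sqrt (t * (1 - t)) + (1 - t) * Re (\<tau> a)\<bar>"
      by (rule bound) (use \<alpha> in \<open>auto simp: abs_le_iff minus_le_iff\<close>)
    moreover have "0 \<le> t * norm a + 2 * \<sigma> * sqrt (t * (1 - t))"
      using assms(11,13,14) by simp
    ultimately show ?thesis using that by simp
  qed
  moreover have one: "1 \<in> {1..m}"
  proof -
    have "\<alpha> ` {..<k} \<noteq> {}" using assms(5) by (auto simp: lessThan_empty_iff)
    then have "{1..m} \<noteq> {}" using assms(8) by (metis bij_betw_imp_surj_on image_empty)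
    then show ?thesis by auto
  qed
  have D1: "D 1 = card {j. j < k \<and> \<alpha> j = \<xi> 1}" using assms(9) one by blast
  \<comment> \<open>The ordering of \<open>D\<close> makes \<open>D 1\<close> the largest
    multiplicity; points outside the spectrum have multiplicity 0.\<close>
  have mult_le: "card {j. j < k \<and> \<alpha> j = x} \<le> D 1" for x
  proof (cases "x \<in> \<alpha> ` {..<k}")
    case True
    then obtain i where "i \<in> {1..m}" "x = \<xi> i" using assms(8) by (metis bij_betw_iff_bijections)
    then show ?thesis using assms(9,10) one by auto
  next
    case False
    then have "{j. j < k \<and> \<alpha> j = x} = {}" by auto
    then show ?thesis by (metis card.empty le0)
  qed
  have "emeasure (free_power (diag_distribution k \<alpha>) (1 / t)) {x} = 0" if "real (D 1) \<le> real k * (1 - t)" for x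
    by (rule emeasure_free_power_atoms(1)[OF assms(13,14)])
      (use mult_le that in \<open>metis of_nat_le_iff order.trans\<close>)
  moreover have "\<exists>x. emeasure (free_power (diag_distribution k \<alpha>) (1 / t)) {x} \<noteq> 0" if "real (D 1) > real k * (1 - t)"
    using emeasure_free_power_atoms(2)[OF assms(13,14)] that unfolding D1 .
  ultimately show ?thesis
    using norm_bound by (intro conjI impI allI) (auto simp: le_max_iff_disj)
qed

end
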